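(* Let $K$ be a field and let $G$ be the graph with vertex set $\{1,2,3,4,5,6\}$ and the seven edges $$e_1=\{1,3\},\ e_2=\{2,3\},\ e_3=\{1,4\},\ e_4=\{2,4\},\ e_5=\{1,5\},\ e_6=\{5,6\},\ e_7=\{2,6\}.$$ Then the cut ideal $I_G$ has quadratic Gröbner bases, and none of them is lexicographic or reverse lexicographic; that is, there is a monomial order with respect to which $I_G$ has a quadratic Gröbner basis, but there is no lexicographic order and no reverse lexicographic order with respect to which $I_G$ has a quadratic Gröbner basis. In particular, $I_G$ is a counterexample to the following conjecture: if a toric ideal $I_A$ of a configuration $A$ has a quadratic Gröbner basis, then $I_A$ has either a lexicographic or a reverse lexicographic quadratic Gröbner basis.
   Context: Toric ideals: a $d\times n$ integer matrix $A=(\mathbf a_1,\dots,\mathbf a_n)$ with columns $\mathbf a_i$ is a configuration if there is $\mathbf c\in\mathbb R^d$ with $\mathbf a_i\cdot\mathbf c=1$ for all $i$. For a field $K$, the toric ideal $I_A$ is the kernel of the $K$-algebra homomorphism $K[x_1,\dots,x_n]\to K[t_1^{\pm1},\dots,t_d^{\pm1}]$, $x_i\mapsto \mathbf t^{\mathbf a_i}=t_1^{a_{1i}}\cdots t_d^{a_{di}}$. Cut ideals: let $G$ be a finite connected simple graph with vertex set $V(G)=\{1,\dots,m\}$ and edge set $E(G)=\{e_1,\dots,e_r\}$. For $C\subset V(G)$ let $\delta_C=(d_1,\dots,d_r)\in\{0,1\}^r$, where $d_i=1$ if $|C\cap e_i|=1$ and $d_i=0$ otherwise. Let $\delta_{C_1},\dots,\delta_{C_N}$,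 $N=2^{m-1}$, be the distinct elements of $\{\delta_C \mid C\subset V(G)\}$. Let $A_G$ be the $(r+1)\times N$ matrix whose $j$-th column is $\delta_{C_j}$ followed by an additional last entry $1$. The cut ideal $I_G\subset K[x_1,\dots,x_N]$ is the toric ideal of $A_G$. Gröbner bases: a quadratic Gröbner basis of an ideal is a Gröbner basis, with respect to some monomial order, consisting of quadratic binomials. It is called lexicographic (resp. reverse lexicographic) if the monomial order is the lexicographic (resp. graded reverse lexicographic) order induced by some total ordering of the variables. *)

theory Defs
  imports
    "HOL-Library.Poly_Mapping"
    "Jordan_Normal_Form.Matrix"
begin

section \<open>Polynomials in the variables \<open>x\<^sub>0, \<dots>, x\<^bsub>n-1\<^esub>\<close>\<close>

text \<open>
  A monomial is identified with its exponent, of type \<open>nat \<Rightarrow>\<^sub>0 nat\<close>. The ring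
  \<open>K[x\<^sub>0, \<dots>, x\<^bsub>n-1\<^esub>]\<close> is the subring \<open>poly_ring n\<close> of the ring of polynomials in countably
  many variables. Variables, matrix columns and matrix rows are numbered from 0.
\<close>

type_synonym mon = "nat \<Rightarrow>\<^sub>0 nat"
type_synonym 'k mpoly = "mon \<Rightarrow>\<^sub>0 'k"

definition monomials :: "nat \<Rightarrow> mon set" where
  "monomials n = {u. Poly_Mapping.keys u \<subseteq> {..<n}}"

definition mon_degree :: "mon \<Rightarrow> nat" where
  "mon_degree u = (\<Sum>i\<in>Poly_Mapping.keys u. Poly_Mapping.lookup u i)"

definition poly_ring :: "nat \<Rightarrow> 'k::zero mpoly set" where
  "poly_ring n = {p. Poly_Mapping.keys p \<subseteq> monomials n}"

abbreviation mon_poly :: "mon \<Rightarrow> 'k::field mpoly" where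
  "mon_poly u \<equiv> Poly_Mapping.single u 1"

definition ideal_generated :: "nat \<Rightarrow> 'k::field mpoly set \<Rightarrow> 'k mpoly set" where
  "ideal_generated n S =
     {\<Sum>s\<in>F. q s * s | F q. finite F \<and> F \<subseteq> S \<and> (\<forall>s\<in>F. q s \<in> poly_ring n)}"


section \<open>Toric ideals\<close>

definition configuration :: "int mat \<Rightarrow> bool" where
  "configuration A \<longleftrightarrow>
     (\<exists>c \<in> carrier_vec (dim_row A). \<forall>j < dim_col A. map_vec real_of_int (col A j) \<bullet> c = 1)"

text \<open>
  Laurent polynomials in the \<open>t\<^sub>i\<close> are finitely supported functions on integer exponents, and
  \<open>laurent_monomial a\<close> is \<open>\<Prod>\<^sub>i t\<^sub>i\<^bsup>a i\<^esup>\<close>.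
\<close>

type_synonym 'k laurent = "(nat \<Rightarrow>\<^sub>0 int) \<Rightarrow>\<^sub>0 'k"

definition laurent_monomial :: "int vec \<Rightarrow> 'k::field laurent" where
  "laurent_monomial a =
     Poly_Mapping.single (\<Sum>i<dim_vec a. Poly_Mapping.single i (a $ i)) 1"

text \<open>The \<open>K\<close>-algebra homomorphism that sends \<open>x\<^sub>j\<close> to the Laurent monomial of column \<open>j\<close>.\<close>

definition toric_map :: "int mat \<Rightarrow> 'k::field mpoly \<Rightarrow> 'k laurent" where
  "toric_map A p =
     (\<Sum>u\<in>Poly_Mapping.keys p. Poly_Mapping.single 0 (Poly_Mapping.lookup p u) *
        (\<Prod>j\<in>Poly_Mapping.keys u. laurent_monomial (col A j) ^ Poly_Mapping.lookup u j))"

definition toric_ideal :: "int mat \<Rightarrow> 'k::field mpoly set" where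
  "toric_ideal A = {p \<in> poly_ring (dim_col A). toric_map A p = 0}"


section \<open>Cut ideals\<close>

text \<open>
  A graph is given by its vertex set and the list \<open>es\<close> of its edges. As the numbering of the
  distinct cut vectors is not prescribed, it is a parameter: a list \<open>ds\<close> that contains each
  cut vector exactly once.
\<close>

definition cut_vector :: "nat set list \<Rightarrow> nat set \<Rightarrow> int vec" where
  "cut_vector es C = vec (length es) (\<lambda>i. if card (C \<inter> es ! i) = 1 then 1 else 0)"

definition cut_enumeration :: "nat set \<Rightarrow> nat set list \<Rightarrow> int vec list \<Rightarrow> bool" where
  "cut_enumeration V es ds \<longleftrightarrow> distinct ds \<and> set ds = cut_vector es ` Pow V"

definition cut_matrix :: "nat set list \<Rightarrow> int vec list \<Rightarrow> int mat" where
  "cut_matrix es ds =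
     mat_of_cols (length es + 1) (map (\<lambda>\<delta>. \<delta> @\<^sub>v vec_of_list [1]) ds)"

definition cut_ideal :: "nat set list \<Rightarrow> int vec list \<Rightarrow> 'k::field mpoly set" where
  "cut_ideal es ds = toric_ideal (cut_matrix es ds)"


section \<open>Monomial orders\<close>

text \<open>
  Orders are reflexive relations; \<open>(u, v) \<in> ord\<close> reads \<open>u \<le> v\<close>. That a monomial order is a
  well-order follows from the clauses below by Dickson's lemma.
\<close>

definition monomial_order :: "nat \<Rightarrow> mon rel \<Rightarrow> bool" where
  "monomial_order n ord \<longleftrightarrow>
     linear_order_on (monomials n) ord \<and>
     (\<forall>u\<in>monomials n. (0, u) \<in> ord) \<and>
     (\<forall>u v. \<forall>w\<in>monomials n. (u, v) \<in> ord \<longrightarrow> (u + w, v + w) \<in> ord)"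

text \<open>
  Below, \<open>r\<close> is a linear order on the indices of the variables; \<open>(i, j) \<in> r\<close> reads
  \<open>x\<^sub>i \<le> x\<^sub>j\<close>.
\<close>

definition lex_order :: "nat \<Rightarrow> nat rel \<Rightarrow> mon rel" where
  "lex_order n r = {(u, v). u \<in> monomials n \<and> v \<in> monomials n \<and>
     (u = v \<or>
      (\<exists>i<n. Poly_Mapping.lookup u i < Poly_Mapping.lookup v i \<and>
         (\<forall>j<n. j \<noteq> i \<and> (i, j) \<in> r \<longrightarrow> Poly_Mapping.lookup u j = Poly_Mapping.lookup v j)))}"

definition grevlex_order :: "nat \<Rightarrow> nat rel \<Rightarrow> mon rel" where
  "grevlex_order n r = {(u, v). u \<in> monomials n \<and> v \<in> monomials n \<and>
     (u = v \<or> mon_degree u < mon_degree v \<or>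
      mon_degree u = mon_degree v \<and>
      (\<exists>i<n. Poly_Mapping.lookup v i < Poly_Mapping.lookup u i \<and>
         (\<forall>j<n. j \<noteq> i \<and> (j, i) \<in> r \<longrightarrow> Poly_Mapping.lookup u j = Poly_Mapping.lookup v j)))}"


section \<open>Quadratic Groebner bases\<close>

text \<open>Only meaningful for \<open>p \<noteq> 0\<close>.\<close>

definition initial_monomial :: "mon rel \<Rightarrow> 'k::field mpoly \<Rightarrow> mon" where
  "initial_monomial ord p =
     (THE u. u \<in> Poly_Mapping.keys p \<and> (\<forall>v\<in>Poly_Mapping.keys p. (v, u) \<in> ord))"

definition initial_ideal :: "nat \<Rightarrow> mon rel \<Rightarrow> 'k::field mpoly set \<Rightarrow> 'k mpoly set" where
  "initial_ideal n ord I =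
     ideal_generated n {mon_poly (initial_monomial ord f) | f. f \<in> I \<and> f \<noteq> 0}"

definition groebner_basis ::
    "nat \<Rightarrow> mon rel \<Rightarrow> 'k::field mpoly set \<Rightarrow> 'k mpoly set \<Rightarrow> bool" where
  "groebner_basis n ord I G \<longleftrightarrow>
     finite G \<and> G \<subseteq> I \<and>
     initial_ideal n ord I =
       ideal_generated n {mon_poly (initial_monomial ord g) | g. g \<in> G \<and> g \<noteq> 0}"

text \<open>A binomial of degree 2; as usual for toric ideals, a binomial is a difference of two
  distinct monomials.\<close>

definition quadratic_binomial :: "'k::field mpoly \<Rightarrow> bool" where
  "quadratic_binomial g \<longleftrightarrow>
     (\<exists>u v. u \<noteq> v \<and> g = mon_poly u - mon_poly v \<and> max (mon_degree u) (mon_degree v) = 2)"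

definition has_quadratic_groebner_basis ::
    "nat \<Rightarrow> mon rel \<Rightarrow> 'k::field mpoly set \<Rightarrow> bool" where
  "has_quadratic_groebner_basis n ord I \<longleftrightarrow>
     (\<exists>G. groebner_basis n ord I G \<and> (\<forall>g\<in>G. quadratic_binomial g))"

definition has_some_quadratic_gb :: "nat \<Rightarrow> 'k::field mpoly set \<Rightarrow> bool" where
  "has_some_quadratic_gb n I \<longleftrightarrow>
     (\<exists>ord. monomial_order n ord \<and> has_quadratic_groebner_basis n ord I)"

definition has_lex_quadratic_gb :: "nat \<Rightarrow> 'k::field mpoly set \<Rightarrow> bool" where
  "has_lex_quadratic_gb n I \<longleftrightarrow>
     (\<exists>r. linear_order_on {..<n} r \<and> has_quadratic_groebner_basis n (lex_order n r) I)"

definition has_revlex_quadratic_gb :: "nat \<Rightarrow> 'k::field mpoly set \<Rightarrow> bool" where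
  "has_revlex_quadratic_gb n I \<longleftrightarrow>
     (\<exists>r. linear_order_on {..<n} r \<and> has_quadratic_groebner_basis n (grevlex_order n r) I)"

definition lex_revlex_conjecture :: "'k::field itself \<Rightarrow> bool" where
  "lex_revlex_conjecture _ \<longleftrightarrow>
     (\<forall>A. configuration A \<longrightarrow>
        has_some_quadratic_gb (dim_col A) (toric_ideal A :: 'k mpoly set) \<longrightarrow>
        has_lex_quadratic_gb (dim_col A) (toric_ideal A :: 'k mpoly set) \<or>
        has_revlex_quadratic_gb (dim_col A) (toric_ideal A :: 'k mpoly set))"

end

theory Submission
  imports Defs "HOL-Library.Multiset"
begin

text \<open>
  The graph consists of three paths from vertex 1 to vertex 2, two of length 2 and one of
  length 3. A 0/1 vector on the edges is a cut vector iff it has the same parity on all three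
  paths; so there are 32 cuts, and they form a linear code over the field with two elements. A
  monomial is a multiset of cuts, and two monomials are congruent modulo the cut ideal iff
  they lie in the same fibre, that is, have the same degree and contain every edge equally
  often. For any monomial order, a quadratic Groebner basis exists iff each monomial that is
  not the least one of its fibre contains a pair of cuts that is not the least one of its own
  fibre (\<open>quadratic_gb_reduces\<close>, \<open>quadratic_gb_if_reduces\<close>). All
  three claims thus become statements about fibres of cuts.

  Existence. Give each cut a weight between 0 and 7 and replace pairs by lighter pairs of the
  same fibre. This rewriting terminates. Two rewrite steps that overlap live inside a cubic,
  and a finite computation (\<open>light_lists_separated\<close>) shows that no fibre of
  degree at most 3 contains two irreducible monomials; hence the rewriting is confluent. As
  every fibre is connected by exchanges of pairs (\<open>fibre_connected\<close>), it contains
  only one irreducible monomial (\<open>normal_unique\<close>), and this is the least one for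
  the order that compares weights first.

  Non-existence. If an order has a quadratic Groebner basis, then no cubic fibre contains two
  monomials all of whose pairs are least in their fibres (\<open>unique_cubics_if_gb\<close>).
  For each lexicographic and each reverse lexicographic order, such a fibre exists. In the
  lexicographic case one looks only at cuts without the last edge: let \<open>{w, w'}\<close>
  be the least pair of complementary ones and \<open>m\<close> the largest variable whose
  parity differs from that of \<open>w\<close>. Then \<open>m w w'\<close> is in one fibre
  with the product of the three neighbours of \<open>m\<close>, and both consist of least
  pairs (\<open>no_lex\<close>).

  In the reverse lexicographic case, the least pair of a fibre is the one that contains the
  smallest variable. By symmetry the smallest variable is the empty cut. It occurs in the
  cubic fibres that are attached to most cuts and so yields a cubic of least pairs in them;
  every other one is a contradiction. Following the smallest variable of odd parity, which up
  to symmetry is one of two cuts, this determines the order so far that it becomes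
  contradictory (\<open>no_revlex\<close>).
\<close>

section \<open>Binomials and Groebner bases of toric ideals\<close>

text \<open>
  The exponent of the Laurent monomial to which the monomial \<open>u\<close> is sent.
\<close>

definition torus_degree :: "int mat \<Rightarrow> mon \<Rightarrow> (nat \<Rightarrow>\<^sub>0 int)" where
  "torus_degree A u = (\<Sum>j\<in>Poly_Mapping.keys u. \<Sum>i<dim_row A.
     Poly_Mapping.single i (int (Poly_Mapping.lookup u j) * col A j $ i))"

lemma lookup_torus_degree:
  "Poly_Mapping.lookup (torus_degree A u) i =
     (if i < dim_row A then \<Sum>j\<in>Poly_Mapping.keys u. int (Poly_Mapping.lookup u j) * col A j $ i else 0)"
proof -
  have "Poly_Mapping.lookup (torus_degree A u) i = (\<Sum>j\<in>Poly_Mapping.keys u. \<Sum>k<dim_row A.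
     (if k = i then int (Poly_Mapping.lookup u j) * col A j $ k else 0))"
    unfolding torus_degree_def lookup_sum lookup_single
    by (simp add: when_def)
  then show ?thesis by (simp add: sum.delta)
qed

lemma single_power:
  fixes m :: "nat \<Rightarrow>\<^sub>0 int"
  shows "(Poly_Mapping.single m (1::'k::field)) ^ k = Poly_Mapping.single (\<Sum>_<k. m) 1"
  by (induction k) (simp_all add: mult_single add.commute del: sum_constant)

lemma prod_single:
  fixes f :: "'a \<Rightarrow> (nat \<Rightarrow>\<^sub>0 int)"
  shows "(\<Prod>x\<in>S. Poly_Mapping.single (f x) (1::'k::field)) = Poly_Mapping.single (\<Sum>x\<in>S. f x) 1"
  by (induction S rule: infinite_finite_induct) (simp_all add: mult_single)

lemma toric_map_eq_sum_single:
  "toric_map A (p :: 'k::field mpoly) = (\<Sum>u\<in>Poly_Mapping.keys p.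
     Poly_Mapping.single (torus_degree A u) (Poly_Mapping.lookup p u))"
proof -
  have scale: "(\<Sum>_<k. \<Sum>i<n. Poly_Mapping.single i (f i)) = (\<Sum>i<n. Poly_Mapping.single i (int k * f i))"
    for k n and f :: "nat \<Rightarrow> int"
    by (induction k) (simp_all add: distrib_right single_add sum.distrib)
  have "(\<Prod>j\<in>Poly_Mapping.keys u. laurent_monomial (col A j) ^ Poly_Mapping.lookup u j) =
      Poly_Mapping.single (torus_degree A u) (1::'k)" for u
    unfolding laurent_monomial_def torus_degree_def single_power prod_single
    by (simp only: scale) simp
  then show ?thesis
    unfolding toric_map_def by (simp add: mult_single)
qed

text \<open>
  The Laurent monomials are linearly independent, so the coefficients of a polynomial in the
  kernel cancel separately within each set of monomials with the same image.
\<close>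

lemma toric_map_eq_0_iff:
  "toric_map A p = 0 \<longleftrightarrow>
     (\<forall>e. (\<Sum>u | u \<in> Poly_Mapping.keys p \<and> torus_degree A u = e. Poly_Mapping.lookup p u) = 0)"
proof -
  have "Poly_Mapping.lookup (toric_map A p) e =
      (\<Sum>u\<in>Poly_Mapping.keys p. if torus_degree A u = e then Poly_Mapping.lookup p u else 0)" for e
    unfolding toric_map_eq_sum_single lookup_sum lookup_single by (simp add: when_def)
  also have "\<dots> e = (\<Sum>u | u \<in> Poly_Mapping.keys p \<and> torus_degree A u = e. Poly_Mapping.lookup p u)" for e
    by (simp add: sum.inter_filter)
  finally show ?thesis by (simp add: poly_mapping_eq_iff fun_eq_iff)
qed

lemma keys_binomial:
  "u \<noteq> v \<Longrightarrow> Poly_Mapping.keys (mon_poly u - mon_poly v :: 'k::field mpoly) = {u, v}"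
  by (auto simp: in_keys_iff lookup_minus lookup_single when_def split: if_splits)

lemma binomial_in_toric_ideal_iff:
  assumes "u \<in> monomials (dim_col A)" "v \<in> monomials (dim_col A)" "u \<noteq> v"
  shows "(mon_poly u - mon_poly v :: 'k::field mpoly) \<in> toric_ideal A \<longleftrightarrow>
    torus_degree A u = torus_degree A v"
proof -
  let ?p = "mon_poly u - mon_poly v :: 'k mpoly"
  have l: "Poly_Mapping.lookup ?p u = 1" "Poly_Mapping.lookup ?p v = -1"
    using assms(3) by (auto simp: lookup_minus lookup_single when_def)
  have m: "?p \<in> poly_ring (dim_col A)"
    using assms by (simp add: poly_ring_def keys_binomial)
  show ?thesis
  proof (cases "torus_degree A u = torus_degree A v")
    case True
    have "(\<Sum>w | w \<in> {u, v} \<and> torus_degree A w = e. Poly_Mapping.lookup ?p w) = 0" for e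
    proof (cases "torus_degree A u = e")
      case t: True
      have "{w. w \<in> {u, v} \<and> torus_degree A w = e} = {u, v}" using t True by auto
      then show ?thesis using assms(3) l by simp
    next
      case False
      then have "{w. w \<in> {u, v} \<and> torus_degree A w = e} = {}" using True by auto
      then show ?thesis by (simp only: sum.empty)
    qed
    then have "toric_map A ?p = 0" unfolding toric_map_eq_0_iff keys_binomial[OF assms(3)] by blast
    then show ?thesis using True m by (simp add: toric_ideal_def)
  next
    case False
    have "{w. w \<in> {u, v} \<and> torus_degree A w = torus_degree A u} = {u}" using False by auto
    then have "(\<Sum>w | w \<in> {u, v} \<and> torus_degree A w = torus_degree A u. Poly_Mapping.lookup ?p w) = 1"
      using l by simp
    then have "toric_map A ?p \<noteq> 0" unfolding toric_map_eq_0_iff keys_binomial[OF assms(3)]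
      by (metis zero_neq_one)
    then show ?thesis using False by (simp add: toric_ideal_def)
  qed
qed

text \<open>
  A single term cannot cancel on its own. Applied to the initial monomial of an element of the
  ideal, this yields a smaller monomial with the same image.
\<close>

lemma toric_ideal_key_partner:
  assumes "f \<in> toric_ideal A" "u \<in> Poly_Mapping.keys f"
  obtains v where "v \<in> Poly_Mapping.keys f" "v \<noteq> u" "torus_degree A v = torus_degree A u"
proof (rule ccontr)
  assume "\<not> thesis"
  then have "{w. w \<in> Poly_Mapping.keys f \<and> torus_degree A w = torus_degree A u} = {u}"
    using that assms(2) by auto
  moreover have "(\<Sum>w | w \<in> Poly_Mapping.keys f \<and> torus_degree A w = torus_degree A u.
      Poly_Mapping.lookup f w) = 0"
    using assms(1) unfolding toric_ideal_def toric_map_eq_0_iff by blast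
  ultimately have "Poly_Mapping.lookup f u = 0" by simp
  then show False using assms(2) by (simp add: in_keys_iff)
qed

lemma initial_monomialI:
  assumes "antisym ord" "u \<in> Poly_Mapping.keys p" "\<And>v. v \<in> Poly_Mapping.keys p \<Longrightarrow> (v, u) \<in> ord"
  shows "initial_monomial ord p = u"
  unfolding initial_monomial_def using assms by (intro the_equality) (auto dest: antisymD)

lemma initial_monomial_binomial:
  assumes "antisym ord" "(u, u) \<in> ord" "(v, u) \<in> ord" "u \<noteq> v"
  shows "initial_monomial ord (mon_poly u - mon_poly v :: 'k::field mpoly) = u"
    and "initial_monomial ord (mon_poly v - mon_poly u :: 'k::field mpoly) = u"
  using assms by (auto intro!: initial_monomialI simp: keys_binomial)

lemma finite_linear_order_max:
  assumes "linear_order_on S r" "finite K" "K \<noteq> {}" "K \<subseteq> S"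
  shows "\<exists>u\<in>K. \<forall>v\<in>K. (v, u) \<in> r"
  using assms(2-4)
proof (induction K rule: finite_ne_induct)
  case (singleton x)
  then show ?case using assms(1) by (auto simp: order_on_defs refl_on_def)
next
  case (insert x F)
  then obtain u where u: "u \<in> F" "\<forall>v\<in>F. (v, u) \<in> r" by auto
  have tr: "trans r" and tot: "total_on S r" and rf: "(x, x) \<in> r" "(u, u) \<in> r"
    using assms(1) insert u by (auto simp: order_on_defs refl_on_def)
  show ?case
  proof (cases "(x, u) \<in> r")
    case True
    then show ?thesis using u by auto
  next
    case False
    then have "(u, x) \<in> r" using tot u insert by (metis insert_subset rf(1) subsetD total_on_def)
    then have "\<forall>v\<in>insert x F. (v, x) \<in> r" using u rf by (auto dest: transD[OF tr])
    then show ?thesis by blast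
  qed
qed

lemma monomials_add: "u \<in> monomials n \<Longrightarrow> v \<in> monomials n \<Longrightarrow> u + v \<in> monomials n"
  unfolding monomials_def using keys_add[of u v] by blast

lemma poly_ring_zero: "0 \<in> poly_ring n" by (simp add: poly_ring_def)

lemma poly_ring_add: "p \<in> poly_ring n \<Longrightarrow> q \<in> poly_ring n \<Longrightarrow> p + q \<in> poly_ring n"
  unfolding poly_ring_def using keys_add[of p q] by blast

lemma poly_ring_mult:
  assumes "p \<in> poly_ring n" "q \<in> poly_ring n" shows "p * q \<in> poly_ring n"
proof -
  have "w \<in> monomials n" if "w \<in> Poly_Mapping.keys (p * q)" for w
  proof -
    obtain a b where "w = a + b" "a \<in> Poly_Mapping.keys p" "b \<in> Poly_Mapping.keys q"
      using \<open>w \<in> _\<close> keys_mult[of p q] by auto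
    then show ?thesis using assms monomials_add unfolding poly_ring_def by blast
  qed
  then show ?thesis by (auto simp: poly_ring_def)
qed

lemma ideal_generated_mono: "S \<subseteq> T \<Longrightarrow> ideal_generated n S \<subseteq> ideal_generated n T"
  unfolding ideal_generated_def by blast

lemma ideal_generated_zero: "0 \<in> ideal_generated n S"
  unfolding ideal_generated_def by (intro CollectI exI[of _ "{}"]) simp

lemma ideal_generated_generator_multiple:
  "s \<in> S \<Longrightarrow> p \<in> poly_ring n \<Longrightarrow> p * s \<in> ideal_generated n S"
  unfolding ideal_generated_def by (intro CollectI exI[of _ "{s}"] exI[of _ "\<lambda>_. p"]) simp

lemma ideal_generated_add:
  assumes "f \<in> ideal_generated n S" "g \<in> ideal_generated n S"
  shows "f + g \<in> ideal_generated n S"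
proof -
  obtain F q where F: "f = (\<Sum>s\<in>F. q s * s)" "finite F" "F \<subseteq> S" "\<forall>s\<in>F. q s \<in> poly_ring n"
    using assms(1) unfolding ideal_generated_def by blast
  obtain G r where G: "g = (\<Sum>s\<in>G. r s * s)" "finite G" "G \<subseteq> S" "\<forall>s\<in>G. r s \<in> poly_ring n"
    using assms(2) unfolding ideal_generated_def by blast
  define h where "h s = (if s \<in> F then q s else 0) + (if s \<in> G then r s else 0)" for s
  have "(\<Sum>s\<in>F \<union> G. h s * s) = (\<Sum>s\<in>F \<union> G. (if s \<in> F then q s * s else 0) + (if s \<in> G then r s * s else 0))"
    by (rule sum.cong) (auto simp: h_def distrib_right)
  also have "\<dots> = f + g"
    unfolding sum.distrib F(1) G(1) using F(2) G(2)
    by (simp add: sum.inter_restrict[symmetric] Int_absorb1 Int_absorb2)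
  finally have "f + g = (\<Sum>s\<in>F \<union> G. h s * s)" by simp
  moreover have "\<forall>s\<in>F \<union> G. h s \<in> poly_ring n"
    using F(4) G(4) by (auto simp: h_def intro: poly_ring_add poly_ring_zero)
  ultimately show ?thesis using F(2,3) G(2,3) unfolding ideal_generated_def
    by (intro CollectI exI[of _ "F \<union> G"] exI[of _ h]) simp
qed

lemma ideal_generated_mult:
  assumes "f \<in> ideal_generated n S" "p \<in> poly_ring n"
  shows "p * f \<in> ideal_generated n S"
proof -
  obtain F q where F: "f = (\<Sum>s\<in>F. q s * s)" "finite F" "F \<subseteq> S" "\<forall>s\<in>F. q s \<in> poly_ring n"
    using assms(1) unfolding ideal_generated_def by blast
  have "p * f = (\<Sum>s\<in>F. (p * q s) * s)" by (simp add: F(1) sum_distrib_left mult.assoc)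
  then show ?thesis using F poly_ring_mult[OF assms(2)] unfolding ideal_generated_def
    by (intro CollectI exI[of _ F] exI[of _ "\<lambda>s. p * q s"]) auto
qed

lemma ideal_generated_least:
  assumes "S \<subseteq> ideal_generated n T"
  shows "ideal_generated n S \<subseteq> ideal_generated n T"
proof
  fix f assume "f \<in> ideal_generated n S"
  then obtain F q where F: "f = (\<Sum>s\<in>F. q s * s)" "finite F" "F \<subseteq> S" "\<forall>s\<in>F. q s \<in> poly_ring n"
    unfolding ideal_generated_def by blast
  have "(\<Sum>s\<in>F. q s * s) \<in> ideal_generated n T" using F(2-4)
  proof (induction F)
    case empty then show ?case by (simp add: ideal_generated_zero)
  next
    case (insert s F)
    then show ?case using assms
      by (simp add: ideal_generated_add ideal_generated_mult subset_iff)
  qed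
  then show "f \<in> ideal_generated n T" using F(1) by simp
qed

text \<open>
  The coefficient of the monomial in a combination of the generators is non-zero, so some
  generator contributes to it.
\<close>

lemma monomial_ideal_divisor:
  assumes "mon_poly u \<in> (ideal_generated n (mon_poly ` S) :: 'k::field mpoly set)"
  obtains a w where "a \<in> S" "w \<in> monomials n" "u = a + w"
proof -
  obtain F q where F: "(mon_poly u :: 'k mpoly) = (\<Sum>s\<in>F. q s * s)" "F \<subseteq> mon_poly ` S"
      "\<forall>s\<in>F. q s \<in> poly_ring n"
    using assms unfolding ideal_generated_def by blast
  have "Poly_Mapping.lookup (\<Sum>s\<in>F. q s * s) u = (1::'k)" unfolding F(1)[symmetric] by simp
  then have "(\<Sum>s\<in>F. Poly_Mapping.lookup (q s * s) u) \<noteq> 0" by (simp add: lookup_sum)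
  then obtain s where s: "s \<in> F" "Poly_Mapping.lookup (q s * s) u \<noteq> 0"
    by (rule sum.not_neutral_contains_not_neutral)
  then obtain a where a: "a \<in> S" "s = mon_poly a" using F(2) by blast
  have "u \<in> Poly_Mapping.keys (q s * s)" using s by (simp add: in_keys_iff)
  then obtain w where "w \<in> Poly_Mapping.keys (q s)" "u = w + a"
    using keys_mult[of "q s" s] a(2) by auto
  then show ?thesis using that[OF a(1), of w] F(3) s(1)
    by (auto simp: poly_ring_def add.commute)
qed

text \<open>
  The divisor \<open>a\<close> of \<open>u\<close> is the initial monomial of the quadratic
  binomial \<open>a - b\<close> of the toric ideal.
\<close>

definition quadratically_reducible :: "nat \<Rightarrow> mon rel \<Rightarrow> int mat \<Rightarrow> mon \<Rightarrow> bool" where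
  "quadratically_reducible n ord A u \<longleftrightarrow> (\<exists>a b w. u = a + w \<and> w \<in> monomials n \<and>
     a \<in> monomials n \<and> b \<in> monomials n \<and> mon_degree a = 2 \<and> mon_degree b = 2 \<and>
     torus_degree A a = torus_degree A b \<and> a \<noteq> b \<and> (b, a) \<in> ord)"

text \<open>
  The monomial \<open>u\<close> is initial in the binomial \<open>u - v\<close> of the ideal,
  so the initial monomial of a basis element divides it. Homogeneity makes both terms of that
  element quadratic.
\<close>

lemma quadratic_gb_reduces:
  fixes A :: "int mat"
  defines "n \<equiv> dim_col A"
  assumes gb: "has_quadratic_groebner_basis n ord (toric_ideal A :: 'k::field mpoly set)"
    and ord: "refl_on (monomials n) ord" "antisym ord" "total_on (monomials n) ord"
    and homogeneous: "\<And>u v. u \<in> monomials n \<Longrightarrow> v \<in> monomials n \<Longrightarrow>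
          torus_degree A u = torus_degree A v \<Longrightarrow> mon_degree u = mon_degree v"
    and u: "u \<in> monomials n" "v \<in> monomials n" "torus_degree A u = torus_degree A v" "u \<noteq> v" "(v, u) \<in> ord"
  shows "quadratically_reducible n ord A u"
proof -
  obtain G where G: "groebner_basis n ord (toric_ideal A :: 'k mpoly set) G" "\<forall>g\<in>G. quadratic_binomial g"
    using gb unfolding has_quadratic_groebner_basis_def by blast
  have refl: "w \<in> monomials n \<Longrightarrow> (w, w) \<in> ord" for w using ord(1) by (auto simp: refl_on_def)
  let ?f = "mon_poly u - mon_poly v :: 'k mpoly"
  have f: "?f \<in> toric_ideal A" "?f \<noteq> 0" "initial_monomial ord ?f = u"
    using binomial_in_toric_ideal_iff[where 'k='k] u keys_binomial[OF u(4), where 'k='k] initial_monomial_binomial(1)[OF ord(2)] refl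
    unfolding n_def by fastforce+
  have "mon_poly u \<in> {mon_poly (initial_monomial ord f) :: 'k mpoly | f. f \<in> (toric_ideal A :: 'k mpoly set) \<and> f \<noteq> 0}"
    using f by (metis (mono_tags, lifting) mem_Collect_eq)
  from ideal_generated_generator_multiple[OF this, of 1 n]
  have "mon_poly u \<in> initial_ideal n ord (toric_ideal A :: 'k mpoly set)"
    unfolding initial_ideal_def by (simp add: poly_ring_def monomials_def)
  also have "initial_ideal n ord (toric_ideal A :: 'k mpoly set) =
     ideal_generated n (mon_poly ` {initial_monomial ord g | g. g \<in> G \<and> g \<noteq> 0})"
    using G(1) unfolding groebner_basis_def by (simp add: setcompr_eq_image image_image)
  finally obtain a w where aw: "a \<in> {initial_monomial ord g | g. g \<in> G \<and> g \<noteq> 0}" "w \<in> monomials n" "u = a + w"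
    by (rule monomial_ideal_divisor)
  then obtain g where g: "g \<in> G" "a = initial_monomial ord g" by blast
  then obtain x y where xy: "x \<noteq> y" "g = mon_poly x - mon_poly y" "max (mon_degree x) (mon_degree y) = 2"
    using G(2) unfolding quadratic_binomial_def by blast
  have "g \<in> toric_ideal A" using G(1) g unfolding groebner_basis_def by blast
  moreover from this have mon: "x \<in> monomials n" "y \<in> monomials n"
    using keys_binomial[OF xy(1), where 'k='k] unfolding toric_ideal_def poly_ring_def n_def xy(2) by auto
  ultimately have td: "torus_degree A x = torus_degree A y"
    using binomial_in_toric_ideal_iff[where 'k='k] xy(1) unfolding n_def xy(2) by blast
  then have deg: "mon_degree x = 2" "mon_degree y = 2" using homogeneous[OF mon] xy(3) by auto
  consider "(x, y) \<in> ord" | "(y, x) \<in> ord" using ord(3) mon xy(1) by (auto simp: total_on_def)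
  then show ?thesis
  proof cases
    case 1
    then have "a = y" unfolding g(2) xy(2) using initial_monomial_binomial(2)[OF ord(2) refl[OF mon(2)] 1] xy(1) by simp
    then show ?thesis unfolding quadratically_reducible_def using aw(2,3) mon deg td xy(1) 1
      by (intro exI[of _ y] exI[of _ x] exI[of _ w]) simp
  next
    case 2
    then have "a = x" unfolding g(2) xy(2) using initial_monomial_binomial(1)[OF ord(2) refl[OF mon(1)] 2 xy(1)] by simp
    then show ?thesis unfolding quadratically_reducible_def using aw(2,3) mon deg td xy(1) 2
      by (intro exI[of _ x] exI[of _ y] exI[of _ w]) simp
  qed
qed

lemma finite_monomials_degree_le: "finite {u \<in> monomials n. mon_degree u = d}"
proof -
  have "Poly_Mapping.lookup u i \<le> d" if "mon_degree u = d" for u i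
    using that member_le_sum[of i "Poly_Mapping.keys u" "Poly_Mapping.lookup u"]
    by (cases "i \<in> Poly_Mapping.keys u") (auto simp: mon_degree_def in_keys_iff)
  then have "Poly_Mapping.lookup ` {u \<in> monomials n. mon_degree u = d} \<subseteq>
      {f. \<forall>i. (i \<in> {..<n} \<longrightarrow> f i \<in> {..d}) \<and> (i \<notin> {..<n} \<longrightarrow> f i = 0)}"
    by (auto simp: monomials_def in_keys_iff)
  moreover have "finite {f. \<forall>i. (i \<in> {..<n} \<longrightarrow> f i \<in> {..d}) \<and> (i \<notin> {..<n} \<longrightarrow> f i = (0::nat))}"
    by (rule finite_set_of_finite_funs) auto
  ultimately have "finite (Poly_Mapping.lookup ` {u \<in> monomials n. mon_degree u = d})"
    by (rule finite_subset)
  then show ?thesis by (rule finite_imageD) (simp add: inj_on_def)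
qed

text \<open>
  All quadratic binomials of the ideal form the basis: the initial monomial of any non-zero
  element has a partner of the same image below it, hence is reducible by hypothesis.
\<close>

lemma quadratic_gb_if_reduces:
  fixes A :: "int mat"
  defines "n \<equiv> dim_col A"
  assumes ord: "monomial_order n ord"
    and red: "\<And>u v. u \<in> monomials n \<Longrightarrow> v \<in> monomials n \<Longrightarrow> torus_degree A u = torus_degree A v \<Longrightarrow>
          u \<noteq> v \<Longrightarrow> (v, u) \<in> ord \<Longrightarrow> quadratically_reducible n ord A u"
  shows "has_quadratic_groebner_basis n ord (toric_ideal A :: 'k::field mpoly set)"
proof -
  define M where "M = {u \<in> monomials n. mon_degree u = 2}"
  define G :: "'k mpoly set" where
    "G = (\<lambda>(a, b). mon_poly a - mon_poly b) ` {(a, b) \<in> M \<times> M. a \<noteq> b \<and> torus_degree A a = torus_degree A b}"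
  have lin: "linear_order_on (monomials n) ord" using ord by (simp add: monomial_order_def)
  then have refl: "w \<in> monomials n \<Longrightarrow> (w, w) \<in> ord" and anti: "antisym ord" for w
    by (auto simp: order_on_defs refl_on_def)
  have GI: "G \<subseteq> toric_ideal A"
    using binomial_in_toric_ideal_iff[where 'k='k] unfolding G_def M_def n_def by fastforce
  have "finite (M \<times> M)" using finite_monomials_degree_le by (simp add: M_def)
  then have "finite {(a, b) \<in> M \<times> M. a \<noteq> b \<and> torus_degree A a = torus_degree A b}"
    by (rule finite_subset[rotated]) auto
  then have fin: "finite G" unfolding G_def by (rule finite_imageI)
  have quad: "quadratic_binomial g" if "g \<in> G" for g
    using that unfolding G_def M_def quadratic_binomial_def by fastforce
  let ?J = "ideal_generated n {mon_poly (initial_monomial ord g) :: 'k mpoly | g. g \<in> G \<and> g \<noteq> 0}"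
  have "mon_poly (initial_monomial ord f) \<in> ?J" if f: "f \<in> toric_ideal A" "f \<noteq> 0" for f :: "'k mpoly"
  proof -
    have keys: "Poly_Mapping.keys f \<subseteq> monomials n" using f(1) by (simp add: toric_ideal_def poly_ring_def n_def)
    obtain u where u: "u \<in> Poly_Mapping.keys f" "\<forall>v\<in>Poly_Mapping.keys f. (v, u) \<in> ord"
      using finite_linear_order_max[OF lin _ _ keys] f(2) by (auto simp: keys_eq_empty)
    have in_f: "initial_monomial ord f = u" using u by (intro initial_monomialI[OF anti]) auto
    obtain v where v: "v \<in> Poly_Mapping.keys f" "v \<noteq> u" "torus_degree A v = torus_degree A u"
      using toric_ideal_key_partner[OF f(1) u(1)] by blast
    have "quadratically_reducible n ord A u" using red[of u v] u v keys by auto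
    then obtain a b w where abw: "u = a + w" "w \<in> monomials n" "a \<in> monomials n" "b \<in> monomials n"
        "mon_degree a = 2" "mon_degree b = 2" "torus_degree A a = torus_degree A b" "a \<noteq> b" "(b, a) \<in> ord"
      unfolding quadratically_reducible_def by blast
    define g where "g = (mon_poly a - mon_poly b :: 'k mpoly)"
    have "g \<in> G" using abw unfolding G_def M_def g_def by auto
    moreover have "g \<noteq> 0" using keys_binomial[OF abw(8), where 'k='k] unfolding g_def by auto
    moreover have "initial_monomial ord g = a"
      unfolding g_def using initial_monomial_binomial(1)[OF anti refl[OF abw(3)] abw(9,8)] .
    ultimately have "mon_poly a \<in> {mon_poly (initial_monomial ord g) :: 'k mpoly | g. g \<in> G \<and> g \<noteq> 0}"
      by blast
    moreover have "(mon_poly w :: 'k mpoly) \<in> poly_ring n" using abw(2) by (simp add: poly_ring_def)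
    ultimately have "mon_poly w * mon_poly a \<in> ?J"
      by (rule ideal_generated_generator_multiple)
    then show ?thesis by (simp add: in_f abw(1) mult_single add.commute)
  qed
  then have "initial_ideal n ord (toric_ideal A :: 'k mpoly set) \<subseteq> ?J"
    unfolding initial_ideal_def by (intro ideal_generated_least) blast
  moreover have "?J \<subseteq> initial_ideal n ord (toric_ideal A :: 'k mpoly set)"
    unfolding initial_ideal_def using GI by (intro ideal_generated_mono) blast
  ultimately show ?thesis
    unfolding has_quadratic_groebner_basis_def groebner_basis_def using fin GI quad by blast
qed

section \<open>Cuts of the graph and their fibres\<close>

text \<open>
  In \<open>Cut p a b x y\<close>, the bit \<open>p\<close> is the parity of the cut on each
  of the three paths between the vertices 1 and 2, \<open>a\<close> and \<open>b\<close> are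
  the entries at the edges \<open>{1,3}\<close> and \<open>{1,4}\<close>, and
  \<open>x\<close>, \<open>y\<close> those at \<open>{1,5}\<close> and \<open>{5,6}\<close>.
  Parity determines the remaining three entries.
\<close>

datatype cut = Cut bool bool bool bool bool

fun par :: "cut \<Rightarrow> bool" where "par (Cut p a b x y) = p"
text \<open>
  The entries of the cut vector, in the order of the edges of the graph.
\<close>

fun e1 :: "cut \<Rightarrow> bool" where "e1 (Cut p a b x y) = a"
fun e2 :: "cut \<Rightarrow> bool" where "e2 (Cut p a b x y) = (a \<noteq> p)"
fun e3 :: "cut \<Rightarrow> bool" where "e3 (Cut p a b x y) = b"
fun e4 :: "cut \<Rightarrow> bool" where "e4 (Cut p a b x y) = (b \<noteq> p)"
fun e5 :: "cut \<Rightarrow> bool" where "e5 (Cut p a b x y) = x"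
fun e6 :: "cut \<Rightarrow> bool" where "e6 (Cut p a b x y) = y"
fun e7 :: "cut \<Rightarrow> bool" where "e7 (Cut p a b x y) = ((x \<noteq> y) \<noteq> p)"

definition coords :: "(cut \<Rightarrow> bool) list" where
  "coords = [e1, e2, e3, e4, e5, e6, e7]"

definition same_fibre :: "cut multiset \<Rightarrow> cut multiset \<Rightarrow> bool" (infix \<open>\<approx>\<close> 50) where
  "M \<approx> N \<longleftrightarrow> size M = size N \<and> (\<forall>c\<in>set coords. size (filter_mset c M) = size (filter_mset c N))"

lemma fibre_refl [simp]: "M \<approx> M" by (simp add: same_fibre_def)
lemma fibre_sym: "M \<approx> N \<Longrightarrow> N \<approx> M" by (simp add: same_fibre_def)
lemma fibre_trans [trans]: "M \<approx> N \<Longrightarrow> N \<approx> P \<Longrightarrow> M \<approx> P" by (simp add: same_fibre_def)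
lemma fibre_add_cancel [simp]: "R + M \<approx> R + N \<longleftrightarrow> M \<approx> N" "M + R \<approx> N + R \<longleftrightarrow> M \<approx> N"
  by (simp_all add: same_fibre_def)

text \<open>
  The cuts form a linear code, and the three summands \<open>u + v - s\<close> may be added
  modulo 2 whenever \<open>s\<close> lies between \<open>u\<close> and \<open>v\<close>; this
  is the partner of \<open>s\<close> in the fibre of the pair \<open>u, v\<close>.
\<close>

fun opp :: "cut \<Rightarrow> cut \<Rightarrow> cut \<Rightarrow> cut" where
 "opp (Cut p a b x y) (Cut p' a' b' x' y') (Cut p'' a'' b'' x'' y'') =
   Cut ((p \<noteq> p') \<noteq> p'') ((a \<noteq> a') \<noteq> a'') ((b \<noteq> b') \<noteq> b'') ((x \<noteq> x') \<noteq> x'') ((y \<noteq> y') \<noteq> y'')"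

fun between :: "bool \<Rightarrow> bool \<Rightarrow> bool \<Rightarrow> bool" where "between s t u = (u = s \<or> u = t)"

text \<open>
  The cuts that agree with \<open>u\<close> or with \<open>v\<close> in each coordinate. They
  are generated bit by bit, so that the list is short to evaluate.
\<close>

fun box :: "cut \<Rightarrow> cut \<Rightarrow> cut list" where
 "box (Cut p a b x y) (Cut p' a' b' x' y') =
   [Cut q c d z w. q \<leftarrow> [False, True],
      c \<leftarrow> filter (\<lambda>c. between a a' c \<and> between (a \<noteq> p) (a' \<noteq> p') (c \<noteq> q)) [False, True],
      d \<leftarrow> filter (\<lambda>d. between b b' d \<and> between (b \<noteq> p) (b' \<noteq> p') (d \<noteq> q)) [False, True],
      z \<leftarrow> filter (between x x') [False, True],
      w \<leftarrow> filter (\<lambda>w. between y y' w \<and> between ((x \<noteq> y) \<noteq> p) ((x' \<noteq> y') \<noteq> p') ((z \<noteq> w) \<noteq> q)) [False, True]]"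

lemma set_box: "Cut q c d z w \<in> set (box (Cut p a b x y) (Cut p' a' b' x' y')) \<longleftrightarrow>
   between a a' c \<and> between (a \<noteq> p) (a' \<noteq> p') (c \<noteq> q) \<and> between b b' d \<and> between (b \<noteq> p) (b' \<noteq> p') (d \<noteq> q) \<and>
   between x x' z \<and> between y y' w \<and> between ((x \<noteq> y) \<noteq> p) ((x' \<noteq> y') \<noteq> p') ((z \<noteq> w) \<noteq> q)"
proof -
  have bools: "(r \<in> set [False, True]) = True" for r by auto
  have comp: "Cut q c d z w \<in> set (concat (map (\<lambda>q. concat (map (\<lambda>c. concat (map (\<lambda>d. concat (map (\<lambda>z.
      map (\<lambda>w. Cut q c d z w) (L5 q c d z)) (L4 q c d))) (L3 q c))) (L2 q))) L1)) \<longleftrightarrow>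
      q \<in> set L1 \<and> c \<in> set (L2 q) \<and> d \<in> set (L3 q c) \<and> z \<in> set (L4 q c d) \<and> w \<in> set (L5 q c d z)" for L1 L2 L3 L4 L5
    by (simp add: image_iff)
  show ?thesis unfolding box.simps comp set_filter mem_Collect_eq bools by blast
qed

lemma count_pair:
  "size (filter_mset P {#u, v#}) = size (filter_mset P {#s, t#}) \<longleftrightarrow>
     between (P u) (P v) (P s) \<and> (P t \<longleftrightarrow> ((P u \<noteq> P v) \<noteq> P s))"
  by auto

text \<open>
  Coordinatewise, two bits are determined as a multiset by their sum. So the fibre of a pair
  consists of the cuts between its members, each with its partner.
\<close>

lemma pair_fibre_iff: "{#u, v#} \<approx> {#s, t#} \<longleftrightarrow> s \<in> set (box u v) \<and> t = opp u v s"
proof -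
  obtain p a b x y where u: "u = Cut p a b x y" by (cases u)
  obtain p' a' b' x' y' where v: "v = Cut p' a' b' x' y'" by (cases v)
  obtain q c d z w where s: "s = Cut q c d z w" by (cases s)
  obtain q' c' d' z' w' where t: "t = Cut q' c' d' z' w'" by (cases t)
  have "{#u, v#} \<approx> {#s, t#} \<longleftrightarrow> (\<forall>P\<in>set coords. between (P u) (P v) (P s) \<and> (P t \<longleftrightarrow> ((P u \<noteq> P v) \<noteq> P s)))"
    unfolding same_fibre_def count_pair by simp
  also have "\<dots> \<longleftrightarrow> s \<in> set (box u v) \<and> t = opp u v s"
    unfolding u v s t set_box coords_def
    by (simp del: between.simps) argo
  finally show ?thesis .
qed

section \<open>Symmetries of the fibres\<close>

lemma all_cut: "(\<forall>u. P u) \<longleftrightarrow> (\<forall>p a b x y. P (Cut p a b x y))" by (metis cut.exhaust)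

text \<open>
  For a reverse lexicographic order with variables ranked by \<open>f\<close>, these are the
  least pairs of their fibres: a pair is least iff it contains the smallest variable that
  occurs in the fibre.
\<close>

definition min_pair :: "(cut \<Rightarrow> nat) \<Rightarrow> cut \<Rightarrow> cut \<Rightarrow> bool" where
  "min_pair f u v \<longleftrightarrow> (\<forall>s t. {#u, v#} \<approx> {#s, t#} \<longrightarrow> f u \<le> f s \<or> f v \<le> f s)"

definition clique :: "(cut \<Rightarrow> cut \<Rightarrow> bool) \<Rightarrow> cut \<Rightarrow> cut \<Rightarrow> cut \<Rightarrow> bool" where
  "clique S u v w \<longleftrightarrow> S u v \<and> S u w \<and> S v w"

text \<open>
  What a quadratic Groebner basis forces when \<open>S u v\<close> says that the pair
  \<open>u, v\<close> is the least one of its fibre: a cubic with only such pairs is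
  irreducible, hence the least monomial of its fibre.
\<close>

definition unique_cubics :: "(cut \<Rightarrow> cut \<Rightarrow> bool) \<Rightarrow> bool" where
  "unique_cubics S \<longleftrightarrow> (\<forall>u v w u' v' w'. clique S u v w \<longrightarrow> clique S u' v' w' \<longrightarrow>
     {#u, v, w#} \<approx> {#u', v', w'#} \<longrightarrow> {#u, v, w#} = {#u', v', w'#})"

text \<open>
  Permuting the edges and complementing some coordinates keeps the relation of lying in one
  fibre. Only involutions are needed, and they spare a separate treatment of inverses.
\<close>

definition symmetry :: "(cut \<Rightarrow> cut) \<Rightarrow> bool" where
  "symmetry \<sigma> \<longleftrightarrow> (\<forall>u. \<sigma> (\<sigma> u) = u) \<and>
     (\<forall>c\<in>set coords. \<exists>d\<in>set coords. (\<forall>u. c (\<sigma> u) = d u) \<or> (\<forall>u. c (\<sigma> u) = (\<not> d u)))"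

lemma symmetry_fibre_imp:
  assumes "symmetry \<sigma>" "M \<approx> N" shows "image_mset \<sigma> M \<approx> image_mset \<sigma> N"
proof -
  have eq: "size (filter_mset c (image_mset \<sigma> K)) = size (filter_mset (\<lambda>u. c (\<sigma> u)) K)" for c K
    by (induction K) auto
  have neg: "size (filter_mset (\<lambda>u. \<not> d u) K) = size K - size (filter_mset d K)" for d and K :: "cut multiset"
    by (metis add_diff_cancel_left' multiset_partition size_union)
  have "size (filter_mset c (image_mset \<sigma> M)) = size (filter_mset c (image_mset \<sigma> N))"
    if c: "c \<in> set coords" for c
  proof -
    obtain d where d: "d \<in> set coords" "(\<forall>u. c (\<sigma> u) = d u) \<or> (\<forall>u. c (\<sigma> u) = (\<not> d u))"
      using assms(1) c unfolding symmetry_def by blast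
    then show ?thesis using assms(2) unfolding eq same_fibre_def by (auto simp: neg)
  qed
  then show ?thesis using assms(2) by (simp add: same_fibre_def)
qed

lemma symmetry_fibre:
  assumes "symmetry \<sigma>" shows "image_mset \<sigma> M \<approx> image_mset \<sigma> N \<longleftrightarrow> M \<approx> N"
proof -
  have "image_mset \<sigma> (image_mset \<sigma> K) = K" for K
    using assms by (simp add: multiset.map_comp comp_def symmetry_def)
  then show ?thesis using symmetry_fibre_imp[OF assms] by metis
qed

lemma symmetry_bij: "symmetry \<sigma> \<Longrightarrow> bij \<sigma>"
  unfolding symmetry_def by (metis involuntory_imp_bij)

lemma symmetry_pair:
  "symmetry \<sigma> \<Longrightarrow> {#\<sigma> u, \<sigma> v#} \<approx> {#\<sigma> s, \<sigma> t#} \<longleftrightarrow> {#u, v#} \<approx> {#s, t#}"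
  using symmetry_fibre[of \<sigma> "{#u, v#}" "{#s, t#}"] by simp

lemma symmetry_min_pair:
  assumes "symmetry \<sigma>" shows "min_pair (f \<circ> \<sigma>) u v \<longleftrightarrow> min_pair f (\<sigma> u) (\<sigma> v)"
proof -
  have "(\<forall>s t. P (\<sigma> s) (\<sigma> t)) = (\<forall>s t. P s t)" for P
    using assms unfolding symmetry_def by metis
  from this[of "\<lambda>s t. {#\<sigma> u, \<sigma> v#} \<approx> {#s, t#} \<longrightarrow> f (\<sigma> u) \<le> f s \<or> f (\<sigma> v) \<le> f s"]
  show ?thesis unfolding min_pair_def symmetry_pair[OF assms] by simp
qed

lemma symmetry_unique_cubics:
  assumes "symmetry \<sigma>" "unique_cubics S" shows "unique_cubics (\<lambda>u v. S (\<sigma> u) (\<sigma> v))"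
  unfolding unique_cubics_def
proof (intro allI impI)
  fix u v w u' v' w'
  assume "clique (\<lambda>u v. S (\<sigma> u) (\<sigma> v)) u v w" "clique (\<lambda>u v. S (\<sigma> u) (\<sigma> v)) u' v' w'"
    "{#u, v, w#} \<approx> {#u', v', w'#}"
  then have "{#\<sigma> u, \<sigma> v, \<sigma> w#} = {#\<sigma> u', \<sigma> v', \<sigma> w'#}"
    using assms(2) symmetry_fibre[OF assms(1), of "{#u, v, w#}" "{#u', v', w'#}"]
    unfolding unique_cubics_def clique_def by simp
  then have "image_mset \<sigma> {#\<sigma> u, \<sigma> v, \<sigma> w#} = image_mset \<sigma> {#\<sigma> u', \<sigma> v', \<sigma> w'#}" by (rule arg_cong)
  then show "{#u, v, w#} = {#u', v', w'#}" using assms(1) by (simp add: symmetry_def)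
qed

text \<open>
  Switching: the symmetric difference with a fixed cut. These symmetries act transitively on
  the cuts.
\<close>

fun translate :: "cut \<Rightarrow> cut \<Rightarrow> cut" where
  "translate (Cut p a b x y) (Cut p' a' b' x' y') = Cut (p \<noteq> p') (a \<noteq> a') (b \<noteq> b') (x \<noteq> x') (y \<noteq> y')"

lemma coords_linear: "c \<in> set coords \<Longrightarrow> c (translate m u) = (c m \<noteq> c u)"
  by (cases m; cases u) (auto simp: coords_def)

lemma symmetry_translate: "symmetry (translate m)"
  unfolding symmetry_def
proof (intro conjI allI ballI)
  fix u show "translate m (translate m u) = u" by (cases m; cases u) auto
next
  fix c assume c: "c \<in> set coords"
  then show "\<exists>d\<in>set coords. (\<forall>u. c (translate m u) = d u) \<or> (\<forall>u. c (translate m u) = (\<not> d u))"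
    by (intro bexI[OF _ c], cases "c m") (simp_all add: coords_linear)
qed

text \<open>
  The two edges of a short path play the same part in the code of cuts, and so do the three
  edges of the long path.
\<close>

fun swap12 :: "cut \<Rightarrow> cut" where "swap12 (Cut p a b x y) = Cut p (a \<noteq> p) b x y"
fun swap34 :: "cut \<Rightarrow> cut" where "swap34 (Cut p a b x y) = Cut p a (b \<noteq> p) x y"
fun swap56 :: "cut \<Rightarrow> cut" where "swap56 (Cut p a b x y) = Cut p a b y x"
fun swap57 :: "cut \<Rightarrow> cut" where "swap57 (Cut p a b x y) = Cut p a b ((x \<noteq> y) \<noteq> p) y"
fun swap67 :: "cut \<Rightarrow> cut" where "swap67 (Cut p a b x y) = Cut p a b x ((x \<noteq> y) \<noteq> p)"

lemma symmetry_swap12: "symmetry swap12"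
  unfolding symmetry_def
proof
  show "\<forall>u. swap12 (swap12 u) = u" unfolding all_cut by auto
  have "\<forall>u. e1 (swap12 u) = e2 u"
    "\<forall>u. e2 (swap12 u) = e1 u"
    "\<forall>u. e3 (swap12 u) = e3 u"
    "\<forall>u. e4 (swap12 u) = e4 u"
    "\<forall>u. e5 (swap12 u) = e5 u"
    "\<forall>u. e6 (swap12 u) = e6 u"
    "\<forall>u. e7 (swap12 u) = e7 u"
    unfolding all_cut by auto
  then show "\<forall>c\<in>set coords. \<exists>d\<in>set coords. (\<forall>u. c (swap12 u) = d u) \<or> (\<forall>u. c (swap12 u) = (\<not> d u))"
    by (simp add: coords_def)
qed

lemma symmetry_swap34: "symmetry swap34"
  unfolding symmetry_def
proof
  show "\<forall>u. swap34 (swap34 u) = u" unfolding all_cut by auto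
  have "\<forall>u. e1 (swap34 u) = e1 u"
    "\<forall>u. e2 (swap34 u) = e2 u"
    "\<forall>u. e3 (swap34 u) = e4 u"
    "\<forall>u. e4 (swap34 u) = e3 u"
    "\<forall>u. e5 (swap34 u) = e5 u"
    "\<forall>u. e6 (swap34 u) = e6 u"
    "\<forall>u. e7 (swap34 u) = e7 u"
    unfolding all_cut by auto
  then show "\<forall>c\<in>set coords. \<exists>d\<in>set coords. (\<forall>u. c (swap34 u) = d u) \<or> (\<forall>u. c (swap34 u) = (\<not> d u))"
    by (simp add: coords_def)
qed

lemma symmetry_swap56: "symmetry swap56"
  unfolding symmetry_def
proof
  show "\<forall>u. swap56 (swap56 u) = u" unfolding all_cut by auto
  have "\<forall>u. e1 (swap56 u) = e1 u"
    "\<forall>u. e2 (swap56 u) = e2 u"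
    "\<forall>u. e3 (swap56 u) = e3 u"
    "\<forall>u. e4 (swap56 u) = e4 u"
    "\<forall>u. e5 (swap56 u) = e6 u"
    "\<forall>u. e6 (swap56 u) = e5 u"
    "\<forall>u. e7 (swap56 u) = e7 u"
    unfolding all_cut by auto
  then show "\<forall>c\<in>set coords. \<exists>d\<in>set coords. (\<forall>u. c (swap56 u) = d u) \<or> (\<forall>u. c (swap56 u) = (\<not> d u))"
    by (simp add: coords_def)
qed

lemma symmetry_swap57: "symmetry swap57"
  unfolding symmetry_def
proof
  show "\<forall>u. swap57 (swap57 u) = u" unfolding all_cut by auto
  have "\<forall>u. e1 (swap57 u) = e1 u"
    "\<forall>u. e2 (swap57 u) = e2 u"
    "\<forall>u. e3 (swap57 u) = e3 u"
    "\<forall>u. e4 (swap57 u) = e4 u"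
    "\<forall>u. e5 (swap57 u) = e7 u"
    "\<forall>u. e6 (swap57 u) = e6 u"
    "\<forall>u. e7 (swap57 u) = e5 u"
    unfolding all_cut by auto
  then show "\<forall>c\<in>set coords. \<exists>d\<in>set coords. (\<forall>u. c (swap57 u) = d u) \<or> (\<forall>u. c (swap57 u) = (\<not> d u))"
    by (simp add: coords_def)
qed

lemma symmetry_swap67: "symmetry swap67"
  unfolding symmetry_def
proof
  show "\<forall>u. swap67 (swap67 u) = u" unfolding all_cut by auto
  have "\<forall>u. e1 (swap67 u) = e1 u"
    "\<forall>u. e2 (swap67 u) = e2 u"
    "\<forall>u. e3 (swap67 u) = e3 u"
    "\<forall>u. e4 (swap67 u) = e4 u"
    "\<forall>u. e5 (swap67 u) = e5 u"
    "\<forall>u. e6 (swap67 u) = e7 u"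
    "\<forall>u. e7 (swap67 u) = e6 u"
    unfolding all_cut by auto
  then show "\<forall>c\<in>set coords. \<exists>d\<in>set coords. (\<forall>u. c (swap67 u) = d u) \<or> (\<forall>u. c (swap67 u) = (\<not> d u))"
    by (simp add: coords_def)
qed

section \<open>Rewriting by weight\<close>

text \<open>
  The weights come from a computer search: a SAT solver chose a pair in each quadratic fibre
  such that every cubic fibre contains exactly one cubic made of chosen pairs, and linear
  arithmetic then found weights for which the chosen pairs are the lightest.
\<close>

fun wt :: "cut \<Rightarrow> int" where
  "wt (Cut False False False False False) = 0"
| "wt (Cut False False False False True) = 0"
| "wt (Cut False False False True False) = 0"
| "wt (Cut False False False True True) = 7"
| "wt (Cut False False True False False) = 6"
| "wt (Cut False False True False True) = 1"
| "wt (Cut False False True True False) = 7"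
| "wt (Cut False False True True True) = 7"
| "wt (Cut True False False False False) = 7"
| "wt (Cut True False False False True) = 1"
| "wt (Cut True False False True False) = 2"
| "wt (Cut True False False True True) = 0"
| "wt (Cut True False True False False) = 7"
| "wt (Cut True False True False True) = 6"
| "wt (Cut True False True True False) = 4"
| "wt (Cut True False True True True) = 1"
| "wt (Cut True True False False False) = 7"
| "wt (Cut True True False False True) = 6"
| "wt (Cut True True False True False) = 4"
| "wt (Cut True True False True True) = 1"
| "wt (Cut True True True False False) = 3"
| "wt (Cut True True True False True) = 3"
| "wt (Cut True True True True False) = 2"
| "wt (Cut True True True True True) = 1"
| "wt (Cut False True False False False) = 0"
| "wt (Cut False True False False True) = 1"
| "wt (Cut False True False True False) = 2"
| "wt (Cut False True False True True) = 6"
| "wt (Cut False True True False False) = 4"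
| "wt (Cut False True True False True) = 0"
| "wt (Cut False True True True False) = 7"
| "wt (Cut False True True True True) = 4"

definition weight :: "cut multiset \<Rightarrow> int" where "weight M = (\<Sum>u\<in>#M. wt u)"

lemma weight_add [simp]: "weight (M + N) = weight M + weight N" by (simp add: weight_def)

lemma wt_nonneg: "0 \<le> wt u" by (cases u rule: wt.cases) simp_all

lemma weight_nonneg: "0 \<le> weight M"
  unfolding weight_def by (induction M) (auto simp: wt_nonneg add_nonneg_nonneg)

definition step :: "cut multiset \<Rightarrow> cut multiset \<Rightarrow> bool" where
  "step M N \<longleftrightarrow> (\<exists>R P Q. M = R + P \<and> N = R + Q \<and> size P = 2 \<and> P \<approx> Q \<and> weight Q < weight P)"

definition normal :: "cut multiset \<Rightarrow> bool" where
  "normal M \<longleftrightarrow> (\<forall>P Q. P \<subseteq># M \<longrightarrow> size P = 2 \<longrightarrow> P \<approx> Q \<longrightarrow> weight P \<le> weight Q)"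

lemma stepI: "size P = 2 \<Longrightarrow> P \<approx> Q \<Longrightarrow> weight Q < weight P \<Longrightarrow> step (R + P) (R + Q)"
  unfolding step_def by blast

lemma not_normal_step: "\<not> normal M \<Longrightarrow> \<exists>N. step M N"
  unfolding normal_def by (metis not_le stepI subset_mset.diff_add)

lemma steps_add: "step\<^sup>*\<^sup>* M N \<Longrightarrow> step\<^sup>*\<^sup>* (R + M) (R + N)"
proof (induction rule: rtranclp_induct)
  case (step N N')
  then have "step (R + N) (R + N')" unfolding step_def by (metis add.assoc)
  with step.IH show ?case by (rule rtranclp.rtrancl_into_rtrancl)
qed simp

lemma step_fibre: "step M N \<Longrightarrow> M \<approx> N" unfolding step_def by auto

lemma steps_fibre: "step\<^sup>*\<^sup>* M N \<Longrightarrow> M \<approx> N"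
  by (induction rule: rtranclp_induct) (auto intro: fibre_trans step_fibre)

lemma step_weight: "step M N \<Longrightarrow> weight N < weight M" unfolding step_def by auto

lemma step_nat_weight: "step M N \<Longrightarrow> nat (weight N) < nat (weight M)"
  using step_weight[of M N] weight_nonneg[of N] by auto

lemma steps_weight: "step\<^sup>*\<^sup>* M N \<Longrightarrow> weight N \<le> weight M"
  by (induction rule: rtranclp_induct) (auto dest: step_weight)

lemma normal_steps: "normal M \<Longrightarrow> step\<^sup>*\<^sup>* M N \<Longrightarrow> N = M"
proof (erule converse_rtranclpE)
  fix N' assume "normal M" "step M N'"
  then show ?thesis unfolding normal_def step_def by (metis mset_subset_eq_add_right not_le)
qed simp

lemma normal_form_exists: "\<exists>N. step\<^sup>*\<^sup>* M N \<and> normal N"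
proof (induction M rule: measure_induct_rule[of "\<lambda>M. nat (weight M)"])
  case (less M)
  show ?case
  proof (cases "normal M")
    case False
    then obtain N where "step M N" using not_normal_step by blast
    with less show ?thesis by (meson converse_rtranclp_into_rtranclp step_nat_weight)
  qed blast
qed

definition cuts :: "cut list" where
 "cuts = [Cut p a b x y. a \<leftarrow> [False,True], p \<leftarrow> [False,True], b \<leftarrow> [False,True], x \<leftarrow> [False,True], y \<leftarrow> [False,True]]"

definition lightest :: "cut \<Rightarrow> cut \<Rightarrow> bool" where
 "lightest u v = (let w = wt u + wt v in list_all (\<lambda>s. w \<le> wt s + wt (opp u v s)) (box u v))"

text \<open>
  All multisets of size \<open>k\<close> over the given cuts whose pairs are lightest, each as
  one list. The restriction of the candidates to the neighbours of \<open>x\<close> is void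
  for the last member, where it would only cost time.
\<close>

fun light_lists :: "nat \<Rightarrow> cut list \<Rightarrow> cut list list" where
  "light_lists 0 _ = [[]]"
| "light_lists (Suc k) [] = []"
| "light_lists (Suc k) (x#xs) = map (Cons x) (light_lists k (if k = 0 then [] else filter (lightest x) (x#xs))) @ light_lists (Suc k) xs"

fun at_least :: "nat \<Rightarrow> ('a \<Rightarrow> bool) \<Rightarrow> 'a list \<Rightarrow> bool" where
  "at_least 0 P xs = True"
| "at_least (Suc n) P [] = False"
| "at_least (Suc n) P (x#xs) = (if P x then at_least n P xs else at_least (Suc n) P xs)"

text \<open>
  Matching on the result of the test, in place of a conditional, lets evaluation by rewriting
  visit the tail of a long list only once.
\<close>

fun cons_if :: "bool \<Rightarrow> 'a \<Rightarrow> 'a list \<Rightarrow> 'a list" where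
  "cons_if True x xs = x # xs"
| "cons_if False x xs = xs"

fun sieve :: "('a \<Rightarrow> bool) \<Rightarrow> 'a list \<Rightarrow> 'a list" where
  "sieve f [] = []"
| "sieve f (x#xs) = cons_if (f x) x (sieve f xs)"

text \<open>
  Splits the list by one feature after the other until each part has at most one member. For a
  list of thousands of entries this is far cheaper than comparing its members with each other.
\<close>

fun separates :: "('a \<Rightarrow> bool) list \<Rightarrow> 'a list \<Rightarrow> bool" where
  "separates fs [] = True"
| "separates fs [x] = True"
| "separates [] (x#y#xs) = False"
| "separates (f#fs) (x#y#xs) = (separates fs (sieve f (x#y#xs)) \<and> separates fs (sieve (\<lambda>z. \<not> f z) (x#y#xs)))"

text \<open>
  The number of members of a multiset of size at most 3 that contain a given edge is known
  from its comparisons with 1, 2 and 3.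
\<close>

definition features :: "(cut list \<Rightarrow> bool) list" where
  "features = [at_least k c. k \<leftarrow> [Suc 0, Suc (Suc 0), Suc (Suc (Suc 0))], c \<leftarrow> coords]"

lemma set_cuts: "u \<in> set cuts"
proof (cases u)
  case (Cut p a b x y)
  show ?thesis unfolding Cut cuts_def by (cases p; cases a; cases b; cases x; cases y) simp_all
qed

lemma set_sieve [simp]: "set (sieve f xs) = {x \<in> set xs. f x}"
proof (induction xs)
  case (Cons x xs)
  then show ?case by (cases "f x") auto
qed simp

lemma separatesD: "separates fs xs \<Longrightarrow> x \<in> set xs \<Longrightarrow> y \<in> set xs \<Longrightarrow> (\<And>f. f \<in> set fs \<Longrightarrow> f x = f y) \<Longrightarrow> x = y"
proof (induction fs xs rule: separates.induct)
  case (4 f fs a b xs)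
  have sep: "separates fs (sieve f (a # b # xs))" "separates fs (sieve (\<lambda>z. \<not> f z) (a # b # xs))" using "4.prems"(1) by simp_all
  have f: "f x = f y" using "4.prems"(4)[of f] by simp
  have fs: "g x = g y" if "g \<in> set fs" for g using "4.prems"(4)[of g] that by simp
  show ?case
  proof (cases "f x")
    case True
    then show ?thesis using "4.IH"(1)[OF sep(1)] "4.prems"(2,3) f fs unfolding set_sieve by blast
  next
    case False
    then show ?thesis using "4.IH"(2)[OF sep(2)] "4.prems"(2,3) f fs unfolding set_sieve by blast
  qed
qed auto

lemma at_least_iff: "at_least n P xs \<longleftrightarrow> n \<le> size (filter_mset P (mset xs))"
  by (induction n P xs rule: at_least.induct) auto

lemma light_lists_complete:
  assumes "set_mset M \<subseteq> set xs" "size M = k" "\<And>u v. {#u, v#} \<subseteq># M \<Longrightarrow> lightest u v"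
  shows "\<exists>l\<in>set (light_lists k xs). mset l = M"
  using assms
proof (induction k xs arbitrary: M rule: light_lists.induct)
  case (3 k x xs)
  show ?case
  proof (cases "x \<in># M")
    case True
    then obtain M' where M: "M = add_mset x M'" by (metis insert_DiffM)
    have k: "size M' = k" using "3.prems"(2) M by simp
    have pairs: "lightest u v" if "{#u, v#} \<subseteq># M'" for u v
      using "3.prems"(3)[of u v] that M by (metis add_mset_add_single mset_subset_eq_add_left subset_mset.order_trans)
    have "set_mset M' \<subseteq> set (if k = 0 then [] else filter (lightest x) (x#xs))"
    proof (cases "k = 0")
      case False
      have "lightest x y" if "y \<in># M'" for y
        using "3.prems"(3)[of x y] that M by (simp add: single_subset_iff)
      then show ?thesis using False "3.prems"(1) M by auto
    qed (use k in simp)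
    from "3.IH"(1)[OF this k pairs] obtain l where "l \<in> set (light_lists k (if k = 0 then [] else filter (lightest x) (x#xs)))" "mset l = M'" by blast
    then have "x # l \<in> set (light_lists (Suc k) (x#xs))" "mset (x # l) = M" using M by auto
    then show ?thesis by blast
  next
    case False
    then have "set_mset M \<subseteq> set xs" using "3.prems"(1) by auto
    from "3.IH"(2)[OF this "3.prems"(2,3)] show ?thesis by auto
  qed
qed auto

text \<open>
  The finite computation behind the existence of the Groebner basis. There are 382 pairs and
  2528 cubics all of whose pairs are lightest, as many as there are fibres of degree 2 and 3.
\<close>

lemma light_lists_separated:
  "separates features (light_lists (Suc 0) cuts)"
  "separates features (light_lists (Suc (Suc 0)) cuts)"
  "separates features (light_lists (Suc (Suc (Suc 0))) cuts)"
  by code_simp+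

lemma normal_lightest: assumes "normal M" "{#u, v#} \<subseteq># M" shows "lightest u v"
proof -
  have "wt u + wt v \<le> wt s + wt (opp u v s)" if "s \<in> set (box u v)" for s
  proof -
    have "{#u, v#} \<approx> {#s, opp u v s#}" using that by (simp add: pair_fibre_iff)
    then show ?thesis using assms unfolding normal_def weight_def by fastforce
  qed
  then show ?thesis by (simp add: lightest_def list_all_iff)
qed

lemma normal_unique_small:
  assumes "normal M" "normal N" "M \<approx> N" "size M \<le> 3" shows "M = N"
proof -
  have "size M = 0 \<or> size M = Suc 0 \<or> size M = Suc (Suc 0) \<or> size M = Suc (Suc (Suc 0))" using assms(4) by linarith
  then have sep: "separates features (light_lists (size M) cuts)" using light_lists_separated by auto
  obtain k where k: "size M = k" "size N = k" using assms(3) by (simp add: same_fibre_def)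
  obtain l where l: "l \<in> set (light_lists k cuts)" "mset l = M"
    using light_lists_complete[of M cuts k] k normal_lightest[OF assms(1)] set_cuts by blast
  obtain l' where l': "l' \<in> set (light_lists k cuts)" "mset l' = N"
    using light_lists_complete[of N cuts k] k normal_lightest[OF assms(2)] set_cuts by blast
  have "f l = f l'" if "f \<in> set features" for f
    using that assms(3) l(2) l'(2) unfolding features_def same_fibre_def by (auto simp: at_least_iff)
  then have "l = l'" using separatesD[OF sep] l(1) l'(1) k by metis
  then show ?thesis using l l' by simp
qed

lemma joinable_small:
  assumes "M \<approx> N" "size M \<le> 3" obtains V where "step\<^sup>*\<^sup>* M V" "step\<^sup>*\<^sup>* N V"
proof -
  obtain V W where V: "step\<^sup>*\<^sup>* M V" "normal V" and W: "step\<^sup>*\<^sup>* N W" "normal W"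
    using normal_form_exists by meson
  have "V \<approx> W" using V(1) W(1) assms(1) by (meson steps_fibre fibre_sym fibre_trans)
  moreover have "size V \<le> 3" using steps_fibre[OF V(1)] assms(2) by (simp add: same_fibre_def)
  ultimately have "V = W" using V(2) W(2) normal_unique_small by blast
  then show ?thesis using that V(1) W(1) by blast
qed

text \<open>
  Disjoint pairs can be rewritten independently. Pairs with a common member lie in a multiset
  of size at most 3, where irreducible multisets are unique, so the two results have a common
  normal form there.
\<close>

lemma locally_confluent:
  assumes "step M N1" "step M N2" obtains V where "step\<^sup>*\<^sup>* N1 V" "step\<^sup>*\<^sup>* N2 V"
proof -
  obtain R1 P1 Q1 where 1: "M = R1 + P1" "N1 = R1 + Q1" "size P1 = 2" "P1 \<approx> Q1" "weight Q1 < weight P1"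
    using assms(1) unfolding step_def by blast
  obtain R2 P2 Q2 where 2: "M = R2 + P2" "N2 = R2 + Q2" "size P2 = 2" "P2 \<approx> Q2" "weight Q2 < weight P2"
    using assms(2) unfolding step_def by blast
  define T where "T = P1 \<union># P2"
  define S where "S = M - T"
  have "P1 \<subseteq># M" unfolding 1(1) by simp
  moreover have "P2 \<subseteq># M" unfolding 2(1) by simp
  ultimately have M: "M = S + T" unfolding S_def T_def by simp
  obtain t1 t2 where t: "T = t1 + P1" "T = t2 + P2"
    unfolding T_def by (metis mset_subset_eq_exists_conv subset_mset.sup_ge1 subset_mset.sup_ge2 union_commute)
  have N: "N1 = S + (t1 + Q1)" "N2 = S + (t2 + Q2)"
    using 1(1,2) 2(1,2) M t by (metis add.assoc add_right_cancel)+
  have st: "step (t1 + P1) (t1 + Q1)" "step (t2 + P2) (t2 + Q2)" using 1 2 by (auto intro: stepI)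
  have T1: "t1 + Q1 \<approx> T" unfolding t(1) using 1(4) by (simp add: fibre_sym)
  have T2: "T \<approx> t2 + Q2" unfolding t(2) using 2(4) by simp
  show ?thesis
  proof (cases "P1 \<inter># P2 = {#}")
    case True
    then have "T = P2 + P1" unfolding T_def by (metis True add.commute diff_empty union_diff_inter_eq_sup)
    then have "t1 = P2" "t2 = P1" using t by auto
    then have "step (t1 + Q1) (Q1 + Q2)" "step (t2 + Q2) (Q1 + Q2)"
      using stepI[OF 2(3-5), of Q1] stepI[OF 1(3-5), of Q2] by (simp_all add: add.commute)
    then show ?thesis using that steps_add N by blast
  next
    case False
    have "size T + size (P1 \<inter># P2) = size P1 + size P2" unfolding T_def
      by (rule size_Un_Int[symmetric])
    then have "size T \<le> 3" using False 1(3) 2(3) nonempty_has_size[of "P1 \<inter># P2"] by linarith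
    then have "size (t1 + Q1) \<le> 3" using T1 unfolding same_fibre_def by metis
    then obtain V where "step\<^sup>*\<^sup>* (t1 + Q1) V" "step\<^sup>*\<^sup>* (t2 + Q2) V"
      using joinable_small fibre_trans[OF T1 T2] by blast
    then show ?thesis using that steps_add N by blast
  qed
qed

text \<open>
  Newman's lemma for this rewriting, by induction on the weight.
\<close>

lemma normal_form_unique:
  assumes "step\<^sup>*\<^sup>* M V" "normal V" "step\<^sup>*\<^sup>* M W" "normal W" shows "V = W"
  using assms
proof (induction M arbitrary: V W rule: measure_induct_rule[of "\<lambda>M. nat (weight M)"])
  case (less M)
  show ?case
  proof (cases "normal M")
    case True
    then show ?thesis using less.prems normal_steps by blast
  next
    case False
    then obtain N1 N2 where N: "step M N1" "step\<^sup>*\<^sup>* N1 V" "step M N2" "step\<^sup>*\<^sup>* N2 W"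
      using less.prems by (metis converse_rtranclpE)
    obtain U where U: "step\<^sup>*\<^sup>* N1 U" "step\<^sup>*\<^sup>* N2 U" using locally_confluent[OF N(1,3)] .
    obtain U' where U': "step\<^sup>*\<^sup>* U U'" "normal U'" using normal_form_exists by blast
    have "V = U'" using less.IH[OF step_nat_weight[OF N(1)] N(2) less.prems(2)] U U' by (meson rtranclp_trans)
    moreover have "W = U'" using less.IH[OF step_nat_weight[OF N(3)] N(4) less.prems(4)] U U' by (meson rtranclp_trans)
    ultimately show ?thesis by simp
  qed
qed

definition move :: "cut multiset \<Rightarrow> cut multiset \<Rightarrow> bool" where
  "move M N \<longleftrightarrow> (\<exists>R P Q. M = R + P \<and> N = R + Q \<and> size P = 2 \<and> P \<approx> Q)"

text \<open>
  Both pairs of a move reduce to the one irreducible pair of their fibre.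
\<close>

lemma moves_same_normal_form:
  assumes "move\<^sup>*\<^sup>* M N" shows "\<exists>V. normal V \<and> step\<^sup>*\<^sup>* M V \<and> step\<^sup>*\<^sup>* N V"
  using assms
proof (induction rule: rtranclp_induct)
  case base
  show ?case using normal_form_exists by blast
next
  case (step N N')
  then obtain V where V: "normal V" "step\<^sup>*\<^sup>* M V" "step\<^sup>*\<^sup>* N V" by blast
  obtain R P Q where R: "N = R + P" "N' = R + Q" "size P = 2" "P \<approx> Q" using step.hyps(2) unfolding move_def by blast
  obtain W where "step\<^sup>*\<^sup>* P W" "step\<^sup>*\<^sup>* Q W" using joinable_small[OF R(4)] R(3) by auto
  then have W: "step\<^sup>*\<^sup>* N (R + W)" "step\<^sup>*\<^sup>* N' (R + W)" using R steps_add by auto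
  obtain U where U: "normal U" "step\<^sup>*\<^sup>* (R + W) U" using normal_form_exists by blast
  have "U = V" using normal_form_unique[of N] V U W by (meson rtranclp_trans)
  then show ?case using V W U by (meson rtranclp_trans)
qed

section \<open>Quadratic moves connect every fibre\<close>

abbreviation connected :: "cut multiset \<Rightarrow> cut multiset \<Rightarrow> bool" where "connected \<equiv> move\<^sup>*\<^sup>*"
abbreviation odds :: "cut multiset \<Rightarrow> nat" where "odds M \<equiv> size (filter_mset par M)"

lemma move_add: "move M N \<Longrightarrow> move (R + M) (R + N)"
  unfolding move_def by (metis add.assoc)

lemma connected_add: "connected M N \<Longrightarrow> connected (R + M) (R + N)"
  by (induction rule: rtranclp_induct) (auto intro: rtranclp.rtrancl_into_rtrancl move_add)

lemma connected_fibre: "connected M N \<Longrightarrow> M \<approx> N"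
  by (induction rule: rtranclp_induct) (auto simp: move_def intro: fibre_trans)

lemma connected_sym: "connected M N \<Longrightarrow> connected N M"
proof (induction rule: rtranclp_induct)
  case (step N N')
  then have "move N' N" unfolding move_def using fibre_sym by (metis same_fibre_def)
  with step.IH show ?case by (rule converse_rtranclp_into_rtranclp[rotated])
qed simp

lemma connected_image:
  assumes "symmetry \<sigma>" "connected M N" shows "connected (image_mset \<sigma> M) (image_mset \<sigma> N)"
  using assms(2)
proof (induction rule: rtranclp_induct)
  case (step N N')
  then obtain R P Q where "N = R + P" "N' = R + Q" "size P = 2" "P \<approx> Q" unfolding move_def by blast
  then have "move (image_mset \<sigma> N) (image_mset \<sigma> N')"
    unfolding move_def using symmetry_fibre[OF assms(1)] by (metis image_mset_union size_image_mset)
  with step.IH show ?case by (rule rtranclp.rtrancl_into_rtrancl)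
qed simp

text \<open>
  A move that replaces two members of a multiset keeps all others available; the parity count
  is recorded because the argument below equalizes it first.
\<close>

lemma exchange:
  assumes "u \<in># M" "v \<in># M" "u \<noteq> v" "{#u, v#} \<approx> {#s, t#}"
  shows "\<exists>M'. connected M M' \<and> s \<in># M' \<and> t \<in># M' \<and> (\<forall>w. w \<in># M \<longrightarrow> w \<noteq> u \<longrightarrow> w \<noteq> v \<longrightarrow> w \<in># M') \<and>
    odds M + odds {#s, t#} = odds M' + odds {#u, v#}"
proof -
  obtain R where R: "M = R + {#u, v#}"
  proof -
    obtain K where K: "M = add_mset u K" using assms(1) by (metis insert_DiffM)
    then have "v \<in># K" using assms(2,3) by auto
    then obtain L where "K = add_mset v L" by (metis insert_DiffM)
    then show ?thesis using that[of L] K by simp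
  qed
  have "move M (R + {#s, t#})" unfolding move_def R using assms(4) by (intro exI conjI) auto
  then have "connected M (R + {#s, t#})" by blast
  then show ?thesis by (intro exI[of _ "R + {#s, t#}"]) (auto simp: R)
qed

lemma exchange_same_parity:
  assumes "u \<in># M" "v \<in># M" "u \<noteq> v" "{#u, v#} \<approx> {#s, t#}" "par s = par u" "par t = par v"
  obtains M' where "connected M M'" "s \<in># M'" "\<And>w. w \<in># M \<Longrightarrow> w \<noteq> u \<Longrightarrow> w \<noteq> v \<Longrightarrow> w \<in># M'" "odds M' = odds M"
proof -
  have "odds {#s, t#} = odds {#u, v#}" using assms(5,6) by simp
  then show ?thesis using exchange[OF assms(1-4)] that by auto
qed

text \<open>
  Affine functions of the edge entries and the parity. Their sums over two multisets of one
  fibre agree up to the contribution of the parity.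
\<close>

definition linear_form :: "int \<Rightarrow> int \<Rightarrow> (int \<times> int \<times> int \<times> int \<times> int \<times> int \<times> int) \<Rightarrow> cut \<Rightarrow> int" where
  "linear_form k l = (\<lambda>(c1, c2, c3, c4, c5, c6, c7) u. k + l * of_bool (par u) + c1 * of_bool (e1 u) + c2 * of_bool (e2 u) +
     c3 * of_bool (e3 u) + c4 * of_bool (e4 u) + c5 * of_bool (e5 u) + c6 * of_bool (e6 u) + c7 * of_bool (e7 u))"

lemma sum_linear_form:
  "(\<Sum>u\<in>#M. linear_form k l (c1, c2, c3, c4, c5, c6, c7) u) =
     k * int (size M) + l * int (odds M) +
     c1 * int (size (filter_mset e1 M)) + c2 * int (size (filter_mset e2 M)) + c3 * int (size (filter_mset e3 M)) +
     c4 * int (size (filter_mset e4 M)) + c5 * int (size (filter_mset e5 M)) + c6 * int (size (filter_mset e6 M)) +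
     c7 * int (size (filter_mset e7 M))"
  by (induction M) (auto simp: linear_form_def algebra_simps)

lemma fibre_sum:
  assumes "M \<approx> N"
  shows "(\<Sum>u\<in>#M. linear_form k l c u) - l * int (odds M) = (\<Sum>u\<in>#N. linear_form k l c u) - l * int (odds N)"
proof -
  obtain c1 c2 c3 c4 c5 c6 c7 where c: "c = (c1, c2, c3, c4, c5, c6, c7)" by (metis prod.collapse)
  show ?thesis unfolding c sum_linear_form using assms by (simp add: same_fibre_def coords_def)
qed

lemma sum_mset_nonneg_on:
  fixes g :: "cut \<Rightarrow> int"
  assumes "\<And>u. u \<in># M \<Longrightarrow> 0 \<le> g u" shows "0 \<le> (\<Sum>u\<in>#M. g u)"
  using assms by (induction M) auto

lemma sum_mset_zero_on:
  fixes g :: "cut \<Rightarrow> int"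
  assumes "\<And>u. u \<in># M \<Longrightarrow> g u = 0" shows "(\<Sum>u\<in>#M. g u) = 0"
  using assms by (induction M) auto

lemma sum_mset_pos_on:
  fixes g :: "cut \<Rightarrow> int"
  assumes "\<And>u. u \<in># M \<Longrightarrow> 0 \<le> g u" "v \<in># M" "0 < g v" shows "0 < (\<Sum>u\<in>#M. g u)"
proof -
  obtain R where "M = add_mset v R" using assms(2) by (metis insert_DiffM)
  then show ?thesis using sum_mset_nonneg_on[of R g] assms(1,3) by (simp add: add_pos_nonneg)
qed

text \<open>
  If a linear function of the edge entries dominates the parity everywhere, with equality on
  \<open>M\<close>, then no member of the fibre has more odd cuts than \<open>M\<close>.
  Conversely, when another member has more, some cut of \<open>M\<close> violates the
  equality.
\<close>

lemma odds_bound: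
  assumes "M \<approx> N" "\<And>u. u \<in># M \<Longrightarrow> linear_form k (-1) c u = 0" "\<And>u. 0 \<le> linear_form k (-1) c u"
  shows "odds N \<le> odds M"
proof -
  have "(\<Sum>u\<in>#M. linear_form k (-1) c u) = 0" by (rule sum_mset_zero_on) (rule assms(2))
  moreover have "0 \<le> (\<Sum>u\<in>#N. linear_form k (-1) c u)" by (rule sum_mset_nonneg_on) (rule assms(3))
  ultimately show ?thesis using fibre_sum[OF assms(1), of k "-1" c] by linarith
qed

lemma no_strict:
  assumes "M \<approx> N" "odds M = odds N" "\<And>u. u \<in># M \<Longrightarrow> linear_form k l c u = 0" "\<And>u. 0 \<le> linear_form k l c u"
    "v \<in># N" "0 < linear_form k l c v" shows False
proof -
  have "(\<Sum>u\<in>#M. linear_form k l c u) = 0" by (rule sum_mset_zero_on) (rule assms(3))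
  moreover have "0 < (\<Sum>u\<in>#N. linear_form k l c u)" by (rule sum_mset_pos_on[of N "linear_form k l c" v]) (use assms(4-6) in auto)
  moreover have "l * int (odds M) = l * int (odds N)" using assms(2) by simp
  ultimately show ?thesis using fibre_sum[OF assms(1), of k l c] by linarith
qed

lemma ex_even_path1:
  assumes "M \<approx> N" "odds M < odds N" obtains b x y where "Cut False a b x y \<in># M"
proof (rule ccontr)
  assume "\<not> thesis"
  then have no: "Cut False a b x y \<notin># M" for b x y using that by blast
  show False
  proof (cases a)
    case True
    have "odds N \<le> odds M"
    proof (rule odds_bound[OF assms(1), of 0 "(1, 1, 0, 0, 0, 0, 0)"])
      show "linear_form 0 (-1) (1, 1, 0, 0, 0, 0, 0) u = 0" if "u \<in># M" for u
      proof (cases u)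
        case (Cut p c d x y)
        then show ?thesis using that no True by (cases p; cases c; cases d) (auto simp: linear_form_def of_bool_def)
      qed
      show "0 \<le> linear_form 0 (-1) (1, 1, 0, 0, 0, 0, 0) u" for u
        by (cases u) (auto simp: linear_form_def of_bool_def)
    qed
    then show False using assms(2) by simp
  next
    case False
    have "odds N \<le> odds M"
    proof (rule odds_bound[OF assms(1), of 2 "(-1, -1, 0, 0, 0, 0, 0)"])
      show "linear_form 2 (-1) (-1, -1, 0, 0, 0, 0, 0) u = 0" if "u \<in># M" for u
      proof (cases u)
        case (Cut p c d x y)
        then show ?thesis using that no False by (cases p; cases c; cases d) (auto simp: linear_form_def of_bool_def)
      qed
      show "0 \<le> linear_form 2 (-1) (-1, -1, 0, 0, 0, 0, 0) u" for u
        by (cases u) (auto simp: linear_form_def of_bool_def)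
    qed
    then show False using assms(2) by simp
  qed
qed

lemma ex_even_path2:
  assumes "M \<approx> N" "odds M < odds N" obtains a x y where "Cut False a b x y \<in># M"
proof (rule ccontr)
  assume "\<not> thesis"
  then have no: "Cut False a b x y \<notin># M" for a x y using that by blast
  show False
  proof (cases b)
    case True
    have "odds N \<le> odds M"
    proof (rule odds_bound[OF assms(1), of 0 "(0, 0, 1, 1, 0, 0, 0)"])
      show "linear_form 0 (-1) (0, 0, 1, 1, 0, 0, 0) u = 0" if "u \<in># M" for u
      proof (cases u)
        case (Cut p c d x y)
        then show ?thesis using that no True by (cases p; cases c; cases d) (auto simp: linear_form_def of_bool_def)
      qed
      show "0 \<le> linear_form 0 (-1) (0, 0, 1, 1, 0, 0, 0) u" for u
        by (cases u) (auto simp: linear_form_def of_bool_def)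
    qed
    then show False using assms(2) by simp
  next
    case False
    have "odds N \<le> odds M"
    proof (rule odds_bound[OF assms(1), of 2 "(0, 0, -1, -1, 0, 0, 0)"])
      show "linear_form 2 (-1) (0, 0, -1, -1, 0, 0, 0) u = 0" if "u \<in># M" for u
      proof (cases u)
        case (Cut p c d x y)
        then show ?thesis using that no False by (cases p; cases c; cases d) (auto simp: linear_form_def of_bool_def)
      qed
      show "0 \<le> linear_form 2 (-1) (0, 0, -1, -1, 0, 0, 0) u" for u
        by (cases u) (auto simp: linear_form_def of_bool_def)
    qed
    then show False using assms(2) by simp
  qed
qed

text \<open>
  The function is the Hamming distance on the long path from the common part of the even cuts
  of \<open>M\<close>. It is at least the parity.
\<close>

lemma ex_complement:
  assumes "M \<approx> N" "odds M < odds N"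
    "\<And>a b x' y'. Cut False a b x' y' \<in># M \<Longrightarrow> x' = x \<and> y' = y"
  obtains a b where "Cut True a b (\<not> x) (\<not> y) \<in># M"
proof (rule ccontr)
  assume "\<not> thesis"
  then have no: "Cut True a b (\<not> x) (\<not> y) \<notin># M" for a b using that by blast
  let ?s = "\<lambda>b. if b then (-1) else (1::int)"
  let ?k = "of_bool x + of_bool y + of_bool (x \<noteq> y)"
  let ?c = "(0, 0, 0, 0, ?s x, ?s y, ?s (x \<noteq> y))"
  have "odds N \<le> odds M"
  proof (rule odds_bound[OF assms(1), of ?k ?c])
    show "linear_form ?k (-1) ?c u = 0" if "u \<in># M" for u
    proof -
      obtain p a b x' y' where u: "u = Cut p a b x' y'" by (cases u)
      have "x' = x \<and> y' = y" if "\<not> p" using \<open>u \<in># M\<close> assms(3)[of a b x' y'] that unfolding u by simp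
      moreover have "\<not> (x' = (\<not> x) \<and> y' = (\<not> y))" if p
      proof
        assume "x' = (\<not> x) \<and> y' = (\<not> y)"
        then have "Cut True a b (\<not> x) (\<not> y) \<in># M" using \<open>u \<in># M\<close> \<open>p\<close> unfolding u by simp
        then show False using no by blast
      qed
      ultimately show ?thesis unfolding u by (cases p; cases x; cases y; cases x'; cases y') (auto simp: linear_form_def of_bool_def)
    qed
    show "0 \<le> linear_form ?k (-1) ?c u" for u
    proof -
      obtain p a b x' y' where u: "u = Cut p a b x' y'" by (cases u)
      show ?thesis unfolding u by (cases p; cases x; cases y; cases x'; cases y') (auto simp: linear_form_def of_bool_def)
    qed
  qed
  then show False using assms(2) by simp
qed

lemma swap_path1: "{#Cut p a b x y, Cut p a' b' x' y'#} \<approx> {#Cut p a' b x y, Cut p a b' x' y'#}"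
  by (cases a; cases a'; simp add: same_fibre_def coords_def)

lemma swap_path2: "{#Cut p a b x y, Cut p a' b' x' y'#} \<approx> {#Cut p a b' x y, Cut p a' b x' y'#}"
  by (cases b; cases b'; simp add: same_fibre_def coords_def)

text \<open>
  On the long path, a cut and its complement have opposite parity, and all four complementary
  pairs have the same sum.
\<close>

lemma trade_complements:
  "{#Cut p a b x y, Cut (\<not> p) a' b' (\<not> x) (\<not> y)#} \<approx> {#Cut p a b x' y', Cut (\<not> p) a' b' (\<not> x') (\<not> y')#}"
  by (cases p; cases x; cases y; cases x'; cases y'; simp add: same_fibre_def coords_def)

lemma even_to_odd:
  assumes "(x, y) \<noteq> (x', y')"
  obtains s t where "par s" "par t" "{#Cut False a b x y, Cut False (\<not> a) (\<not> b) x' y'#} \<approx> {#s, t#}"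
proof -
  let ?s = "if x \<noteq> x' then Cut True a b (\<not> x) y else Cut True a b x (\<not> y)"
  let ?t = "opp (Cut False a b x y) (Cut False (\<not> a) (\<not> b) x' y') ?s"
  have "par ?s" "par ?t" "{#Cut False a b x y, Cut False (\<not> a) (\<not> b) x' y'#} \<approx> {#?s, ?t#}"
    using assms by (cases x; cases y; cases x'; cases y'; simp add: same_fibre_def coords_def)+
  then show ?thesis by (rule that)
qed

text \<open>
  Two even cuts that differ on all three paths can be replaced by two odd cuts. Such a pair is
  assembled by moves: the first step finds even cuts that differ on the long path, the next
  two make them differ on the short ones, where \<open>odds_bound\<close> provides the even
  cuts to swap with.
\<close>

lemma increase_odds:
  assumes "M \<approx> N" "odds M < odds N"
  obtains M' where "connected M M'" "odds M < odds M'"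
proof -
  \<comment> \<open>Two even cuts that differ on the long path, if necessary after a trade of complements.\<close>
  have "\<exists>M1 a b x y a' b' x' y'. connected M M1 \<and> odds M1 = odds M \<and>
      Cut False a b x y \<in># M1 \<and> Cut False a' b' x' y' \<in># M1 \<and> (x, y) \<noteq> (x', y')"
  proof (cases "\<exists>a b x y a' b' x' y'. Cut False a b x y \<in># M \<and> Cut False a' b' x' y' \<in># M \<and> (x, y) \<noteq> (x', y')")
    case True
    then show ?thesis by blast
  next
    case False
    obtain b x y where u: "Cut False False b x y \<in># M" using ex_even_path1[OF assms] .
    obtain b' x' y' where v: "Cut False True b' x' y' \<in># M" using ex_even_path1[OF assms] .
    have same: "x' = x \<and> y' = y" if "Cut False a b x' y' \<in># M" for a b x' y' using False u that by blast
    obtain c d where w: "Cut True c d (\<not> x) (\<not> y) \<in># M" using ex_complement[OF assms same] .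
    have tr: "{#Cut False False b x y, Cut True c d (\<not> x) (\<not> y)#} \<approx> {#Cut False False b (\<not> x) y, Cut True c d x (\<not> y)#}"
      using trade_complements[of False False b x y c d "\<not> x" y] by simp
    obtain M1 where M1: "connected M M1" "Cut False False b (\<not> x) y \<in># M1"
      "\<And>w'. w' \<in># M \<Longrightarrow> w' \<noteq> Cut False False b x y \<Longrightarrow> w' \<noteq> Cut True c d (\<not> x) (\<not> y) \<Longrightarrow> w' \<in># M1"
      "odds M1 = odds M"
      by (rule exchange_same_parity[OF u w _ tr]) simp_all
    have "Cut False True b' x y \<in># M1" using M1(3)[OF v] same[OF v] by simp
    moreover have "(\<not> x, y) \<noteq> (x, y)" by simp
    ultimately show ?thesis using M1(1,2,4) by blast
  qed
  then obtain M1 a b x y a' b' x' y' where M1: "connected M M1" "odds M1 = odds M"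
      "Cut False a b x y \<in># M1" "Cut False a' b' x' y' \<in># M1" "(x, y) \<noteq> (x', y')" by blast
  have f1: "M1 \<approx> N" using M1(1) assms(1) by (meson connected_fibre fibre_sym fibre_trans)
  have "\<exists>M2 b'. connected M M2 \<and> odds M2 = odds M \<and> Cut False a b x y \<in># M2 \<and> Cut False (\<not> a) b' x' y' \<in># M2"
  proof (cases "a' = a")
    case True
    obtain d z w where c: "Cut False (\<not> a) d z w \<in># M1" using ex_even_path1[OF f1] M1(2) assms(2) by metis
    obtain M2 where M2: "connected M1 M2" "Cut False (\<not> a) b' x' y' \<in># M2"
      "\<And>w'. w' \<in># M1 \<Longrightarrow> w' \<noteq> Cut False a' b' x' y' \<Longrightarrow> w' \<noteq> Cut False (\<not> a) d z w \<Longrightarrow> w' \<in># M2"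
      "odds M2 = odds M1"
      by (rule exchange_same_parity[OF M1(4) c _ swap_path1]) (use True in simp_all)
    have "Cut False a b x y \<in># M2" using M2(3)[OF M1(3)] M1(5) by simp
    then show ?thesis using M1(1,2) M2(1,2,4) by (metis rtranclp_trans)
  next
    case False
    then show ?thesis using M1 by (metis (full_types))
  qed
  then obtain M2 b' where M2: "connected M M2" "odds M2 = odds M" "Cut False a b x y \<in># M2"
      "Cut False (\<not> a) b' x' y' \<in># M2" by blast
  have f2: "M2 \<approx> N" using M2(1) assms(1) by (meson connected_fibre fibre_sym fibre_trans)
  have "\<exists>M3. connected M M3 \<and> odds M3 = odds M \<and> Cut False a b x y \<in># M3 \<and> Cut False (\<not> a) (\<not> b) x' y' \<in># M3"
  proof (cases "b' = b")
    case True
    obtain d z w where c: "Cut False d (\<not> b) z w \<in># M2" using ex_even_path2[OF f2] M2(2) assms(2) by metis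
    obtain M3 where M3: "connected M2 M3" "Cut False (\<not> a) (\<not> b) x' y' \<in># M3"
      "\<And>w'. w' \<in># M2 \<Longrightarrow> w' \<noteq> Cut False (\<not> a) b' x' y' \<Longrightarrow> w' \<noteq> Cut False d (\<not> b) z w \<Longrightarrow> w' \<in># M3"
      "odds M3 = odds M2"
      by (rule exchange_same_parity[OF M2(4) c _ swap_path2]) (use True in simp_all)
    have "Cut False a b x y \<in># M3" using M3(3)[OF M2(3)] M1(5) True by simp
    then show ?thesis using M2(1,2) M3(1,2,4) by (metis rtranclp_trans)
  next
    case False
    then show ?thesis using M2 by (metis (full_types))
  qed
  then obtain M3 where M3: "connected M M3" "odds M3 = odds M" "Cut False a b x y \<in># M3"
      "Cut False (\<not> a) (\<not> b) x' y' \<in># M3" by blast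
  obtain s t where st: "par s" "par t" "{#Cut False a b x y, Cut False (\<not> a) (\<not> b) x' y'#} \<approx> {#s, t#}"
    using even_to_odd[OF M1(5)] .
  obtain M4 where "connected M3 M4" "odds M3 + odds {#s, t#} = odds M4 + odds {#Cut False a b x y, Cut False (\<not> a) (\<not> b) x' y'#}"
    using exchange[OF M3(3,4) _ st(3)] by auto
  then have "connected M M4" "odds M < odds M4" using M3(1,2) st(1,2) by auto
  then show ?thesis by (rule that)
qed

lemma equal_odds:
  assumes "M \<approx> N" shows "\<exists>M' N'. connected M M' \<and> connected N N' \<and> odds M' = odds N'"
  using assms
proof (induction "2 * size M - odds M - odds N" arbitrary: M N rule: less_induct)
  case less
  have le: "odds K \<le> size K" for K :: "cut multiset" by (rule size_mset_mono) simp
  have sz: "size M = size N" using less.prems by (simp add: same_fibre_def)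
  consider "odds M = odds N" | "odds M < odds N" | "odds N < odds M" by linarith
  then show ?case
  proof cases
    case 2
    obtain M' where M': "connected M M'" "odds M < odds M'" using increase_odds[OF less.prems 2] .
    have f: "M' \<approx> N" using connected_fibre[OF M'(1)] less.prems fibre_sym fibre_trans by blast
    have "size M' = size M" using connected_fibre[OF M'(1)] by (simp add: same_fibre_def)
    then have "2 * size M' - odds M' - odds N < 2 * size M - odds M - odds N"
      using M'(2) le[of M'] le[of N] le[of M] sz by linarith
    from less.hyps[OF this f] show ?thesis using M'(1) by (meson rtranclp_trans)
  next
    case 3
    obtain N' where N': "connected N N'" "odds N < odds N'" using increase_odds[OF fibre_sym[OF less.prems] 3] .
    have f: "M \<approx> N'" using connected_fibre[OF N'(1)] less.prems fibre_trans by blast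
    have "size N' = size N" using connected_fibre[OF N'(1)] by (simp add: same_fibre_def)
    then have "2 * size M - odds M - odds N' < 2 * size M - odds M - odds N"
      using N'(2) le[of N'] le[of N] le[of M] sz by linarith
    from less.hyps[OF this f] show ?thesis using N'(1) by (meson rtranclp_trans)
  qed blast
qed

text \<open>
  For the short paths a suitable even cut exists since otherwise \<open>no_strict\<close>
  applies. For the long path, each of the four complementary pairs carries a signed count
  (even minus odd), the sum of an affine function of the cuts and hence the same for
  \<open>M\<close> and \<open>N\<close>. If \<open>M\<close> contains neither an even cut that
  vanishes on the long path nor two complementary cuts, then on each of these axes only one
  sign occurs in \<open>M\<close>, and the correspondingly signed sum of the affine functions
  is maximal at every member of \<open>M\<close> but not at the empty cut.
\<close>

lemma pull_origin:
  assumes "M \<approx> N" "odds M = odds N" "Cut False False False False False \<in># N"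
  obtains M' where "connected M M'" "Cut False False False False False \<in># M'"
proof -
  let ?o = "Cut False False False False False"
  have ex1: "\<exists>b x y. Cut False False b x y \<in># K" if "K \<approx> N" "odds K = odds N" for K
  proof (rule ccontr)
    assume no: "\<not> (\<exists>b x y. Cut False False b x y \<in># K)"
    show False
    proof (rule no_strict[OF that, of 2 "-1" "(-1, -1, 0, 0, 0, 0, 0)" ?o])
      show "linear_form 2 (-1) (-1, -1, 0, 0, 0, 0, 0) u = 0" if "u \<in># K" for u
      proof (cases u)
        case (Cut p c d x y)
        then show ?thesis using that no by (cases p; cases c; cases d) (auto simp: linear_form_def of_bool_def)
      qed
      show "0 \<le> linear_form 2 (-1) (-1, -1, 0, 0, 0, 0, 0) u" for u
        by (cases u) (auto simp: linear_form_def of_bool_def)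
    qed (use assms(3) in \<open>auto simp: linear_form_def\<close>)
  qed
  have ex2: "\<exists>a x y. Cut False a False x y \<in># K" if "K \<approx> N" "odds K = odds N" for K
  proof (rule ccontr)
    assume no: "\<not> (\<exists>a x y. Cut False a False x y \<in># K)"
    show False
    proof (rule no_strict[OF that, of 2 "-1" "(0, 0, -1, -1, 0, 0, 0)" ?o])
      show "linear_form 2 (-1) (0, 0, -1, -1, 0, 0, 0) u = 0" if "u \<in># K" for u
      proof (cases u)
        case (Cut p c d x y)
        then show ?thesis using that no by (cases p; cases c; cases d) (auto simp: linear_form_def of_bool_def)
      qed
      show "0 \<le> linear_form 2 (-1) (0, 0, -1, -1, 0, 0, 0) u" for u
        by (cases u) (auto simp: linear_form_def of_bool_def)
    qed (use assms(3) in \<open>auto simp: linear_form_def\<close>)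
  qed
  have "\<exists>M1 a b. connected M M1 \<and> odds M1 = odds M \<and> Cut False a b False False \<in># M1"
  proof (cases "\<exists>a b. Cut False a b False False \<in># M")
    case True
    then show ?thesis by blast
  next
    case no0: False
    have "\<exists>a b x y a' b'. Cut False a b x y \<in># M \<and> Cut True a' b' (\<not> x) (\<not> y) \<in># M"
    proof (rule ccontr)
      assume none: "\<not> ?thesis"
      \<comment> \<open>The sign that occurs on the axis of the even part with entries x and y.\<close>
      define s :: "bool \<Rightarrow> bool \<Rightarrow> int" where
        "s x y = (if \<exists>a b. Cut False a b x y \<in># M then 1 else -1)" for x y
      let ?s1 = "s True True" and ?s2 = "s True False" and ?s3 = "s False True"
      let ?c = "(0, 0, 0, 0, - 1 - ?s1 - ?s2 + ?s3, - 1 - ?s1 + ?s2 - ?s3, - 1 + ?s1 - ?s2 - ?s3)"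
      let ?l = "- 1 + ?s1 + ?s2 + ?s3"
      have s: "s x y = 1 \<or> s x y = -1" for x y by (auto simp: s_def)
      show False
      proof (rule no_strict[OF assms(1,2), of 4 ?l ?c ?o])
        show "linear_form 4 ?l ?c u = 0" if "u \<in># M" for u
        proof -
          obtain p a b x y where u: "u = Cut p a b x y" by (cases u)
          have 1: "\<not> p \<Longrightarrow> s x y = 1" using that unfolding s_def u by auto
          have 2: "s (\<not> x) (\<not> y) = -1" if p
          proof -
            have "Cut True a b (\<not> \<not> x) (\<not> \<not> y) \<in># M" using \<open>u \<in># M\<close> that u by simp
            then have "\<not> (\<exists>a b. Cut False a b (\<not> x) (\<not> y) \<in># M)" using none by blast
            then show ?thesis by (simp add: s_def)
          qed
          have 3: "\<not> p \<Longrightarrow> x \<or> y" using that no0 unfolding u by (cases x; cases y; cases p) auto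
          show ?thesis unfolding u using 1 2 3 no0
            by (cases p; cases x; cases y) (auto simp: linear_form_def of_bool_def s_def)
        qed
        show "0 \<le> linear_form 4 ?l ?c u" for u
        proof -
          obtain p a b x y where u: "u = Cut p a b x y" by (cases u)
          show ?thesis unfolding u using s[of True True] s[of True False] s[of False True]
            by (cases p; cases x; cases y) (auto simp: linear_form_def of_bool_def)
        qed
      qed (use assms(3) in \<open>auto simp: linear_form_def\<close>)
    qed
    then obtain a b x y a' b' where uv: "Cut False a b x y \<in># M" "Cut True a' b' (\<not> x) (\<not> y) \<in># M" by blast
    have tr: "{#Cut False a b x y, Cut True a' b' (\<not> x) (\<not> y)#} \<approx> {#Cut False a b False False, Cut True a' b' True True#}"
      using trade_complements[of False a b x y a' b' False False] by simp
    obtain M1 where "connected M M1" "Cut False a b False False \<in># M1" "odds M1 = odds M"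
      by (rule exchange_same_parity[OF uv _ tr]) simp_all
    then show ?thesis by blast
  qed
  then obtain M1 a b where M1: "connected M M1" "odds M1 = odds N" "Cut False a b False False \<in># M1" using assms(2) by auto
  have f1: "M1 \<approx> N" using M1(1) assms(1) by (meson connected_fibre fibre_sym fibre_trans)
  have "\<exists>M2 b. connected M M2 \<and> odds M2 = odds N \<and> Cut False False b False False \<in># M2"
  proof (cases a)
    case True
    obtain d z w where c: "Cut False False d z w \<in># M1" using ex1[OF f1 M1(2)] by blast
    obtain M2 where "connected M1 M2" "Cut False False b False False \<in># M2" "odds M2 = odds M1"
      by (rule exchange_same_parity[OF M1(3) c _ swap_path1]) (use True in simp_all)
    then show ?thesis using M1 by (metis rtranclp_trans)
  qed (use M1 in auto)
  then obtain M2 b where M2: "connected M M2" "odds M2 = odds N" "Cut False False b False False \<in># M2" by blast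
  have f2: "M2 \<approx> N" using M2(1) assms(1) by (meson connected_fibre fibre_sym fibre_trans)
  show ?thesis
  proof (cases b)
    case True
    obtain d z w where c: "Cut False d False z w \<in># M2" using ex2[OF f2 M2(2)] by blast
    obtain M3 where "connected M2 M3" "?o \<in># M3" "odds M3 = odds M2"
      by (rule exchange_same_parity[OF M2(3) c _ swap_path2]) (use True in simp_all)
    then show ?thesis using M2 that by (metis rtranclp_trans)
  qed (use M2 that in auto)
qed

text \<open>
  Switching by \<open>u\<close> turns \<open>u\<close> into the empty cut and keeps equal
  parity counts equal.
\<close>

lemma pull:
  assumes "M \<approx> N" "odds M = odds N" "u \<in># N"
  obtains M' where "connected M M'" "u \<in># M'"
proof -
  let ?t = "translate u"
  have sym: "symmetry ?t" by (rule symmetry_translate)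
  have tt: "?t (?t v) = v" for v using sym by (simp add: symmetry_def)
  have o: "?t u = Cut False False False False False" by (cases u) simp
  have odds: "odds (image_mset ?t K) = (if par u then size K - odds K else odds K)" for K
  proof -
    have "par (?t v) = (par u \<noteq> par v)" for v by (cases u; cases v) simp
    then have "odds (image_mset ?t K) = size (filter_mset (\<lambda>v. par u \<noteq> par v) K)"
      by (simp add: filter_mset_image_mset)
    moreover have "size (filter_mset (\<lambda>v. \<not> par v) K) = size K - odds K"
      by (metis add_diff_cancel_left' multiset_partition size_union)
    ultimately show ?thesis by (cases "par u") auto
  qed
  have "Cut False False False False False \<in># image_mset ?t N" using assms(3) o by (metis image_eqI set_image_mset)
  moreover have "image_mset ?t M \<approx> image_mset ?t N" using assms(1) symmetry_fibre[OF sym] by blast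
  moreover have "odds (image_mset ?t M) = odds (image_mset ?t N)"
    unfolding odds using assms(1,2) by (simp add: same_fibre_def)
  ultimately obtain M' where M': "connected (image_mset ?t M) M'" "?t u \<in># M'"
    using pull_origin o by metis
  have "connected (image_mset ?t (image_mset ?t M)) (image_mset ?t M')" using connected_image[OF sym M'(1)] .
  then have "connected M (image_mset ?t M')" by (simp add: multiset.map_comp comp_def tt)
  moreover have "u \<in># image_mset ?t M'" using M'(2) tt by (metis image_eqI set_image_mset)
  ultimately show ?thesis by (rule that)
qed

text \<open>
  After equalizing the parity counts, a member of \<open>N\<close> can be moved into
  \<open>M\<close>; remove it from both and use induction.
\<close>

lemma fibre_connected: "M \<approx> N \<Longrightarrow> connected M N"
proof (induction "size M" arbitrary: M N)
  case 0
  then show ?case by (simp add: same_fibre_def)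
next
  case (Suc n)
  obtain M1 N1 where 1: "connected M M1" "connected N N1" "odds M1 = odds N1" using equal_odds[OF Suc.prems] by blast
  have f: "M1 \<approx> N1" using 1 Suc.prems by (meson connected_fibre fibre_sym fibre_trans)
  have sz: "size M1 = Suc n" using connected_fibre[OF 1(1)] Suc.hyps(2) by (simp add: same_fibre_def)
  then have "N1 \<noteq> {#}" using f by (auto simp: same_fibre_def)
  then obtain u where u: "u \<in># N1" by blast
  obtain M2 where M2: "connected M1 M2" "u \<in># M2" using pull[OF f 1(3) u] .
  obtain M3 N3 where 3: "M2 = add_mset u M3" "N1 = add_mset u N3" using M2(2) u by (meson multi_member_split)
  have "{#u#} + M3 \<approx> {#u#} + N3" using f connected_fibre[OF M2(1)] 3 fibre_sym fibre_trans by (metis add_mset_add_single add.commute)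
  then have f3: "M3 \<approx> N3" by (simp only: fibre_add_cancel)
  have "size M2 = Suc n" using connected_fibre[OF M2(1)] sz by (simp add: same_fibre_def)
  then have "connected M3 N3" using Suc.hyps(1)[OF _ f3] 3(1) by simp
  then have "connected M2 N1" using connected_add[of M3 N3 "{#u#}"] 3 by simp
  then show ?case using 1 M2 by (meson connected_sym rtranclp_trans)
qed

lemma normal_unique: assumes "normal M" "normal N" "M \<approx> N" shows "M = N"
  using moves_same_normal_form[OF fibre_connected[OF assms(3)]] normal_steps assms by metis

section \<open>Lexicographic orders leave two minimal cubics in a fibre\<close>

text \<open>
  The least pairs for a lexicographic order with variables ranked by \<open>f\<close>: every
  other pair of the fibre contains a larger variable.
\<close>

definition max_pair :: "(cut \<Rightarrow> nat) \<Rightarrow> cut \<Rightarrow> cut \<Rightarrow> bool" where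
  "max_pair f u v \<longleftrightarrow> (\<forall>s t. {#u, v#} \<approx> {#s, t#} \<longrightarrow> {#s, t#} = {#u, v#} \<or>
     (\<exists>r\<in>{s, t}. f u < f r \<and> f v < f r))"

lemma symmetry_max_pair:
  assumes "symmetry \<sigma>" shows "max_pair (f \<circ> \<sigma>) u v \<longleftrightarrow> max_pair f (\<sigma> u) (\<sigma> v)"
proof -
  have \<sigma>\<sigma>: "\<sigma> (\<sigma> w) = w" for w using assms by (simp add: symmetry_def)
  have all: "(\<forall>s t. P (\<sigma> s) (\<sigma> t)) = (\<forall>s t. P s t)" for P using \<sigma>\<sigma> by metis
  have eq: "{#\<sigma> s, \<sigma> t#} = {#\<sigma> u, \<sigma> v#} \<longleftrightarrow> {#s, t#} = {#u, v#}" for s t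
  proof
    assume "{#\<sigma> s, \<sigma> t#} = {#\<sigma> u, \<sigma> v#}"
    then have "image_mset \<sigma> {#\<sigma> s, \<sigma> t#} = image_mset \<sigma> {#\<sigma> u, \<sigma> v#}" by (rule arg_cong)
    then show "{#s, t#} = {#u, v#}" by (simp add: \<sigma>\<sigma>)
  next
    assume "{#s, t#} = {#u, v#}"
    then have "image_mset \<sigma> {#s, t#} = image_mset \<sigma> {#u, v#}" by (rule arg_cong)
    then show "{#\<sigma> s, \<sigma> t#} = {#\<sigma> u, \<sigma> v#}" by simp
  qed
  show ?thesis
    using all[of "\<lambda>s t. {#\<sigma> u, \<sigma> v#} \<approx> {#s, t#} \<longrightarrow> {#s, t#} = {#\<sigma> u, \<sigma> v#} \<or> (\<exists>r\<in>{s, t}. f (\<sigma> u) < f r \<and> f (\<sigma> v) < f r)"]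
    unfolding max_pair_def symmetry_pair[OF assms] eq by simp
qed

text \<open>
  Complementation of the first six entries, for cuts that avoid the last edge.
\<close>

abbreviation antipode :: "cut \<Rightarrow> cut" where "antipode \<equiv> translate (Cut False True True True True)"

lemma box_antipode: "s \<in> set (box u (antipode u)) \<longleftrightarrow> (e7 s = e7 u)"
  by (cases u; cases s rule: cut.exhaust) (simp add: set_box del: box.simps; argo)

lemma opp_antipode: "opp u (antipode u) s = antipode s"
  by (cases u; cases s) auto

text \<open>
  The empty cut is the largest even variable without the last edge, so no pair containing it
  can be least in the fibre of two of its neighbours; hence the neighbours' pairs are least.
  The other cubic consists of the least complementary pair and of two pairs that are alone in
  their fibres.
\<close>

lemma no_lex_normalized:
  fixes f :: "cut \<Rightarrow> nat"
  assumes inj: "inj f" and uc: "unique_cubics (max_pair f)"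
    and top: "\<And>u. \<not> par u \<Longrightarrow> \<not> e7 u \<Longrightarrow> f u \<le> f (Cut False False False False False)"
    and w: "par w" "\<not> e7 w" "max_pair f w (antipode w)"
  shows False
proof -
  let ?o = "Cut False False False False False"
  \<comment> \<open>The three cuts that differ from the empty cut on exactly one path.\<close>
  let ?n1 = "Cut False True False False False" and ?n2 = "Cut False False True False False" and ?n3 = "Cut False False False True True"
  have alone: "max_pair f ?o v" if v: "par v" "\<not> e7 v" for v
    unfolding max_pair_def
  proof (intro allI impI)
    fix s t assume st: "{#?o, v#} \<approx> {#s, t#}"
    have "s = ?o \<or> s = v" using st v unfolding pair_fibre_iff
      by (cases v; cases s rule: cut.exhaust) (simp add: set_box del: box.simps; argo)
    moreover have "t = opp ?o v s" using st by (simp add: pair_fibre_iff)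
    then have "(s = ?o \<longrightarrow> t = v) \<and> (s = v \<longrightarrow> t = ?o)" by (cases v) auto
    ultimately show "{#s, t#} = {#?o, v#} \<or> (\<exists>r\<in>{s, t}. f ?o < f r \<and> f v < f r)"
      by (auto simp: add_mset_commute)
  qed
  have square: "max_pair f u v" if uv: "(u, v) \<in> {(?n1, ?n2), (?n1, ?n3), (?n2, ?n3)}" for u v
    unfolding max_pair_def
  proof (intro allI impI)
    fix s t assume st: "{#u, v#} \<approx> {#s, t#}"
    have s: "s = u \<or> s = v \<or> s = ?o \<or> s = opp u v ?o" using st uv unfolding pair_fibre_iff
      by (cases s rule: cut.exhaust) (auto simp: set_box simp del: box.simps)
    have t: "t = opp u v s" using st by (simp add: pair_fibre_iff)
    have "f u \<noteq> f ?o" "f v \<noteq> f ?o" using uv inj by (auto simp: inj_eq)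
    then have less: "f u < f ?o \<and> f v < f ?o" using top[of u] top[of v] uv by fastforce
    have "(s = u \<longrightarrow> t = v) \<and> (s = v \<longrightarrow> t = u) \<and> (s = opp u v ?o \<longrightarrow> t = ?o)" using t uv by auto
    then show "{#s, t#} = {#u, v#} \<or> (\<exists>r\<in>{s, t}. f u < f r \<and> f v < f r)"
      using s less by (auto simp: add_mset_commute)
  qed
  have "clique (max_pair f) ?n1 ?n2 ?n3" using square by (simp add: clique_def)
  moreover have "clique (max_pair f) ?o w (antipode w)"
    using alone w unfolding clique_def by (cases w) auto
  moreover have "{#?o, w, antipode w#} \<approx> {#?n1, ?n2, ?n3#}"
    using w by (cases w) (auto simp: same_fibre_def coords_def)
  ultimately have "{#?o, w, antipode w#} = {#?n1, ?n2, ?n3#}" using uc unfolding unique_cubics_def by blast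
  then have "?o \<in># {#?n1, ?n2, ?n3#}" by (metis union_single_eq_member)
  then show False by simp
qed

text \<open>
  Choose the complementary pair whose larger variable is as small as possible, then switch so
  that the largest variable of the other parity becomes the empty cut.
\<close>

theorem no_lex:
  fixes f :: "cut \<Rightarrow> nat"
  assumes inj: "inj f" shows "\<not> unique_cubics (max_pair f)"
proof
  assume uc: "unique_cubics (max_pair f)"
  have anti: "antipode (antipode u) = u" "antipode u \<noteq> u" "e7 (antipode u) = e7 u" "par (antipode u) = par u" for u
    by (cases u; simp; argo)+
  have ex: "\<exists>q\<in>S. \<forall>s\<in>S. g q \<le> g s" if "x \<in> S" for S and g :: "cut \<Rightarrow> nat" and x
    using ex_has_least_nat[of "\<lambda>s. s \<in> S" x g] that by blast
  obtain w where w: "\<not> e7 w" "\<And>s. \<not> e7 s \<Longrightarrow> max (f w) (f (antipode w)) \<le> max (f s) (f (antipode s))"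
    using ex[of "Cut False False False False False" "{s. \<not> e7 s}" "\<lambda>s. max (f s) (f (antipode s))"] by auto
  have mw: "max_pair f w (antipode w)"
    unfolding max_pair_def
  proof (intro allI impI)
    fix s t assume "{#w, antipode w#} \<approx> {#s, t#}"
    then have s: "\<not> e7 s" "t = antipode s" using w(1) by (simp_all add: pair_fibre_iff box_antipode opp_antipode)
    show "{#s, t#} = {#w, antipode w#} \<or> (\<exists>r\<in>{s, t}. f w < f r \<and> f (antipode w) < f r)"
    proof (cases "s = w \<or> s = antipode w")
      case True
      then show ?thesis using s(2) anti(1) by (auto simp: add_mset_commute)
    next
      case False
      then have "t \<noteq> w" "t \<noteq> antipode w" using s(2) anti(1) by metis+
      then have "f s \<noteq> f w" "f s \<noteq> f (antipode w)" "f t \<noteq> f w" "f t \<noteq> f (antipode w)" using False inj by (auto simp: inj_eq)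
      then have "(f w < f s \<and> f (antipode w) < f s) \<or> (f w < f t \<and> f (antipode w) < f t)"
        using w(2)[OF s(1)] unfolding s(2) by linarith
      then show ?thesis by blast
    qed
  qed
  define S where "S = {u. \<not> e7 u \<and> par u \<noteq> par w}"
  have "S \<noteq> {}"
  proof (cases "par w")
    case True
    then have "Cut False False False False False \<in> S" by (simp add: S_def)
    then show ?thesis by blast
  next
    case False
    then have "Cut True False False True False \<in> S" by (simp add: S_def)
    then show ?thesis by blast
  qed
  moreover have "finite (f ` UNIV)"
  proof -
    have "UNIV = set cuts" using set_cuts by auto
    then show ?thesis by (metis List.finite_set finite_imageI)
  qed
  then have "finite (f ` S)" by (rule finite_subset[rotated]) auto
  ultimately obtain m where m: "m \<in> S" "\<And>u. u \<in> S \<Longrightarrow> f u \<le> f m"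
    using Max_in[of "f ` S"] Max_ge[of "f ` S"] by (metis (no_types, lifting) imageE image_eqI image_is_empty)
  let ?t = "translate m"
  have sym: "symmetry ?t" by (rule symmetry_translate)
  have tt: "?t (?t u) = u" for u using sym by (simp add: symmetry_def)
  have par: "par (?t u) = (par m \<noteq> par u)" "e7 (?t u) = (e7 m \<noteq> e7 u)" "antipode (?t u) = ?t (antipode u)" for u
    by (cases m; cases u; simp; argo)+
  have o: "?t (Cut False False False False False) = m" by (cases m) simp
  have "inj (f \<circ> ?t)" using inj symmetry_bij[OF sym] by (simp add: bij_is_inj inj_compose)
  moreover have "unique_cubics (max_pair (f \<circ> ?t))"
  proof -
    have "max_pair (f \<circ> ?t) = (\<lambda>u v. max_pair f (?t u) (?t v))" using symmetry_max_pair[OF sym] by (intro ext) simp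
    then show ?thesis using symmetry_unique_cubics[OF sym uc] by simp
  qed
  moreover have "(f \<circ> ?t) u \<le> (f \<circ> ?t) (Cut False False False False False)" if "\<not> par u" "\<not> e7 u" for u
    using m that par by (simp add: S_def o)
  moreover have "par (?t w)" "\<not> e7 (?t w)" using m(1) w(1) par by (auto simp: S_def)
  moreover have "max_pair (f \<circ> ?t) (?t w) (antipode (?t w))"
    using mw tt by (simp add: symmetry_max_pair[OF sym] par(3))
  ultimately show False by (rule no_lex_normalized)
qed

section \<open>Reverse lexicographic orders leave two minimal cubics in a fibre\<close>

declare box.simps [simp del]

lemma min_pair_iff: "min_pair f u v \<longleftrightarrow> (\<forall>s\<in>set (box u v). f u \<le> f s \<or> f v \<le> f s)"
  unfolding min_pair_def pair_fibre_iff by auto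

text \<open>
  The truth values and the parities appear in almost every term of this section. The last two
  arguments of \<open>Ev a b x y\<close> and \<open>Od a b x y\<close> describe the long path:
  its entries are \<open>x\<close>, \<open>y\<close> and the bit that makes up the parity. The
  complement of that part is \<open>\<not> x, \<not> y\<close> in the other parity.
\<close>

abbreviation "F \<equiv> False"
abbreviation "T \<equiv> True"
abbreviation "Ev \<equiv> Cut False"
abbreviation "Od \<equiv> Cut True"

lemma segre_square:
  fixes f :: "cut \<Rightarrow> nat"
  assumes "\<And>s. s \<in> set (box u v) \<Longrightarrow> s = u \<or> s = v \<or> s = u' \<or> s = v'"
    "\<And>s. s \<in> set (box u' v') \<Longrightarrow> s = u \<or> s = v \<or> s = u' \<or> s = v'"
  shows "min_pair f u v \<or> min_pair f u' v'"
proof -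
  have "min_pair f u v" if "min (f u) (f v) \<le> min (f u') (f v')"
    unfolding min_pair_iff using assms(1) that by fastforce
  moreover have "min_pair f u' v'" if "min (f u') (f v') \<le> min (f u) (f v)"
    unfolding min_pair_iff using assms(2) that by fastforce
  ultimately show ?thesis by linarith
qed

lemma min_pair_sym: "min_pair f u v \<Longrightarrow> min_pair f v u"
  unfolding min_pair_def by (metis add_mset_commute)

text \<open>
  Cuts of equal parity that agree on one short path span a fibre of at most two pairs, and one
  of the two contains the smallest variable.
\<close>

lemma pair_choice:
  assumes "a = a' \<or> b = b'"
  shows "min_pair f (Cut p a b x y) (Cut p a' b' x' y') \<or> min_pair f (Cut p a' b' x y) (Cut p a b x' y')"
proof (rule segre_square)
  fix s assume "s \<in> set (box (Cut p a b x y) (Cut p a' b' x' y'))"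
  then show "s = Cut p a b x y \<or> s = Cut p a' b' x' y' \<or> s = Cut p a' b' x y \<or> s = Cut p a b x' y'"
    using assms by (cases s rule: cut.exhaust) (simp add: set_box; argo)
next
  fix s assume "s \<in> set (box (Cut p a' b' x y) (Cut p a b x' y'))"
  then show "s = Cut p a b x y \<or> s = Cut p a' b' x' y' \<or> s = Cut p a' b' x y \<or> s = Cut p a b x' y'"
    using assms by (cases s rule: cut.exhaust) (simp add: set_box; argo)
qed

lemma pair_choice_same:
  "min_pair f (Cut p a b x y) (Cut p a' b' x y) \<or> min_pair f (Cut p a b' x y) (Cut p a' b x y)"
proof (rule segre_square)
  fix s assume "s \<in> set (box (Cut p a b x y) (Cut p a' b' x y))"
  then show "s = Cut p a b x y \<or> s = Cut p a' b' x y \<or> s = Cut p a b' x y \<or> s = Cut p a' b x y"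
    by (cases s rule: cut.exhaust) (simp add: set_box; argo)
next
  fix s assume "s \<in> set (box (Cut p a b' x y) (Cut p a' b x y))"
  then show "s = Cut p a b x y \<or> s = Cut p a' b' x y \<or> s = Cut p a b' x y \<or> s = Cut p a' b x y"
    by (cases s rule: cut.exhaust) (simp add: set_box; argo)
qed

lemma ex_min:
  fixes f :: "'a \<Rightarrow> nat" assumes "x \<in> S" shows "\<exists>q\<in>S. \<forall>s\<in>S. f q \<le> f s"
  using ex_has_least_nat[of "\<lambda>s. s \<in> S" x f] assms by blast

text \<open>
  The smallest variable is the empty cut, and the smallest odd variable vanishes at the edges
  \<open>{1,3}\<close> and \<open>{1,4}\<close>; switching and swapping the edges of the short
  paths bring every reverse lexicographic order into this form.
\<close>

locale revlex =
  fixes f :: "cut \<Rightarrow> nat" and ox oy :: bool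
  assumes inj: "inj f" and unique: "unique_cubics (min_pair f)"
    and origin: "f (Ev F F F F) \<le> f u"
    and odd_min: "par u \<Longrightarrow> f (Od F F ox oy) \<le> f u"
begin

abbreviation "mp \<equiv> min_pair f"
abbreviation "orig \<equiv> Ev F F F F"
abbreviation "omin \<equiv> Od F F ox oy"

lemma clash:
  "clique mp u v w \<Longrightarrow> clique mp u' v' w' \<Longrightarrow> {#u, v, w#} \<approx> {#u', v', w'#} \<Longrightarrow> {u, v, w} = {u', v', w'}"
  using unique unfolding unique_cubics_def by (metis set_mset_add_mset_insert set_mset_empty)

lemma mpI: "(\<And>s. s \<in> set (box u v) \<Longrightarrow> f u \<le> f s \<or> f v \<le> f s) \<Longrightarrow> mp u v"
  unfolding min_pair_iff by blast

lemma mp_origin: "mp orig u" "mp u orig" unfolding min_pair_def using origin by auto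

lemma mp_apart:
  assumes "(x', y') \<noteq> (\<not> x, \<not> y)"
  shows "mp (Cut p a b x y) (Cut (\<not> p) a' b' x' y')"
proof (rule mpI)
  fix s assume "s \<in> set (box (Cut p a b x y) (Cut (\<not> p) a' b' x' y'))"
  then have "s = Cut p a b x y \<or> s = Cut (\<not> p) a' b' x' y'"
    using assms by (cases s rule: cut.exhaust) (simp add: set_box; argo)
  then show "f (Cut p a b x y) \<le> f s \<or> f (Cut (\<not> p) a' b' x' y') \<le> f s" by blast
qed

lemma box_complements:
  "s \<in> set (box (Ev a b x y) (Od a' b' (\<not> x) (\<not> y))) \<Longrightarrow> par s \<or> (\<exists>x y. s = Ev a b x y)"
  by (cases s rule: cut.exhaust) (simp add: set_box; argo)

text \<open>
  A cut \<open>v\<close> and two cuts of the other parity that are complementary on the short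
  paths, and whose long path is complementary to that of \<open>v\<close>, form a cubic; its
  fibre is the one attached to \<open>v\<close>. If the even cut \<open>Ev a b x y\<close> is
  non-zero on the long path and on a short one, this fibre contains a cubic of least pairs
  that consists of the empty cut and two even cuts. By uniqueness, odd cuts occur in no other
  one.
\<close>

lemma even_cubic:
  assumes "(a, b) \<noteq> (F, F)" "(x, y) \<noteq> (F, F)" "clique mp u v w"
    "{#u, v, w#} \<approx> {#Ev a b x y, Od F F (\<not> x) (\<not> y), Od T T (\<not> x) (\<not> y)#}"
  shows "\<not> par u \<and> \<not> par v \<and> \<not> par w"
proof -
  obtain s t where st: "\<not> par s" "\<not> par t" "mp s t"
      "{#orig, s, t#} \<approx> {#Ev a b x y, Od F F (\<not> x) (\<not> y), Od T T (\<not> x) (\<not> y)#}"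
  proof -
    have 1: "{#orig, Ev a b y (x \<noteq> y), Ev T T (x \<noteq> y) x#} \<approx> {#Ev a b x y, Od F F (\<not> x) (\<not> y), Od T T (\<not> x) (\<not> y)#}"
     and 2: "{#orig, Ev T T y (x \<noteq> y), Ev a b (x \<noteq> y) x#} \<approx> {#Ev a b x y, Od F F (\<not> x) (\<not> y), Od T T (\<not> x) (\<not> y)#}"
      using assms(1,2) by (cases a; cases b; cases x; cases y; simp add: same_fibre_def coords_def)+
    have "mp (Ev a b y (x \<noteq> y)) (Ev T T (x \<noteq> y) x) \<or> mp (Ev T T y (x \<noteq> y)) (Ev a b (x \<noteq> y) x)"
      using assms(1) by (intro pair_choice) auto
    then show ?thesis using that[OF _ _ _ 1] that[OF _ _ _ 2] by auto
  qed
  have "clique mp orig s t" using st(3) mp_origin by (simp add: clique_def)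
  from clash[OF assms(3) this] assms(4) st(4) have "{u, v, w} = {orig, s, t}" using fibre_sym fibre_trans by blast
  moreover have "\<forall>r\<in>{orig, s, t}. \<not> par r" using st by simp
  ultimately show ?thesis by blast
qed

text \<open>
  As for even cuts, but in the cubic fibre attached to an odd cut, where the empty cut joins
  an odd and an even one.
\<close>

lemma odd_cubic:
  assumes "(x, y) \<noteq> (T, T)" "clique mp u v w"
    "{#u, v, w#} \<approx> {#Od a b x y, Ev F F (\<not> x) (\<not> y), Ev T T (\<not> x) (\<not> y)#}"
  shows "orig \<in> {u, v, w}"
proof -
  have "{#orig, Od a b T T, Ev T T (\<not> x) (\<not> y)#} \<approx> {#Od a b x y, Ev F F (\<not> x) (\<not> y), Ev T T (\<not> x) (\<not> y)#}"
    using assms(1) by (cases a; cases b; cases x; cases y; simp add: same_fibre_def coords_def)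
  moreover have "clique mp orig (Od a b T T) (Ev T T (\<not> x) (\<not> y))"
    using mp_origin mp_apart[of "\<not> x" "\<not> y" T T T a b T T] assms(1) by (simp add: clique_def)
  ultimately have "{u, v, w} = {orig, Od a b T T, Ev T T (\<not> x) (\<not> y)}"
    using clash[OF assms(2)] assms(3) fibre_sym fibre_trans by blast
  then show ?thesis by blast
qed

text \<open>
  In the cubic fibre attached to the empty cut itself, the cubic of least pairs consists of
  the empty cut and two odd cuts.
\<close>

lemma origin_cubic:
  assumes "clique mp u v w" "{#u, v, w#} \<approx> {#orig, Od F F T T, Od T T T T#}"
  shows "par u \<or> par v \<or> par w"
proof -
  have "clique mp orig (Od F F T T) (Od T T T T) \<or> clique mp orig (Od F T T T) (Od T F T T)"
    using pair_choice_same[of f T F F T T T T] mp_origin by (simp add: clique_def)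
  moreover have "{#orig, Od F F T T, Od T T T T#} \<approx> {#orig, Od F T T T, Od T F T T#}"
    by (simp add: same_fibre_def coords_def)
  ultimately have "{u, v, w} = {orig, Od F F T T, Od T T T T} \<or> {u, v, w} = {orig, Od F T T T, Od T F T T}"
    using clash[OF assms(1)] assms(2) fibre_trans by blast
  then show ?thesis
  proof
    assume "{u, v, w} = {orig, Od F F T T, Od T T T T}"
    then have "Od F F T T \<in> {u, v, w}" by blast
    then show ?thesis by auto
  next
    assume "{u, v, w} = {orig, Od F T T T, Od T F T T}"
    then have "Od F T T T \<in> {u, v, w}" by blast
    then show ?thesis by auto
  qed
qed

text \<open>
  The 16 cuts of a quadratic fibre with eight pairs, four even and four odd. The index is the
  even long-path part that is missing: the parts that occur are the other two non-zero even
  ones, the complement of the missing one, and the odd one with all entries 1.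
\<close>

definition octet :: "bool \<Rightarrow> bool \<Rightarrow> cut set" where
  "octet x y = set (box (Od F F T T) (Od T T (\<not> x) (\<not> y)))"

definition even_min :: "bool \<Rightarrow> bool \<Rightarrow> bool" where
  "even_min x y \<longleftrightarrow> (\<exists>q\<in>octet x y. \<not> par q \<and> (\<forall>s\<in>octet x y. f q \<le> f s))"

lemma odd_in_octet: "Od a b z w \<in> octet x y \<longleftrightarrow> (z, w) = (T, T) \<or> (z, w) = (\<not> x, \<not> y)" if "(x, y) \<noteq> (F, F)"
  unfolding octet_def set_box using that by (cases x; cases y; cases z; cases w) auto

lemma even_in_octet: "Ev a b z w \<in> octet x y \<longleftrightarrow> (z, w) = (y, x \<noteq> y) \<or> (z, w) = (x \<noteq> y, x)" if "(x, y) \<noteq> (F, F)"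
  unfolding octet_def set_box using that by (cases x; cases y; cases z; cases w) auto

lemma box_odd_octet: "(x, y) \<noteq> (F, F) \<Longrightarrow> set (box (Od a b T T) (Od (\<not> a) (\<not> b) (\<not> x) (\<not> y))) = octet x y"
proof (rule Set.set_eqI)
  fix s
  assume "(x, y) \<noteq> (F, F)"
  then show "s \<in> set (box (Od a b T T) (Od (\<not> a) (\<not> b) (\<not> x) (\<not> y))) \<longleftrightarrow> s \<in> octet x y"
    unfolding octet_def by (cases s rule: cut.exhaust) (auto simp: set_box)
qed

lemma box_even_octet: "(x, y) \<noteq> (F, F) \<Longrightarrow> set (box (Ev a b y (x \<noteq> y)) (Ev (\<not> a) (\<not> b) (x \<noteq> y) x)) = octet x y"
proof (rule Set.set_eqI)
  fix s
  assume "(x, y) \<noteq> (F, F)"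
  then show "s \<in> set (box (Ev a b y (x \<noteq> y)) (Ev (\<not> a) (\<not> b) (x \<noteq> y) x)) \<longleftrightarrow> s \<in> octet x y"
    unfolding octet_def by (cases s rule: cut.exhaust) (auto simp: set_box)
qed

lemma octet_min:
  assumes "(x, y) \<noteq> (F, F)"
  shows "even_min x y \<or> (\<exists>a b z w. (Od a b z w \<in> octet x y) \<and> (\<forall>s\<in>octet x y. f (Od a b z w) \<le> f s))"
proof -
  have "Od F F T T \<in> octet x y" by (simp add: odd_in_octet[OF assms])
  then obtain q where q: "q \<in> octet x y" "\<forall>s\<in>octet x y. f q \<le> f s" using ex_min[of _ "octet x y" f] by blast
  show ?thesis
  proof (cases q)
    case (Cut p a b z w)
    show ?thesis
    proof (cases p)
      case True
      then have "q = Od a b z w" using Cut by simp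
      then show ?thesis using q by blast
    next
      case False
      then have "\<not> par q" using Cut by simp
      then show ?thesis using q unfolding even_min_def by blast
    qed
  qed
qed

lemma odd_pair:
  assumes "(x, y) \<noteq> (F, F)" "\<not> even_min x y"
  shows "\<exists>a b. mp (Od a b T T) (Od (\<not> a) (\<not> b) (\<not> x) (\<not> y))"
proof -
  obtain a b z w where q: "Od a b z w \<in> octet x y" "\<forall>s\<in>octet x y. f (Od a b z w) \<le> f s" using octet_min assms by blast
  show ?thesis
  proof (cases "(z, w) = (T, T)")
    case True
    then have "mp (Od a b T T) (Od (\<not> a) (\<not> b) (\<not> x) (\<not> y))"
      using q(2) by (intro mpI) (simp add: box_odd_octet[OF assms(1)])
    then show ?thesis by blast
  next
    case False
    then have zw: "z = (\<not> x)" "w = (\<not> y)" using q(1) odd_in_octet[OF assms(1)] by auto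
    have "mp (Od (\<not> a) (\<not> b) T T) (Od (\<not> \<not> a) (\<not> \<not> b) (\<not> x) (\<not> y))"
      using q(2) zw by (intro mpI) (simp only: box_odd_octet[OF assms(1)], simp)
    then show ?thesis by blast
  qed
qed

lemma even_pair:
  assumes "(x, y) \<noteq> (F, F)" "even_min x y"
  shows "\<exists>a b. mp (Ev a b y (x \<noteq> y)) (Ev (\<not> a) (\<not> b) (x \<noteq> y) x)"
proof -
  obtain q where q: "q \<in> octet x y" "\<not> par q" "\<forall>s\<in>octet x y. f q \<le> f s" using assms(2) unfolding even_min_def by blast
  then obtain a b z w where qc: "q = Ev a b z w" by (cases q) auto
  show ?thesis
  proof (cases "(z, w) = (y, x \<noteq> y)")
    case True
    then have "mp (Ev a b y (x \<noteq> y)) (Ev (\<not> a) (\<not> b) (x \<noteq> y) x)"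
      using q(3) qc by (intro mpI) (simp only: box_even_octet[OF assms(1)], simp)
    then show ?thesis by blast
  next
    case False
    then have zw: "z = (x \<noteq> y)" "w = x" using q(1) even_in_octet[OF assms(1)] qc by auto
    have "mp (Ev (\<not> a) (\<not> b) y (x \<noteq> y)) (Ev (\<not> \<not> a) (\<not> \<not> b) (x \<noteq> y) x)"
      using q(3) zw qc by (intro mpI) (simp only: box_even_octet[OF assms(1)], simp)
    then show ?thesis by blast
  qed
qed

text \<open>
  Let \<open>z\<close> be the smallest even variable that does not vanish on the long path.
  When all three octets have even minimum, \<open>z\<close> is the minimum of each octet that
  contains it, and with two further even cuts it forms a cubic of least pairs that
  \<open>origin_cubic\<close> excludes.
\<close>

lemma not_all_even: "even_min F T \<Longrightarrow> even_min T F \<Longrightarrow> even_min T T \<Longrightarrow> False"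
proof -
  assume em: "even_min F T" "even_min T F" "even_min T T"
  let ?S = "{Ev a b x y | a b x y. (x, y) \<noteq> (F, F)}"
  have "Ev F F T T \<in> ?S" by blast
  then obtain z where z: "z \<in> ?S" "\<forall>s\<in>?S. f z \<le> f s" using ex_min[of _ ?S f] by blast
  then obtain a b x y where zc: "z = Ev a b x y" "(x, y) \<noteq> (F, F)" by blast
  have em': "even_min x' y'" if "(x', y') \<noteq> (F, F)" for x' y' using em that by (cases x'; cases y') auto
  have zQ: "f z \<le> f s" if sQ: "s \<in> octet x' y'" and nz: "(x', y') \<noteq> (F, F)" for s x' y'
  proof -
    obtain q where q: "q \<in> octet x' y'" "\<not> par q" "\<forall>s\<in>octet x' y'. f q \<le> f s" using em'[OF nz] unfolding even_min_def by blast
    then obtain a b z' w where qc: "q = Ev a b z' w" by (cases q) auto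
    have "(z', w) \<noteq> (F, F)" using q(1) nz unfolding qc even_in_octet[OF nz] by auto
    then have "f z \<le> f q" using z(2) unfolding qc by blast
    then show ?thesis using q(3) sQ by (meson order_trans)
  qed
  have zp: "mp z (Ev a' b' x' y')" if "(x', y') = (y, x \<noteq> y) \<or> (x', y') = (x \<noteq> y, x)" for a' b' x' y'
  proof (rule mpI)
    fix s assume s: "s \<in> set (box z (Ev a' b' x' y'))"
    obtain q c d z' w where sc: "s = Cut q c d z' w" by (cases s)
    have "q \<longrightarrow> s \<in> octet (x \<noteq> x') (y \<noteq> y')"
      using s that zc(2) unfolding sc zc(1) by (cases q; cases x; cases y; cases x'; cases y') (auto simp: set_box octet_def)
    moreover have "(x \<noteq> x', y \<noteq> y') \<noteq> (F, F)" using that zc(2) by (cases x; cases y) auto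
    moreover have "\<not> q \<longrightarrow> (z', w) \<noteq> (F, F)"
      using s that zc(2) unfolding sc zc(1) by (cases q; cases x; cases y; cases x'; cases y') (auto simp: set_box)
    then have "\<not> q \<longrightarrow> f z \<le> f s" using z(2) unfolding sc by (cases q) auto
    ultimately show "f z \<le> f s \<or> f (Ev a' b' x' y') \<le> f s" using zQ by blast
  qed
  obtain s t where st: "mp s t" "mp z s" "mp z t" "\<not> par s" "\<not> par t" "{#z, s, t#} \<approx> {#orig, Od F F T T, Od T T T T#}"
  proof (cases "(a, b) = (F, F)")
    case True
    obtain a' b' where ab: "mp (Ev a' b' y (x \<noteq> y)) (Ev (\<not> a') (\<not> b') (x \<noteq> y) x)" using even_pair[OF zc(2)] em'[OF zc(2)] by blast
    have "{#z, Ev a' b' y (x \<noteq> y), Ev (\<not> a') (\<not> b') (x \<noteq> y) x#} \<approx> {#orig, Od F F T T, Od T T T T#}"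
      using True zc by (cases a'; cases b'; cases x; cases y; simp add: same_fibre_def coords_def)
    then show ?thesis using that[OF ab] zp by simp
  next
    case False
    have 1: "{#z, Ev F F y (x \<noteq> y), Ev (\<not> a) (\<not> b) (x \<noteq> y) x#} \<approx> {#orig, Od F F T T, Od T T T T#}"
      and 2: "{#z, Ev (\<not> a) (\<not> b) y (x \<noteq> y), Ev F F (x \<noteq> y) x#} \<approx> {#orig, Od F F T T, Od T T T T#}"
      using False zc by (cases a; cases b; cases x; cases y; simp add: same_fibre_def coords_def)+
    have "mp (Ev F F y (x \<noteq> y)) (Ev (\<not> a) (\<not> b) (x \<noteq> y) x) \<or> mp (Ev (\<not> a) (\<not> b) y (x \<noteq> y)) (Ev F F (x \<noteq> y) x)"
      using False by (intro pair_choice) auto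
    then show ?thesis
    proof
      assume "mp (Ev F F y (x \<noteq> y)) (Ev (\<not> a) (\<not> b) (x \<noteq> y) x)"
      then show ?thesis using zp by (intro that[OF _ _ _ _ _ 1]) simp_all
    next
      assume "mp (Ev (\<not> a) (\<not> b) y (x \<noteq> y)) (Ev F F (x \<noteq> y) x)"
      then show ?thesis using zp by (intro that[OF _ _ _ _ _ 2]) simp_all
    qed
  qed
  then have "clique mp z s t" by (simp add: clique_def)
  from origin_cubic[OF this st(6)] show False using st zc by simp
qed

text \<open>
  Consider the smallest variable among the odd cuts and the cuts \<open>Ev a b _ _\<close>. If
  it were one of the latter and non-zero on the long path, it would form a cubic of least
  pairs with two odd cuts in the fibre of \<open>even_cubic\<close>. If it vanished on the
  long path, then an octet with odd minimum would provide such a cubic, so that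
  \<open>not_all_even\<close> applies.
\<close>

lemma odd_less:
  assumes ab: "(a, b) \<noteq> (F, F)" shows "f omin \<le> f (Ev a b x y)"
proof -
  let ?S = "{s. par s \<or> (\<exists>x y. s = Ev a b x y)}"
  have "Ev a b x y \<in> ?S" by blast
  then obtain q where q: "q \<in> ?S" "\<forall>s\<in>?S. f q \<le> f s" using ex_min[of _ ?S f] by blast
  have mpq: "mp q (Od a' b' (\<not> x') (\<not> y'))" if "q = Ev a b x' y'" for a' b' x' y'
    using q(2) box_complements unfolding that by (intro mpI) blast
  show ?thesis
  proof (cases "par q")
    case True
    then have "f omin \<le> f q" using odd_min by simp
    then show ?thesis using q(2) \<open>Ev a b x y \<in> ?S\<close> by (meson order_trans)
  next
    case False
    then obtain x' y' where qc: "q = Ev a b x' y'" using q(1) by blast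
    show ?thesis
    proof (cases "(x', y') = (F, F)")
      case nz: False
      have "mp (Od F F (\<not> x') (\<not> y')) (Od T T (\<not> x') (\<not> y')) \<or> mp (Od F T (\<not> x') (\<not> y')) (Od T F (\<not> x') (\<not> y'))"
        by (rule pair_choice_same)
      then have "clique mp q (Od F F (\<not> x') (\<not> y')) (Od T T (\<not> x') (\<not> y')) \<or> clique mp q (Od F T (\<not> x') (\<not> y')) (Od T F (\<not> x') (\<not> y'))"
        using mpq[OF qc] by (simp add: clique_def)
      moreover have "{#q, Od F T (\<not> x') (\<not> y'), Od T F (\<not> x') (\<not> y')#} \<approx> {#Ev a b x' y', Od F F (\<not> x') (\<not> y'), Od T T (\<not> x') (\<not> y')#}"
        unfolding qc by (cases x'; cases y'; simp add: same_fibre_def coords_def)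
      ultimately have False using even_cubic[OF ab nz] qc fibre_refl by (metis par.simps)
      then show ?thesis ..
    next
      case z: True
      have "even_min x y" if xy: "(x, y) \<noteq> (F, F)" for x y
      proof (rule ccontr)
        assume "\<not> even_min x y"
        then obtain a' b' where ab': "mp (Od a' b' T T) (Od (\<not> a') (\<not> b') (\<not> x) (\<not> y))" using odd_pair xy by blast
        have "clique mp q (Od a' b' T T) (Od (\<not> a') (\<not> b') (\<not> x) (\<not> y))"
          using mpq[OF qc, of a' b'] ab' mp_apart[of "\<not> x" "\<not> y" F F F a b] z xy qc by (simp add: clique_def)
        moreover have "{#q, Od a' b' T T, Od (\<not> a') (\<not> b') (\<not> x) (\<not> y)#} \<approx> {#Ev a b x y, Od F F (\<not> x) (\<not> y), Od T T (\<not> x) (\<not> y)#}"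
          using z xy unfolding qc by (cases a'; cases b'; cases x; cases y; simp add: same_fibre_def coords_def)
        ultimately show False using even_cubic[OF ab xy] by fastforce
      qed
      then have False using not_all_even by blast
      then show ?thesis ..
    qed
  qed
qed

lemma mp_omin_even: "(a, b) \<noteq> (F, F) \<Longrightarrow> mp (Ev a b x y) omin"
proof (cases "(x, y) = (\<not> ox, \<not> oy)")
  case True
  assume ab: "(a, b) \<noteq> (F, F)"
  show ?thesis
  proof (rule mpI)
    fix s assume "s \<in> set (box (Ev a b x y) omin)"
    then have "par s \<or> (\<exists>x y. s = Ev a b x y)" using box_complements[of s a b x y F F] True by simp
    then show "f (Ev a b x y) \<le> f s \<or> f omin \<le> f s" using odd_min odd_less[OF ab] by blast
  qed
next
  case False
  then show ?thesis using mp_apart[of ox oy x y F a b F F] by auto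
qed

lemma mp_omin_odd: "(a, b) \<noteq> (T, T) \<Longrightarrow> mp omin (Od a b x y)"
proof (rule mpI)
  fix s assume ab: "(a, b) \<noteq> (T, T)" and s: "s \<in> set (box omin (Od a b x y))"
  have "par s" using s ab by (cases s rule: cut.exhaust) (simp add: set_box; argo)
  then show "f omin \<le> f s \<or> f (Od a b x y) \<le> f s" using odd_min by blast
qed

text \<open>
  By \<open>odd_less\<close>, the even cuts below the smallest odd one vanish on both short
  paths.
\<close>

lemma octet_below_omin:
  assumes "(x, y) \<noteq> (F, F)" "s \<in> octet x y" "f s < f omin"
  obtains z w where "even_min x y" "Ev F F z w \<in> octet x y" "\<forall>s\<in>octet x y. f (Ev F F z w) \<le> f s" "f (Ev F F z w) < f omin"
proof -
  obtain q where q: "q \<in> octet x y" "\<forall>s\<in>octet x y. f q \<le> f s" using ex_min[OF assms(2), of f] by blast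
  have less: "f q < f omin" using q(2) assms(2,3) by (meson le_less_trans)
  obtain p a b z w where qc: "q = Cut p a b z w" by (cases q)
  have "\<not> p" using less odd_min[of q] unfolding qc by auto
  moreover have "(a, b) = (F, F)" using less odd_less[of a b z w] unfolding qc using \<open>\<not> p\<close> by auto
  ultimately have q_eq: "q = Ev F F z w" using qc by simp
  have "even_min x y" unfolding even_min_def using q q_eq by (intro bexI[of _ q]) auto
  then show ?thesis using that[of z w] q less unfolding q_eq by blast
qed

end

text \<open>
  The smallest odd variable is the complement, on the long path, of the smallest variable. It
  then lies in all three octets.
\<close>

locale revlex_antipodal = revlex f T T for f
begin

lemma contradiction: False
proof -
  have "even_min x y" if xy: "(x, y) \<noteq> (F, F)" for x y
  proof (rule ccontr)
    assume "\<not> even_min x y"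
    then have "\<forall>s\<in>octet x y. f omin \<le> f s" using octet_below_omin[OF xy] by (meson not_le)
    then have "mp omin (Od T T (\<not> x) (\<not> y))" using box_odd_octet[OF xy, of F F] by (intro mpI) auto
    then have "clique mp (Ev T T F F) omin (Od T T (\<not> x) (\<not> y))"
      using mp_omin_even[of T T F F] mp_apart[of "\<not> x" "\<not> y" F F F T T T T] xy by (simp add: clique_def)
    moreover have "{#Ev T T F F, omin, Od T T (\<not> x) (\<not> y)#} \<approx> {#Ev T T x y, Od F F (\<not> x) (\<not> y), Od T T (\<not> x) (\<not> y)#}"
      using xy by (cases x; cases y; simp add: same_fibre_def coords_def)
    ultimately show False using even_cubic[of T T x y] xy by fastforce
  qed
  then show False using not_all_even by blast
qed

end

text \<open>
  The smallest odd variable differs from the smallest variable in one edge of the long path.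
  The three octets are no longer alike: the smallest odd variable lies only in \<open>octet F
  T\<close>.
\<close>

locale revlex_adjacent = revlex f T F for f
begin

text \<open>
  Together with the smallest odd variable, such a pair would form a cubic of least pairs in
  the fibre of \<open>odd_cubic\<close>, without the empty cut.
\<close>

lemma even_pairs_not_min:
  assumes ab: "(a, b) \<noteq> (F, F)"
  shows "\<not> mp (Ev a b F T) (Ev (\<not> a) (\<not> b) T T)" "\<not> mp (Ev a b F T) (Ev (\<not> a) (\<not> b) T F)"
proof -
  show "\<not> mp (Ev a b F T) (Ev (\<not> a) (\<not> b) T T)"
  proof
    assume "mp (Ev a b F T) (Ev (\<not> a) (\<not> b) T T)"
    then have "clique mp (Ev a b F T) omin (Ev (\<not> a) (\<not> b) T T)"
      using mp_omin_even[OF ab] mp_apart[of T T T F T F F "\<not> a" "\<not> b"] by (simp add: clique_def)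
    moreover have "{#Ev a b F T, omin, Ev (\<not> a) (\<not> b) T T#} \<approx> {#Od F F F F, Ev F F (\<not> F) (\<not> F), Ev T T (\<not> F) (\<not> F)#}"
      by (cases a; cases b; simp add: same_fibre_def coords_def)
    ultimately show False using odd_cubic[of F F] by fastforce
  qed
  show "\<not> mp (Ev a b F T) (Ev (\<not> a) (\<not> b) T F)"
  proof
    assume "mp (Ev a b F T) (Ev (\<not> a) (\<not> b) T F)"
    then have "clique mp (Ev a b F T) omin (Ev (\<not> a) (\<not> b) T F)"
      using mp_omin_even[OF ab] mp_apart[of T F T F T F F "\<not> a" "\<not> b"] by (simp add: clique_def)
    moreover have "{#Ev a b F T, omin, Ev (\<not> a) (\<not> b) T F#} \<approx> {#Od F F F T, Ev F F (\<not> F) (\<not> T), Ev T T (\<not> F) (\<not> T)#}"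
      by (cases a; cases b; simp add: same_fibre_def coords_def)
    ultimately show False using odd_cubic[of F T] by fastforce
  qed
qed

text \<open>
  An even cut below the smallest odd one in this octet is also in another octet. With
  \<open>even_pairs_not_min\<close> this drives the minimum of that octet to \<open>Ev F F F
  T\<close>, which is in both remaining octets; then all of them have even minimum.
\<close>

lemma omin_min_octet: "\<forall>s\<in>octet F T. f omin \<le> f s"
proof (rule ccontr)
  have ne: "(F, T) \<noteq> (F, F)" "(T, F) \<noteq> (F, F)" "(T, T) \<noteq> (F, F)" by auto
  assume "\<not> ?thesis"
  then obtain s where s: "s \<in> octet F T" "f s < f omin" by (meson not_le)
  obtain z w where 1: "even_min F T" "Ev F F z w \<in> octet F T" "f (Ev F F z w) < f omin" using octet_below_omin[OF ne(1) s] by blast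
  consider "(z, w) = (T, T)" | "(z, w) = (T, F)" using 1(2) by (auto simp: even_in_octet)
  then show False
  proof cases
    case c: 1
    then have less: "f (Ev F F T T) < f omin" using 1(3) by simp
    from c have "Ev F F T T \<in> octet T F" by (simp add: even_in_octet)
    then obtain z' w' where 2: "even_min T F" "Ev F F z' w' \<in> octet T F" "\<forall>s\<in>octet T F. f (Ev F F z' w') \<le> f s" "f (Ev F F z' w') < f omin"
      using octet_below_omin[OF ne(2) _ less] by blast
    have "(z', w') \<noteq> (T, T)"
    proof
      assume "(z', w') = (T, T)"
      then have "mp (Ev T T F T) (Ev F F T T)" using 2(3) box_even_octet[of T F T T] by (intro mpI) simp
      then show False using even_pairs_not_min(1)[of T T] by simp
    qed
    then have "(z', w') = (F, T)" using 2(2) by (auto simp: even_in_octet)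
    then have "Ev F F z' w' \<in> octet T T" by (simp add: even_in_octet)
    then have "even_min T T" using octet_below_omin[OF ne(3) _ 2(4)] by blast
    then show False using not_all_even 1(1) 2(1) by blast
  next
    case c: 2
    then have less: "f (Ev F F T F) < f omin" using 1(3) by simp
    from c have "Ev F F T F \<in> octet T T" by (simp add: even_in_octet)
    then obtain z' w' where 2: "even_min T T" "Ev F F z' w' \<in> octet T T" "\<forall>s\<in>octet T T. f (Ev F F z' w') \<le> f s" "f (Ev F F z' w') < f omin"
      using octet_below_omin[OF ne(3) _ less] by blast
    have "(z', w') \<noteq> (T, F)"
    proof
      assume "(z', w') = (T, F)"
      then have "mp (Ev F F T F) (Ev T T F T)" using 2(3) box_even_octet[of T T F F] by (intro mpI) simp
      then show False using even_pairs_not_min(2)[of T T] min_pair_sym by simp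
    qed
    then have "(z', w') = (F, T)" using 2(2) by (auto simp: even_in_octet)
    then have "Ev F F z' w' \<in> octet T F" by (simp add: even_in_octet)
    then have "even_min T F" using octet_below_omin[OF ne(2) _ 2(4)] by blast
    then show False using not_all_even 1(1) 2(1) by blast
  qed
qed

lemma mp_omin_octet: "mp omin (Od a b T T)"
proof (cases "(a, b) = (T, T)")
  case True
  have "s \<in> octet F T" if "s \<in> set (box omin (Od T T T T))" for s
    using that by (cases s rule: cut.exhaust) (simp add: set_box octet_def; argo)
  then show ?thesis using True omin_min_octet by (intro mpI) auto
qed (rule mp_omin_odd)

text \<open>
  Whatever the parity of the minimum of one of the other two octets, its least pair is known;
  this lemma and the next three name it.
\<close>

lemma octet_TF_even: "even_min T F \<Longrightarrow> mp (Ev F F F T) (Ev T T T T)"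
proof -
  assume "even_min T F"
  then obtain a b where ab: "mp (Ev a b F T) (Ev (\<not> a) (\<not> b) T T)" using even_pair[of T F] by auto
  then have "(a, b) = (F, F)" using even_pairs_not_min(1) by blast
  then show ?thesis using ab by simp
qed

lemma octet_TT_even: "even_min T T \<Longrightarrow> mp (Ev F F F T) (Ev T T T F)"
proof -
  assume "even_min T T"
  then obtain a b where ab: "mp (Ev a b T F) (Ev (\<not> a) (\<not> b) F T)" using even_pair[of T T] by auto
  then have "mp (Ev (\<not> a) (\<not> b) F T) (Ev (\<not> \<not> a) (\<not> \<not> b) T F)" using min_pair_sym by simp
  then have "(\<not> a, \<not> b) = (F, F)" using even_pairs_not_min(2) by blast
  then show ?thesis using min_pair_sym[OF ab] by simp
qed

lemma octet_TF_odd: "\<not> even_min T F \<Longrightarrow> mp (Od F F T T) (Od T T F T)"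
proof -
  assume "\<not> even_min T F"
  then obtain a b where ab: "mp (Od a b T T) (Od (\<not> a) (\<not> b) F T)" using odd_pair[of T F] by auto
  have "(a, b) = (F, F)"
  proof (rule ccontr)
    assume "(a, b) \<noteq> (F, F)"
    then have "clique mp omin (Od a b T T) (Od (\<not> a) (\<not> b) F T)" using ab mp_omin_octet mp_omin_odd[of "\<not> a" "\<not> b" F T] by (simp add: clique_def)
    moreover have "{#omin, Od a b T T, Od (\<not> a) (\<not> b) F T#} \<approx> {#Od F F F F, Ev F F (\<not> F) (\<not> F), Ev T T (\<not> F) (\<not> F)#}"
      by (cases a; cases b; simp add: same_fibre_def coords_def)
    ultimately show False using odd_cubic[of F F] by fastforce
  qed
  then show ?thesis using ab by simp
qed

lemma octet_TT_odd: "\<not> even_min T T \<Longrightarrow> mp (Od F F T T) (Od T T F F)"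
proof -
  assume "\<not> even_min T T"
  then obtain a b where ab: "mp (Od a b T T) (Od (\<not> a) (\<not> b) F F)" using odd_pair[of T T] by auto
  have "(a, b) = (F, F)"
  proof (rule ccontr)
    assume "(a, b) \<noteq> (F, F)"
    then have "clique mp omin (Od a b T T) (Od (\<not> a) (\<not> b) F F)" using ab mp_omin_octet mp_omin_odd[of "\<not> a" "\<not> b" F F] by (simp add: clique_def)
    moreover have "{#omin, Od a b T T, Od (\<not> a) (\<not> b) F F#} \<approx> {#Od F F F T, Ev F F (\<not> F) (\<not> T), Ev T T (\<not> F) (\<not> T)#}"
      by (cases a; cases b; simp add: same_fibre_def coords_def)
    ultimately show False using odd_cubic[of F T] by fastforce
  qed
  then show ?thesis using ab by simp
qed

lemma clique_omin: "clique mp (Ev T T F T) (Od T T T T) omin"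
  using mp_apart[of T T F T F T T T T] mp_omin_even[of T T F T] mp_omin_octet[of T T] min_pair_sym by (simp add: clique_def)

lemma not_both_even: "\<not> (even_min T F \<and> even_min T T)"
proof
  assume "even_min T F \<and> even_min T T"
  then have "clique mp (Ev F F F T) (Ev T T T T) (Ev T T T F)"
    using octet_TF_even octet_TT_even pair_choice[of T T T T f F T T T F] by (simp add: clique_def)
  moreover have "{#Ev F F F T, Ev T T T T, Ev T T T F#} \<approx> {#Ev T T F T, Od T T T T, omin#}"
    by (simp add: same_fibre_def coords_def)
  ultimately have "{Ev F F F T, Ev T T T T, Ev T T T F} = {Ev T T F T, Od T T T T, omin}" using clash clique_omin by blast
  then show False by auto
qed

lemma some_even: "even_min T F \<or> even_min T T"
proof (rule ccontr)
  assume "\<not> ?thesis"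
  then have "clique mp (Od F F T T) (Od T T F F) (Od T T F T)"
    using octet_TF_odd octet_TT_odd pair_choice[of T T T T f T F F F T] by (simp add: clique_def)
  moreover have "{#Od F F T T, Od T T F F, Od T T F T#} \<approx> {#Od T T T F, Ev F F (\<not> T) (\<not> F), Ev T T (\<not> T) (\<not> F)#}"
    by (simp add: same_fibre_def coords_def)
  ultimately show False using odd_cubic[of T F] by fastforce
qed

text \<open>
  The four complementary pairs of \<open>?C\<close> form one fibre. Its least pair can only be
  \<open>?a\<close>, \<open>?b\<close>, since each of the other three pairs would give a
  second cubic of least pairs somewhere. The least pairs of the two octets then impose
  incompatible inequalities on the ranks.
\<close>

lemma mixed:
  assumes TF: "mp (Ev F F F T) (Ev T T T T)" and TT: "mp (Od F F T T) (Od T T F F)"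
  shows False
proof -
  \<comment> \<open>The other three complementary pairs on the short-path parts T, T are excluded.\<close>
  have 1: "\<not> mp (Ev T T F F) (Od T T T T)"
  proof
    assume "mp (Ev T T F F) (Od T T T T)"
    then have "clique mp (Ev T T F F) omin (Od T T T T)" using mp_omin_even[of T T] mp_omin_octet by (simp add: clique_def)
    moreover have "{#Ev T T F F, omin, Od T T T T#} \<approx> {#Ev T T F T, Od F F (\<not> F) (\<not> T), Od T T (\<not> F) (\<not> T)#}"
      by (simp add: same_fibre_def coords_def)
    ultimately show False using even_cubic[of T T F T] by fastforce
  qed
  have 2: "\<not> mp (Ev T T F T) (Od T T T F)"
  proof
    assume "mp (Ev T T F T) (Od T T T F)"
    moreover have "mp omin (Od T T T F)"
    proof (rule mpI)
      fix s assume "s \<in> set (box omin (Od T T T F))"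
      then have "par s" by (cases s rule: cut.exhaust) (simp add: set_box; argo)
      then show "f omin \<le> f s \<or> f (Od T T T F) \<le> f s" using odd_min by blast
    qed
    ultimately have "clique mp (Ev T T F T) omin (Od T T T F)" using mp_omin_even[of T T] by (simp add: clique_def)
    moreover have "{#Ev T T F T, omin, Od T T T F#} \<approx> {#Ev T T F T, Od F F (\<not> F) (\<not> T), Od T T (\<not> F) (\<not> T)#}"
      by (simp add: same_fibre_def coords_def)
    ultimately show False using even_cubic[of T T F T] by fastforce
  qed
  have 3: "\<not> mp (Ev T T T T) (Od T T F F)"
  proof
    assume "mp (Ev T T T T) (Od T T F F)"
    then have "clique mp (Ev T T T T) (Od F F T T) (Od T T F F)" using TT mp_apart[of T T T T F T T F F] by (simp add: clique_def)
    moreover have "{#Ev T T T T, Od F F T T, Od T T F F#} \<approx> {#Ev T T F T, Od T T T T, omin#}"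
      by (simp add: same_fibre_def coords_def)
    ultimately have "{Ev T T T T, Od F F T T, Od T T F F} = {Ev T T F T, Od T T T T, omin}" using clash clique_omin by blast
    then show False by auto
  qed
  let ?C = "set (box (Ev T T F F) (Od T T T T))"
  let ?a = "Ev T T T F" and ?b = "Od T T F T" and ?g = "Ev F F F T" and ?h = "Ev T T T T" and ?j = "Od F F T T" and ?k = "Od T T F F"
  have C: "s \<in> ?C \<longleftrightarrow> (\<exists>p x y. s = Cut p T T x y)" for s
    by (cases s rule: cut.exhaust) (simp add: set_box; blast)
  have Cb: "set (box (Ev T T x y) (Od T T (\<not> x) (\<not> y))) = ?C" for x y
  proof (rule Set.set_eqI)
    fix s show "s \<in> set (box (Ev T T x y) (Od T T (\<not> x) (\<not> y))) \<longleftrightarrow> s \<in> ?C"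
      by (cases s rule: cut.exhaust) (auto simp: set_box)
  qed
  obtain q where q: "q \<in> ?C" "\<forall>s\<in>?C. f q \<le> f s" using ex_min[of ?a ?C f] C by blast
  have "mp (Ev T T x y) (Od T T (\<not> x) (\<not> y))" if "q = Ev T T x y \<or> q = Od T T (\<not> x) (\<not> y)" for x y
    using q(2) that Cb by (intro mpI) auto
  from this[of F F] this[of F T] this[of T T] have "q = ?a \<or> q = ?b"
    using q(1) 1 2 3 unfolding C by (metis (full_types))
  then have min: "(\<forall>s\<in>{?a, ?b, ?h, ?k}. f ?a \<le> f s) \<or> (\<forall>s\<in>{?a, ?b, ?h, ?k}. f ?b \<le> f s)"
    using q(2) C by (metis insert_iff singletonD)
  have "?b \<in> set (box ?g ?h)" "?j \<in> set (box ?g ?h)" "?a \<in> set (box ?j ?k)" "?g \<in> set (box ?j ?k)" by (simp_all add: set_box)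
  then have "f ?g \<le> f ?b \<or> f ?h \<le> f ?b" "f ?g \<le> f ?j \<or> f ?h \<le> f ?j" "f ?j \<le> f ?a \<or> f ?k \<le> f ?a" "f ?j \<le> f ?g \<or> f ?k \<le> f ?g"
    using TF TT unfolding min_pair_iff by blast+
  moreover have "f ?a \<noteq> f ?k" "f ?a \<noteq> f ?h" "f ?g \<noteq> f ?j" "f ?b \<noteq> f ?h" "f ?b \<noteq> f ?k"
    using inj by (auto simp: inj_eq)
  ultimately show False using min by (simp) linarith
qed

end

text \<open>
  The hypotheses of the locale, apart from the position of the smallest odd variable on the
  short paths, as a predicate that can be transported along symmetries.
\<close>

definition revlex_data :: "(cut \<Rightarrow> nat) \<Rightarrow> cut \<Rightarrow> bool" where
  "revlex_data f v \<longleftrightarrow> inj f \<and> unique_cubics (min_pair f) \<and> (\<forall>u. f (Ev F F F F) \<le> f u) \<and>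
     par v \<and> (\<forall>u. par u \<longrightarrow> f v \<le> f u)"

lemma unique_cubics_comp:
  assumes "symmetry \<sigma>" "unique_cubics (min_pair f)" shows "unique_cubics (min_pair (f \<circ> \<sigma>))"
proof -
  have "min_pair (f \<circ> \<sigma>) = (\<lambda>u v. min_pair f (\<sigma> u) (\<sigma> v))"
    using symmetry_min_pair[OF assms(1)] by (intro ext) simp
  then show ?thesis using symmetry_unique_cubics[OF assms] by simp
qed

lemma inj_comp_symmetry: "symmetry \<sigma> \<Longrightarrow> inj f \<Longrightarrow> inj (f \<circ> \<sigma>)"
  by (rule inj_compose) (simp_all add: bij_is_inj symmetry_bij)

lemma revlex_data_comp:
  assumes "symmetry \<sigma>" "\<sigma> (Ev F F F F) = Ev F F F F" "\<And>u. par (\<sigma> u) = par u" "revlex_data f v"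
  shows "revlex_data (f \<circ> \<sigma>) (\<sigma> v)"
proof -
  have "\<sigma> (\<sigma> v) = v" using assms(1) by (simp add: symmetry_def)
  then show ?thesis
    using assms unique_cubics_comp inj_comp_symmetry unfolding revlex_data_def by auto
qed

lemma revlex_data_swaps:
  assumes "revlex_data f v"
  shows "revlex_data (f \<circ> swap12) (swap12 v)" "revlex_data (f \<circ> swap34) (swap34 v)"
    "revlex_data (f \<circ> swap56) (swap56 v)" "revlex_data (f \<circ> swap57) (swap57 v)"
proof -
  have p: "par (swap12 u) = par u" "par (swap34 u) = par u" "par (swap56 u) = par u" "par (swap57 u) = par u" for u
    by (cases u; simp)+
  show "revlex_data (f \<circ> swap12) (swap12 v)" "revlex_data (f \<circ> swap34) (swap34 v)"
    "revlex_data (f \<circ> swap56) (swap56 v)" "revlex_data (f \<circ> swap57) (swap57 v)"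
    by (rule revlex_data_comp[OF _ _ _ assms]; simp add: p symmetry_swap12 symmetry_swap34 symmetry_swap56 symmetry_swap57)+
qed

lemma revlex_dataI: "revlex_data f (Od F F x y) \<Longrightarrow> revlex f x y"
  unfolding revlex_data_def by unfold_locales auto

lemma (in revlex_adjacent) contradiction: False
proof -
  consider "even_min T F" "\<not> even_min T T" | "\<not> even_min T F" "even_min T T"
    using some_even not_both_even by blast
  then show False
  proof cases
    case 1
    then show False using mixed octet_TF_even octet_TT_odd by blast
  next
    case 2
    have par: "par (swap67 u) = par u" for u by (cases u) simp
    have "revlex_data f (Od F F T F)" using inj unique origin odd_min unfolding revlex_data_def by simp
    then have "revlex_data (f \<circ> swap67) (swap67 (Od F F T F))"
      by (intro revlex_data_comp) (simp_all add: par symmetry_swap67)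
    then interpret s: revlex_adjacent "f \<circ> swap67"
      unfolding revlex_adjacent_def by (intro revlex_dataI) simp
    show False
      using s.mixed octet_TT_even[OF 2(2)] octet_TF_odd[OF 2(1)] by (simp add: symmetry_min_pair[OF symmetry_swap67])
  qed
qed

text \<open>
  Swapping the edges of the paths brings the smallest odd variable to one of two positions.
\<close>

lemma revlex_data_False: "\<not> revlex_data f v"
proof
  assume d: "revlex_data f v"
  obtain a b x y where v: "v = Od a b x y" using d unfolding revlex_data_def by (cases v) auto
  obtain f1 where 1: "revlex_data f1 (Od F b x y)"
    using d revlex_data_swaps(1)[OF d] unfolding v by (cases a) auto
  obtain f2 where 2: "revlex_data f2 (Od F F x y)"
    using 1 revlex_data_swaps(2)[OF 1] by (cases b) auto
  obtain f3 where 3: "revlex_data f3 (Od F F T T) \<or> revlex_data f3 (Od F F T F)"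
    using 2 revlex_data_swaps(3)[OF 2] revlex_data_swaps(4)[OF 2] by (cases x; cases y) auto
  then show False
  proof
    assume "revlex_data f3 (Od F F T T)"
    then interpret revlex_antipodal f3 unfolding revlex_antipodal_def by (rule revlex_dataI)
    show False by (rule contradiction)
  next
    assume "revlex_data f3 (Od F F T F)"
    then interpret revlex_adjacent f3 unfolding revlex_adjacent_def by (rule revlex_dataI)
    show False by (rule contradiction)
  qed
qed

theorem no_revlex:
  fixes f :: "cut \<Rightarrow> nat"
  assumes "inj f" shows "\<not> unique_cubics (min_pair f)"
proof
  assume uc: "unique_cubics (min_pair f)"
  obtain m where m: "\<And>u. f m \<le> f u" using ex_min[of _ UNIV f] by blast
  let ?g = "f \<circ> translate m"
  have sym: "symmetry (translate m)" by (rule symmetry_translate)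
  have "translate m (Ev F F F F) = m" by (cases m) simp
  then have g0: "?g (Ev F F F F) \<le> ?g u" for u using m by simp
  have "Od F F F F \<in> {u. par u}" by simp
  then obtain v where "par v" "\<And>u. par u \<Longrightarrow> ?g v \<le> ?g u" using ex_min[of _ "{u. par u}" ?g] by blast
  then have "revlex_data ?g v"
    unfolding revlex_data_def using g0 inj_comp_symmetry[OF sym assms] unique_cubics_comp[OF sym uc] by blast
  then show False using revlex_data_False by blast
qed

section \<open>Monomials as multisets of cuts\<close>

lemma UNIV_cuts: "(UNIV :: cut set) = set cuts" using set_cuts by auto

instance cut :: finite by standard (metis UNIV_cuts List.finite_set)

text \<open>
  The enumeration of the cut vectors is arbitrary, so the position of a cut among the
  variables is a parameter.
\<close>

locale cut_numbering =
  fixes idx :: "cut \<Rightarrow> nat" and A :: "int mat" and n :: nat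
  assumes idx: "bij_betw idx UNIV {..<n}"
    and dims: "dim_col A = n" "dim_row A = 8"
    and entries: "\<And>u i. i < 7 \<Longrightarrow> col A (idx u) $ i = of_bool ((coords ! i) u)"
    and last_row: "\<And>u. col A (idx u) $ 7 = 1"
begin

definition cut_mon :: "cut multiset \<Rightarrow> mon" where
  "cut_mon M = (\<Sum>u\<in>#M. Poly_Mapping.single (idx u) 1)"

lemma idx_eq [simp]: "idx u = idx v \<longleftrightarrow> u = v"
  using idx by (auto simp: bij_betw_def inj_eq)

lemma idx_less: "idx u < n" using idx by (auto simp: bij_betw_def)

lemma idx_surj: "j < n \<Longrightarrow> \<exists>u. j = idx u"
  using idx unfolding bij_betw_def by (metis imageE lessThan_iff)

lemma cut_mon_empty [simp]: "cut_mon {#} = 0" by (simp add: cut_mon_def)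
lemma cut_mon_add_mset: "cut_mon (add_mset u M) = Poly_Mapping.single (idx u) 1 + cut_mon M" by (simp add: cut_mon_def)
lemma cut_mon_add: "cut_mon (M + N) = cut_mon M + cut_mon N" by (simp add: cut_mon_def)

lemma lookup_cut_mon [simp]: "Poly_Mapping.lookup (cut_mon M) (idx u) = count M u"
  by (induction M) (auto simp: cut_mon_add_mset lookup_add lookup_single when_def)

lemma cut_mon_monomials: "cut_mon M \<in> monomials n"
proof (induction M)
  case empty
  show ?case by (simp add: monomials_def)
next
  case (add u M)
  have "Poly_Mapping.single (idx u) 1 \<in> monomials n" using idx_less by (simp add: monomials_def)
  then show ?case unfolding cut_mon_add_mset using add by (rule monomials_add)
qed

lemma cut_mon_inj [simp]: "cut_mon M = cut_mon N \<longleftrightarrow> M = N"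
  by (metis lookup_cut_mon multiset_eqI)

lemma cut_mon_surj: assumes "u \<in> monomials n" obtains M where "u = cut_mon M"
proof -
  define M where "M = (\<Sum>v\<in>UNIV. replicate_mset (Poly_Mapping.lookup u (idx v)) v)"
  have M: "count M v = Poly_Mapping.lookup u (idx v)" for v
    unfolding M_def count_sum by (simp add: count_replicate_mset)
  have "Poly_Mapping.lookup u j = Poly_Mapping.lookup (cut_mon M) j" for j
  proof (cases "j < n")
    case True
    then obtain v where "j = idx v" using idx_surj by blast
    then show ?thesis using M by simp
  next
    case False
    then have "j \<notin> Poly_Mapping.keys u" "j \<notin> Poly_Mapping.keys (cut_mon M)"
      using assms cut_mon_monomials[of M] unfolding monomials_def by auto
    then show ?thesis by (simp add: in_keys_iff)
  qed
  then show ?thesis using that by (metis poly_mapping_eqI)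
qed

lemma sum_keys_cut_mon:
  fixes g :: "nat \<Rightarrow> 'b::comm_semiring_1"
  shows "(\<Sum>j\<in>Poly_Mapping.keys (cut_mon M). of_nat (Poly_Mapping.lookup (cut_mon M) j) * g j) = (\<Sum>u\<in>#M. g (idx u))"
proof -
  have "(\<Sum>j\<in>Poly_Mapping.keys (cut_mon M). of_nat (Poly_Mapping.lookup (cut_mon M) j) * g j) =
      (\<Sum>j<n. of_nat (Poly_Mapping.lookup (cut_mon M) j) * g j)"
    using cut_mon_monomials[of M] by (intro sum.mono_neutral_left) (auto simp: monomials_def in_keys_iff)
  also have "\<dots> = (\<Sum>u\<in>UNIV. of_nat (count M u) * g (idx u))"
    using sum.reindex_bij_betw[OF idx, of "\<lambda>j. of_nat (Poly_Mapping.lookup (cut_mon M) j) * g j"] by simp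
  also have "\<dots> = (\<Sum>u\<in>#M. g (idx u))"
  proof (induction M)
    case (add v M)
    have "of_nat (count (add_mset v M) u) * g (idx u) = of_nat (count M u) * g (idx u) + (if u = v then g (idx v) else 0)" for u
      by (simp add: distrib_right add.commute)
    then have "(\<Sum>u\<in>UNIV. of_nat (count (add_mset v M) u) * g (idx u)) = (\<Sum>u\<in>UNIV. of_nat (count M u) * g (idx u)) + g (idx v)"
      by (simp only: sum.distrib) simp
    then show ?case using add by (simp add: add.commute)
  qed simp
  finally show ?thesis .
qed

lemma mon_degree_cut_mon [simp]: "mon_degree (cut_mon M) = size M"
proof -
  have "(\<Sum>u\<in>#M. 1 :: nat) = size M" by (induction M) auto
  then show ?thesis using sum_keys_cut_mon[of M "\<lambda>_. 1 :: nat"] unfolding mon_degree_def by simp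
qed

lemma sum_of_bool: "(\<Sum>u\<in>#M. of_bool (P u)) = int (size (filter_mset P M))"
  by (induction M) auto

lemma torus_degree_cut_mon: "torus_degree A (cut_mon M) = torus_degree A (cut_mon N) \<longleftrightarrow> M \<approx> N"
proof -
  have l: "Poly_Mapping.lookup (torus_degree A (cut_mon K)) i =
     (if i < 7 then int (size (filter_mset (coords ! i) K)) else if i = 7 then int (size K) else 0)" for K i
  proof -
    have "Poly_Mapping.lookup (torus_degree A (cut_mon K)) i = (if i < 8 then \<Sum>u\<in>#K. col A (idx u) $ i else 0)"
      unfolding lookup_torus_degree dims using sum_keys_cut_mon[of K "\<lambda>j. col A j $ i"] by simp
    moreover have "(\<Sum>u\<in>#K. col A (idx u) $ 7) = int (size K)" unfolding last_row by (induction K) auto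
    ultimately show ?thesis using entries[of i] by (cases "i < 7"; cases "i = 7") (auto simp: sum_of_bool)
  qed
  have len: "length coords = 7" by (simp add: coords_def)
  show ?thesis
  proof
    assume eq: "torus_degree A (cut_mon M) = torus_degree A (cut_mon N)"
    have "size M = size N" using l[of M 7] l[of N 7] eq by simp
    moreover have "size (filter_mset (coords ! i) M) = size (filter_mset (coords ! i) N)" if "i < 7" for i
      using l[of M i] l[of N i] eq that by simp
    ultimately show "M \<approx> N" unfolding same_fibre_def by (metis in_set_conv_nth len)
  next
    assume "M \<approx> N"
    then have "Poly_Mapping.lookup (torus_degree A (cut_mon M)) i = Poly_Mapping.lookup (torus_degree A (cut_mon N)) i" for i
      unfolding l same_fibre_def using len nth_mem[of i coords] by auto
    then show "torus_degree A (cut_mon M) = torus_degree A (cut_mon N)" by (rule poly_mapping_eqI)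
  qed
qed

lemma reducible_cut_mon:
  "quadratically_reducible n ord A (cut_mon M) \<longleftrightarrow>
     (\<exists>P Q. P \<subseteq># M \<and> size P = 2 \<and> P \<approx> Q \<and> P \<noteq> Q \<and> (cut_mon Q, cut_mon P) \<in> ord)"
proof
  assume "quadratically_reducible n ord A (cut_mon M)"
  then obtain a b w where *: "cut_mon M = a + w" "w \<in> monomials n" "a \<in> monomials n" "b \<in> monomials n"
      "mon_degree a = 2" "torus_degree A a = torus_degree A b" "a \<noteq> b" "(b, a) \<in> ord"
    unfolding quadratically_reducible_def by blast
  obtain P Q R where PQR: "a = cut_mon P" "b = cut_mon Q" "w = cut_mon R" using cut_mon_surj *(2,3,4) by metis
  have "M = P + R" using *(1) unfolding PQR by (metis cut_mon_add cut_mon_inj)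
  then show "\<exists>P Q. P \<subseteq># M \<and> size P = 2 \<and> P \<approx> Q \<and> P \<noteq> Q \<and> (cut_mon Q, cut_mon P) \<in> ord"
    using * unfolding PQR torus_degree_cut_mon by (intro exI[of _ P] exI[of _ Q]) auto
next
  assume "\<exists>P Q. P \<subseteq># M \<and> size P = 2 \<and> P \<approx> Q \<and> P \<noteq> Q \<and> (cut_mon Q, cut_mon P) \<in> ord"
  then obtain P Q where PQ: "P \<subseteq># M" "size P = 2" "P \<approx> Q" "P \<noteq> Q" "(cut_mon Q, cut_mon P) \<in> ord" by blast
  have "cut_mon M = cut_mon P + cut_mon (M - P)" using PQ(1) by (simp flip: cut_mon_add)
  moreover have "size Q = 2" using PQ(2,3) by (simp add: same_fibre_def)
  ultimately show "quadratically_reducible n ord A (cut_mon M)"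
    unfolding quadratically_reducible_def using PQ cut_mon_monomials torus_degree_cut_mon
    by (intro exI[of _ "cut_mon P"] exI[of _ "cut_mon Q"] exI[of _ "cut_mon (M - P)"]) auto
qed

text \<open>
  Of two cubics in a fibre the larger one is reducible, hence contains a pair that is not
  least. The predicate \<open>S\<close> only has to imply that a pair is least.
\<close>

lemma unique_cubics_if_gb:
  assumes gb: "has_quadratic_groebner_basis n ord (toric_ideal A :: 'k::field mpoly set)"
    and ord: "refl_on (monomials n) ord" "antisym ord" "total_on (monomials n) ord"
    and least: "\<And>u v s t. S u v \<Longrightarrow> {#u, v#} \<approx> {#s, t#} \<Longrightarrow> {#s, t#} \<noteq> {#u, v#} \<Longrightarrow> (cut_mon {#s, t#}, cut_mon {#u, v#}) \<notin> ord"
  shows "unique_cubics S"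
proof -
  have reduces: "\<exists>P Q. P \<subseteq># M \<and> size P = 2 \<and> P \<approx> Q \<and> P \<noteq> Q \<and> (cut_mon Q, cut_mon P) \<in> ord"
    if "M \<approx> N" "M \<noteq> N" "(cut_mon N, cut_mon M) \<in> ord" for M N
  proof -
    have hom: "mon_degree u = mon_degree v" if uv: "u \<in> monomials (dim_col A)" "v \<in> monomials (dim_col A)"
      "torus_degree A u = torus_degree A v" for u v
    proof -
      obtain K L where KL: "u = cut_mon K" "v = cut_mon L" using cut_mon_surj uv(1,2) dims(1) by metis
      show ?thesis using uv(3) unfolding KL torus_degree_cut_mon by (simp add: same_fibre_def)
    qed
    have "quadratically_reducible (dim_col A) ord A (cut_mon M)"
    proof (rule quadratic_gb_reduces)
      show "has_quadratic_groebner_basis (dim_col A) ord (toric_ideal A :: 'k mpoly set)" unfolding dims(1) by (rule gb)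
      show "refl_on (monomials (dim_col A)) ord" "antisym ord" "total_on (monomials (dim_col A)) ord"
        unfolding dims(1) by (rule ord)+
      show "mon_degree u = mon_degree v" if "u \<in> monomials (dim_col A)" "v \<in> monomials (dim_col A)"
        "torus_degree A u = torus_degree A v" for u v using hom that by blast
      show "cut_mon M \<in> monomials (dim_col A)" "cut_mon N \<in> monomials (dim_col A)" unfolding dims(1) by (rule cut_mon_monomials)+
      show "torus_degree A (cut_mon M) = torus_degree A (cut_mon N)" using that(1) by (simp add: torus_degree_cut_mon)
      show "cut_mon M \<noteq> cut_mon N" "(cut_mon N, cut_mon M) \<in> ord" using that by simp_all
    qed
    then show ?thesis unfolding dims(1) reducible_cut_mon .
  qed
  have irreducible: False if c: "clique S u v w" and P: "P \<subseteq># {#u, v, w#}" "size P = 2" "P \<approx> Q" "P \<noteq> Q" "(cut_mon Q, cut_mon P) \<in> ord" for u v w P Q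
  proof -
    have "size ({#u, v, w#} - P) = 1" using P(1,2) by (simp add: size_Diff_submset)
    then obtain x where x: "{#u, v, w#} - P = {#x#}" by (metis size_1_singleton_mset)
    then have eq: "{#u, v, w#} = P + {#x#}" using subset_mset.add_diff_inverse[OF P(1)] by simp
    then have "P = {#u, v, w#} - {#x#}" by (metis add_diff_cancel_right')
    moreover have "x \<in># {#u, v, w#}" unfolding eq by simp
    ultimately consider "P = {#u, v#}" | "P = {#u, w#}" | "P = {#v, w#}" by (auto simp: add_mset_commute)
    then obtain a b where ab: "P = {#a, b#}" "S a b" using c unfolding clique_def by metis
    have "size Q = Suc (Suc 0)" using P(2,3) by (simp add: same_fibre_def)
    then obtain s t where "Q = {#s, t#}" by (metis size_1_singleton_mset One_nat_def size_eq_Suc_imp_eq_union size_Suc_Diff1 add_mset_add_single size_add_mset nat.inject)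
    then show False using least[OF ab(2), of s t] P(3,4,5) unfolding ab(1) by auto
  qed
  show ?thesis unfolding unique_cubics_def
  proof (intro allI impI, rule ccontr)
    fix u v w u' v' w'
    assume *: "clique S u v w" "clique S u' v' w'" "{#u, v, w#} \<approx> {#u', v', w'#}" "{#u, v, w#} \<noteq> {#u', v', w'#}"
    have "(cut_mon {#u', v', w'#}, cut_mon {#u, v, w#}) \<in> ord \<or> (cut_mon {#u, v, w#}, cut_mon {#u', v', w'#}) \<in> ord"
      using ord(3) cut_mon_monomials *(4) unfolding total_on_def by (metis cut_mon_inj)
    then show False
    proof
      assume "(cut_mon {#u', v', w'#}, cut_mon {#u, v, w#}) \<in> ord"
      then show False using reduces[OF *(3,4)] irreducible[OF *(1)] by blast
    next
      assume "(cut_mon {#u, v, w#}, cut_mon {#u', v', w'#}) \<in> ord"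
      then show False using reduces[OF fibre_sym[OF *(3)]] *(4) irreducible[OF *(2)] by metis
    qed
  qed
qed

end

section \<open>Lexicographic and reverse lexicographic orders by ranks\<close>

text \<open>
  Ranks turn an order on the variables into a comparison of natural numbers.
\<close>

definition rank :: "nat \<Rightarrow> nat rel \<Rightarrow> nat \<Rightarrow> nat" where
  "rank n r i = card {j \<in> {..<n}. (j, i) \<in> r}"

lemma rank_le_iff:
  assumes "linear_order_on {..<n} r" "i < n" "j < n"
  shows "rank n r i \<le> rank n r j \<longleftrightarrow> (i, j) \<in> r"
proof -
  have r: "refl_on {..<n} r" "trans r" "antisym r" "total_on {..<n} r" using assms(1) by (auto simp: order_on_defs)
  have le: "rank n r a \<le> rank n r b" if "(a, b) \<in> r" for a b
    unfolding rank_def using that r(2) by (intro card_mono) (auto dest: transD)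
  have "rank n r j < rank n r i" if nij: "(i, j) \<notin> r"
  proof -
    have "i \<noteq> j" using nij r(1) assms(2) by (auto simp: refl_on_def)
    then have ji: "(j, i) \<in> r" using r(4) nij assms(2,3) unfolding total_on_def by blast
    have "{k \<in> {..<n}. (k, j) \<in> r} \<subset> {k \<in> {..<n}. (k, i) \<in> r}"
    proof
      show "{k \<in> {..<n}. (k, j) \<in> r} \<subseteq> {k \<in> {..<n}. (k, i) \<in> r}" using ji r(2) by (auto dest: transD)
      have "i \<in> {k \<in> {..<n}. (k, i) \<in> r}" using assms(2) r(1) by (auto simp: refl_on_def)
      moreover have "i \<notin> {k \<in> {..<n}. (k, j) \<in> r}" using nij by simp
      ultimately show "{k \<in> {..<n}. (k, j) \<in> r} \<noteq> {k \<in> {..<n}. (k, i) \<in> r}" by blast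
    qed
    then show ?thesis unfolding rank_def by (intro psubset_card_mono) auto
  qed
  then show ?thesis using le by (meson not_le)
qed

lemma rank_eq_iff:
  assumes "linear_order_on {..<n} r" "i < n" "j < n"
  shows "rank n r i = rank n r j \<longleftrightarrow> i = j"
proof -
  have "antisym r" using assms(1) by (auto simp: order_on_defs)
  then show ?thesis using rank_le_iff[OF assms] rank_le_iff[OF assms(1,3,2)] by (metis antisymD order_refl le_antisym)
qed

lemma lex_order_rank:
  assumes "linear_order_on {..<n} r"
  shows "(u, v) \<in> lex_order n r \<longleftrightarrow> u \<in> monomials n \<and> v \<in> monomials n \<and> (u = v \<or>
      (\<exists>i<n. Poly_Mapping.lookup u i < Poly_Mapping.lookup v i \<and>
         (\<forall>j<n. rank n r i < rank n r j \<longrightarrow> Poly_Mapping.lookup u j = Poly_Mapping.lookup v j)))"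
proof -
  have "(j \<noteq> i \<and> (i, j) \<in> r) = (rank n r i < rank n r j)" if "i < n" "j < n" for i j
    using rank_le_iff[OF assms that] rank_eq_iff[OF assms that] rank_le_iff[OF assms that(2,1)] by auto
  then have "(\<forall>j<n. j \<noteq> i \<and> (i, j) \<in> r \<longrightarrow> P j) = (\<forall>j<n. rank n r i < rank n r j \<longrightarrow> P j)" if "i < n" for i P
    using that by blast
  then have "(\<exists>i<n. P i \<and> (\<forall>j<n. j \<noteq> i \<and> (i, j) \<in> r \<longrightarrow> R j)) = (\<exists>i<n. P i \<and> (\<forall>j<n. rank n r i < rank n r j \<longrightarrow> R j))" for P R
    by blast
  then show ?thesis unfolding lex_order_def by simp
qed

lemma grevlex_order_rank:
  assumes "linear_order_on {..<n} r"
  shows "(u, v) \<in> grevlex_order n r \<longleftrightarrow> u \<in> monomials n \<and> v \<in> monomials n \<and>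
      (u = v \<or> mon_degree u < mon_degree v \<or> mon_degree u = mon_degree v \<and>
      (\<exists>i<n. Poly_Mapping.lookup v i < Poly_Mapping.lookup u i \<and>
         (\<forall>j<n. rank n r j < rank n r i \<longrightarrow> Poly_Mapping.lookup u j = Poly_Mapping.lookup v j)))"
proof -
  have "(j \<noteq> i \<and> (j, i) \<in> r) = (rank n r j < rank n r i)" if "i < n" "j < n" for i j
    using rank_le_iff[OF assms that(2,1)] rank_eq_iff[OF assms that(2,1)] rank_le_iff[OF assms that] by auto
  then have "(\<forall>j<n. j \<noteq> i \<and> (j, i) \<in> r \<longrightarrow> P j) = (\<forall>j<n. rank n r j < rank n r i \<longrightarrow> P j)" if "i < n" for i P
    using that by blast
  then have "(\<exists>i<n. P i \<and> (\<forall>j<n. j \<noteq> i \<and> (j, i) \<in> r \<longrightarrow> R j)) = (\<exists>i<n. P i \<and> (\<forall>j<n. rank n r j < rank n r i \<longrightarrow> R j))" for P R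
    by blast
  then show ?thesis unfolding grevlex_order_def by simp
qed

lemma monomials_differ:
  assumes "u \<in> monomials n" "v \<in> monomials n" "u \<noteq> v"
  shows "\<exists>i<n. Poly_Mapping.lookup u i \<noteq> Poly_Mapping.lookup v i"
proof (rule ccontr)
  assume same: "\<not> ?thesis"
  then have "Poly_Mapping.lookup u i = Poly_Mapping.lookup v i" for i
  proof (cases "i < n")
    case False
    then have "i \<notin> Poly_Mapping.keys u" "i \<notin> Poly_Mapping.keys v" using assms(1,2) by (auto simp: monomials_def)
    then show ?thesis by (simp add: in_keys_iff)
  qed (use same in blast)
  then show False using assms(3) by (metis poly_mapping_eqI)
qed

lemma lex_order_props:
  assumes r: "linear_order_on {..<n} r"
  shows "refl_on (monomials n) (lex_order n r)" "antisym (lex_order n r)" "total_on (monomials n) (lex_order n r)"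
proof -
  show "refl_on (monomials n) (lex_order n r)" by (auto simp: refl_on_def lex_order_def)
  show "antisym (lex_order n r)"
  proof (rule antisymI, rule ccontr)
    fix u v assume "(u, v) \<in> lex_order n r" "(v, u) \<in> lex_order n r" "u \<noteq> v"
    then obtain i k where ik: "i < n" "Poly_Mapping.lookup u i < Poly_Mapping.lookup v i"
      "\<forall>j<n. rank n r i < rank n r j \<longrightarrow> Poly_Mapping.lookup u j = Poly_Mapping.lookup v j"
      "k < n" "Poly_Mapping.lookup v k < Poly_Mapping.lookup u k"
      "\<forall>j<n. rank n r k < rank n r j \<longrightarrow> Poly_Mapping.lookup v j = Poly_Mapping.lookup u j"
      unfolding lex_order_rank[OF r] by auto
    consider "rank n r i < rank n r k" | "rank n r k < rank n r i" | "i = k"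
      using rank_eq_iff[OF r ik(1,4)] by linarith
    then show False using ik by cases auto
  qed
  show "total_on (monomials n) (lex_order n r)"
    unfolding total_on_def
  proof (intro ballI impI)
    fix u v assume uv: "u \<in> monomials n" "v \<in> monomials n" "u \<noteq> v"
    let ?D = "{i. i < n \<and> Poly_Mapping.lookup u i \<noteq> Poly_Mapping.lookup v i}"
    have "rank n r i < Suc n" for i
    proof -
      have "rank n r i \<le> card {..<n}" unfolding rank_def by (rule card_mono) auto
      then show ?thesis by simp
    qed
    then obtain i where i: "i \<in> ?D" "\<And>j. j \<in> ?D \<Longrightarrow> rank n r j \<le> rank n r i"
      using monomials_differ[OF uv] ex_has_greatest_nat[of "\<lambda>i. i \<in> ?D" _ "rank n r" "Suc n"] by blast
    then have above: "\<forall>j<n. rank n r i < rank n r j \<longrightarrow> Poly_Mapping.lookup u j = Poly_Mapping.lookup v j"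
      using not_le by blast
    have "i < n" "Poly_Mapping.lookup u i < Poly_Mapping.lookup v i \<or> Poly_Mapping.lookup v i < Poly_Mapping.lookup u i"
      using i(1) by auto
    then show "(u, v) \<in> lex_order n r \<or> (v, u) \<in> lex_order n r"
      unfolding lex_order_rank[OF r] using uv above by fastforce
  qed
qed

lemma grevlex_order_props:
  assumes r: "linear_order_on {..<n} r"
  shows "refl_on (monomials n) (grevlex_order n r)" "antisym (grevlex_order n r)" "total_on (monomials n) (grevlex_order n r)"
proof -
  show "refl_on (monomials n) (grevlex_order n r)" by (auto simp: refl_on_def grevlex_order_def)
  show "antisym (grevlex_order n r)"
  proof (rule antisymI, rule ccontr)
    fix u v assume a: "(u, v) \<in> grevlex_order n r" and b: "(v, u) \<in> grevlex_order n r" and neq: "u \<noteq> v"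
    have deg: "mon_degree x \<le> mon_degree y" if "(x, y) \<in> grevlex_order n r" for x y
      using that unfolding grevlex_order_def by auto
    have eq: "mon_degree u = mon_degree v" using deg[OF a] deg[OF b] by simp
    have strict: "\<exists>i<n. Poly_Mapping.lookup y i < Poly_Mapping.lookup x i \<and>
         (\<forall>j<n. rank n r j < rank n r i \<longrightarrow> Poly_Mapping.lookup x j = Poly_Mapping.lookup y j)"
      if "(x, y) \<in> grevlex_order n r" "x \<noteq> y" "mon_degree x = mon_degree y" for x y
      using that unfolding grevlex_order_rank[OF r] by simp
    obtain i where i: "i < n" "Poly_Mapping.lookup v i < Poly_Mapping.lookup u i"
      "\<forall>j<n. rank n r j < rank n r i \<longrightarrow> Poly_Mapping.lookup u j = Poly_Mapping.lookup v j"
      using strict[OF a neq eq] by blast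
    obtain k where k: "k < n" "Poly_Mapping.lookup u k < Poly_Mapping.lookup v k"
      "\<forall>j<n. rank n r j < rank n r k \<longrightarrow> Poly_Mapping.lookup v j = Poly_Mapping.lookup u j"
      using strict[OF b neq[symmetric] eq[symmetric]] by blast
    note ik = i k
    consider "rank n r i < rank n r k" | "rank n r k < rank n r i" | "i = k"
      using rank_eq_iff[OF r ik(1,4)] by linarith
    then show False using ik by cases auto
  qed
  show "total_on (monomials n) (grevlex_order n r)"
    unfolding total_on_def
  proof (intro ballI impI)
    fix u v assume uv: "u \<in> monomials n" "v \<in> monomials n" "u \<noteq> v"
    let ?D = "{i. i < n \<and> Poly_Mapping.lookup u i \<noteq> Poly_Mapping.lookup v i}"
    obtain i where i: "i \<in> ?D" "\<And>j. j \<in> ?D \<Longrightarrow> rank n r i \<le> rank n r j"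
      using monomials_differ[OF uv] ex_has_least_nat[of "\<lambda>i. i \<in> ?D" _ "rank n r"] by blast
    then have below: "\<forall>j<n. rank n r j < rank n r i \<longrightarrow> Poly_Mapping.lookup u j = Poly_Mapping.lookup v j"
      using not_le by blast
    have "i < n" "Poly_Mapping.lookup u i < Poly_Mapping.lookup v i \<or> Poly_Mapping.lookup v i < Poly_Mapping.lookup u i"
      using i(1) by auto
    moreover have "mon_degree u < mon_degree v \<or> mon_degree v < mon_degree u \<or> mon_degree u = mon_degree v" by linarith
    ultimately show "(u, v) \<in> grevlex_order n r \<or> (v, u) \<in> grevlex_order n r"
      unfolding grevlex_order_rank[OF r] using uv below by fastforce
  qed
qed

section \<open>Groebner bases of the cut ideal\<close>

context cut_numbering
begin

definition mon_weight :: "mon \<Rightarrow> int" where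
  "mon_weight u = (\<Sum>v\<in>UNIV. int (Poly_Mapping.lookup u (idx v)) * wt v)"

text \<open>
  Ties between equal weights are broken by the order on exponent functions, which is
  compatible with addition.
\<close>

definition weight_order :: "mon rel" where
  "weight_order = {(u, v). u \<in> monomials n \<and> v \<in> monomials n \<and>
     (mon_weight u < mon_weight v \<or> mon_weight u = mon_weight v \<and> u \<le> v)}"

lemma mon_weight_add: "mon_weight (u + v) = mon_weight u + mon_weight v"
  by (simp add: mon_weight_def lookup_add distrib_right sum.distrib)

lemma mon_weight_cut_mon: "mon_weight (cut_mon M) = weight M"
proof (induction M)
  case (add u M)
  have "mon_weight (Poly_Mapping.single (idx u) 1) = (\<Sum>v\<in>UNIV. if v = u then wt v else 0)"
    unfolding mon_weight_def by (rule sum.cong) (auto simp: lookup_single when_def)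
  then show ?case using add by (simp add: cut_mon_add_mset mon_weight_add weight_def)
qed (simp add: mon_weight_def weight_def)

lemma mon_weight_nonneg: "0 \<le> mon_weight u"
  unfolding mon_weight_def by (intro sum_nonneg) (simp add: wt_nonneg)

lemma zero_le_mon: "0 \<le> (u :: mon)"
proof (cases "u = 0")
  case False
  then have "\<exists>k. Poly_Mapping.lookup u k \<noteq> 0" by (metis lookup_zero poly_mapping_eqI)
  then have "less_fun (Poly_Mapping.lookup 0) (Poly_Mapping.lookup u)"
    by (intro less_funI exI[of _ "LEAST k. Poly_Mapping.lookup u k \<noteq> 0"])
      (metis (mono_tags, lifting) LeastI_ex gr0I lookup_zero not_less_Least)
  then show ?thesis by (simp add: less_imp_le less_poly_mapping.rep_eq)
qed simp

lemma monomial_order_weight: "monomial_order n weight_order"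
  unfolding monomial_order_def
proof (intro conjI ballI allI impI)
  show "linear_order_on (monomials n) weight_order"
    unfolding order_on_defs
  proof (intro conjI)
    show "refl_on (monomials n) weight_order" by (auto simp: refl_on_def weight_order_def)
    show "trans weight_order" by (rule transI) (auto simp: weight_order_def)
    show "antisym weight_order" by (rule antisymI) (auto simp: weight_order_def)
    show "total_on (monomials n) weight_order" by (auto simp: total_on_def weight_order_def)
    show "weight_order \<subseteq> monomials n \<times> monomials n" by (auto simp: weight_order_def)
  qed
next
  fix u assume "u \<in> monomials n"
  moreover have "mon_weight 0 = 0" by (simp add: mon_weight_def)
  ultimately show "(0, u) \<in> weight_order"
    using mon_weight_nonneg[of u] zero_le_mon[of u] by (auto simp: weight_order_def monomials_def)
next
  fix u v w assume "w \<in> monomials n" "(u, v) \<in> weight_order"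
  then show "(u + w, v + w) \<in> weight_order"
    by (auto simp: weight_order_def mon_weight_add monomials_add)
qed

end

context cut_numbering
begin

text \<open>
  The irreducible monomial of a fibre is reached from every other one by rewriting, hence has
  strictly smaller weight.
\<close>

lemma weight_order_gb: "has_quadratic_groebner_basis n weight_order (toric_ideal A :: 'k::field mpoly set)"
proof -
  have "quadratically_reducible n weight_order A u"
    if u: "u \<in> monomials n" and v: "v \<in> monomials n" and eq: "torus_degree A u = torus_degree A v"
      and neq: "u \<noteq> v" and ord: "(v, u) \<in> weight_order" for u v
  proof -
    obtain M N where M: "u = cut_mon M" and N: "v = cut_mon N" using cut_mon_surj u v by metis
    have MN: "M \<approx> N" using eq unfolding M N torus_degree_cut_mon .
    have le: "weight N \<le> weight M" using ord unfolding M N weight_order_def by (auto simp: mon_weight_cut_mon)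
    have "\<not> normal M"
    proof
      assume M': "normal M"
      obtain V where V: "step\<^sup>*\<^sup>* N V" "normal V" using normal_form_exists by blast
      have "M \<approx> V" using MN steps_fibre[OF V(1)] fibre_trans by blast
      then have "step\<^sup>*\<^sup>* N M" using normal_unique[OF M' V(2)] V(1) by simp
      then obtain N' where "step N N'" "step\<^sup>*\<^sup>* N' M" using neq M N by (metis converse_rtranclpE)
      then show False using step_weight steps_weight le by fastforce
    qed
    then obtain P Q where PQ: "P \<subseteq># M" "size P = 2" "P \<approx> Q" "weight Q < weight P" unfolding normal_def by force
    then have "(cut_mon Q, cut_mon P) \<in> weight_order" by (simp add: weight_order_def cut_mon_monomials mon_weight_cut_mon)
    moreover have "P \<noteq> Q" using PQ(4) by auto
    ultimately show ?thesis unfolding M reducible_cut_mon using PQ by blast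
  qed
  then show ?thesis
    using quadratic_gb_if_reduces[of A weight_order, where 'k = 'k] monomial_order_weight unfolding dims(1) by blast
qed

text \<open>
  A common cut could be cancelled.
\<close>

lemma pair_disjoint:
  assumes "{#u, v#} \<approx> {#s, t#}" "{#s, t#} \<noteq> {#u, v#}" "x \<in> {u, v}"
  shows "x \<noteq> s" "x \<noteq> t"
proof -
  have uv: "opp u v u = v" "opp u v v = u" by (cases u; cases v; auto)+
  have st: "t = opp u v s" "s = opp u v t"
    using assms(1) pair_fibre_iff[of u v s t] pair_fibre_iff[of u v t s] by (simp_all add: add_mset_commute)
  have "(s = u \<longrightarrow> t = v) \<and> (s = v \<longrightarrow> t = u)" using st(1) uv by metis
  moreover have "(t = u \<longrightarrow> s = v) \<and> (t = v \<longrightarrow> s = u)" using st(2) uv by metis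
  ultimately have "s \<noteq> u \<and> s \<noteq> v \<and> t \<noteq> u \<and> t \<noteq> v" using assms(2) by (metis add_mset_commute)
  then show "x \<noteq> s" "x \<noteq> t" using assms(3) by blast+
qed

lemma no_lex_gb:
  assumes r: "linear_order_on {..<n} r"
  shows "\<not> has_quadratic_groebner_basis n (lex_order n r) (toric_ideal A :: 'k::field mpoly set)"
proof
  assume gb: "has_quadratic_groebner_basis n (lex_order n r) (toric_ideal A :: 'k mpoly set)"
  let ?f = "\<lambda>u. rank n r (idx u)"
  have "inj ?f" using rank_eq_iff[OF r] idx_less by (auto intro!: injI)
  moreover have "unique_cubics (max_pair ?f)"
  proof (rule unique_cubics_if_gb[OF gb lex_order_props[OF r]])
    fix u v s t
    assume max: "max_pair ?f u v" and st: "{#u, v#} \<approx> {#s, t#}" "{#s, t#} \<noteq> {#u, v#}"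
    show "(cut_mon {#s, t#}, cut_mon {#u, v#}) \<notin> lex_order n r"
    proof
      assume "(cut_mon {#s, t#}, cut_mon {#u, v#}) \<in> lex_order n r"
      then obtain i where i: "i < n" "Poly_Mapping.lookup (cut_mon {#s, t#}) i < Poly_Mapping.lookup (cut_mon {#u, v#}) i"
        "\<forall>j<n. rank n r i < rank n r j \<longrightarrow> Poly_Mapping.lookup (cut_mon {#s, t#}) j = Poly_Mapping.lookup (cut_mon {#u, v#}) j"
        unfolding lex_order_rank[OF r] cut_mon_inj using st(2) by blast
      obtain x where x: "i = idx x" using idx_surj i(1) by blast
      have "x \<in> {u, v}" using i(2) unfolding x lookup_cut_mon by (auto split: if_splits)
      moreover obtain q where q: "q \<in> {s, t}" "?f u < ?f q" "?f v < ?f q"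
        using max st unfolding max_pair_def by blast
      ultimately have "rank n r i < ?f q" unfolding x by auto
      then have "count {#s, t#} q = count {#u, v#} q" using i(3) idx_less[of q] lookup_cut_mon by metis
      moreover have "q \<noteq> u" "q \<noteq> v" using q(2,3) by auto
      ultimately show False using q(1) by (auto split: if_splits)
    qed
  qed
  ultimately show False using no_lex by blast
qed

lemma no_grevlex_gb:
  assumes r: "linear_order_on {..<n} r"
  shows "\<not> has_quadratic_groebner_basis n (grevlex_order n r) (toric_ideal A :: 'k::field mpoly set)"
proof
  assume gb: "has_quadratic_groebner_basis n (grevlex_order n r) (toric_ideal A :: 'k mpoly set)"
  let ?f = "\<lambda>u. rank n r (idx u)"
  have inj: "inj ?f" using rank_eq_iff[OF r] idx_less by (auto intro!: injI)
  moreover have "unique_cubics (min_pair ?f)"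
  proof (rule unique_cubics_if_gb[OF gb grevlex_order_props[OF r]])
    fix u v s t
    assume min: "min_pair ?f u v" and st: "{#u, v#} \<approx> {#s, t#}" "{#s, t#} \<noteq> {#u, v#}"
    show "(cut_mon {#s, t#}, cut_mon {#u, v#}) \<notin> grevlex_order n r"
    proof
      assume "(cut_mon {#s, t#}, cut_mon {#u, v#}) \<in> grevlex_order n r"
      then obtain i where i: "i < n" "Poly_Mapping.lookup (cut_mon {#u, v#}) i < Poly_Mapping.lookup (cut_mon {#s, t#}) i"
        "\<forall>j<n. rank n r j < rank n r i \<longrightarrow> Poly_Mapping.lookup (cut_mon {#s, t#}) j = Poly_Mapping.lookup (cut_mon {#u, v#}) j"
        unfolding grevlex_order_rank[OF r] cut_mon_inj using st(2) by auto
      obtain x where x: "i = idx x" using idx_surj i(1) by blast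
      have xst: "x \<in> {s, t}" using i(2) unfolding x lookup_cut_mon by (auto split: if_splits)
      have "{#u, v#} \<approx> {#t, s#}" using st(1) by (simp add: add_mset_commute)
      then have "(?f u \<le> ?f s \<or> ?f v \<le> ?f s) \<and> (?f u \<le> ?f t \<or> ?f v \<le> ?f t)"
        using min st(1) unfolding min_pair_def by blast
      then obtain q where q: "q \<in> {u, v}" "?f q \<le> ?f x" using xst by blast
      have qd: "q \<noteq> s" "q \<noteq> t" using pair_disjoint[OF st q(1)] .
      then have "?f q < ?f x" using q(2) inj xst by (metis empty_iff insert_iff injD le_neq_implies_less)
      then have "count {#s, t#} q = count {#u, v#} q" using i(3) idx_less[of q] lookup_cut_mon unfolding x by metis
      then show False using q(1) qd by (auto split: if_splits)
    qed
  qed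
  ultimately show False using no_revlex by blast
qed

end

section \<open>The graph and its cut matrix\<close>

definition edges :: "nat set list" where
  "edges = [{1,3}, {2,3}, {1,4}, {2,4}, {1,5}, {5,6}, {2,6}]"

definition vec_of :: "cut \<Rightarrow> int vec" where
  "vec_of u = vec 7 (\<lambda>i. of_bool ((coords ! i) u))"

lemma vec_of_inj: "inj vec_of"
proof (rule injI)
  fix u v assume eq: "vec_of u = vec_of v"
  have "(coords ! i) u = (coords ! i) v" if "i < 7" for i
  proof -
    have "vec_of u $ i = vec_of v $ i" using eq by simp
    then show ?thesis using that by (simp add: vec_of_def of_bool_eq_iff)
  qed
  from this[of 0] this[of 1] this[of 2] this[of 4] this[of 5] show "u = v"
    by (cases u; cases v) (auto simp: coords_def)
qed

lemma card_inter_pair: "i \<noteq> j \<Longrightarrow> card (C \<inter> {i, j}) = 1 \<longleftrightarrow> (i \<in> C) \<noteq> (j \<in> C)"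
  by (cases "i \<in> C"; cases "j \<in> C") auto

text \<open>
  An edge is in the cut iff exactly one of its ends is in \<open>C\<close>; the parity of each
  path tells whether its end points 1 and 2 are separated.
\<close>

lemma cut_vector_eq:
  "cut_vector edges C = vec_of (Cut ((1 \<in> C) \<noteq> (2 \<in> C)) ((1 \<in> C) \<noteq> (3 \<in> C)) ((1 \<in> C) \<noteq> (4 \<in> C))
     ((1 \<in> C) \<noteq> (5 \<in> C)) ((5 \<in> C) \<noteq> (6 \<in> C)))"
proof (rule eq_vecI)
  fix i assume "i < dim_vec (vec_of (Cut ((1 \<in> C) \<noteq> (2 \<in> C)) ((1 \<in> C) \<noteq> (3 \<in> C)) ((1 \<in> C) \<noteq> (4 \<in> C))
     ((1 \<in> C) \<noteq> (5 \<in> C)) ((5 \<in> C) \<noteq> (6 \<in> C))))"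
  then have "i < 7" by (simp add: vec_of_def)
  then have "i \<in> {0, 1, 2, 3, 4, 5, 6}" by auto
  then show "cut_vector edges C $ i = vec_of (Cut ((1 \<in> C) \<noteq> (2 \<in> C)) ((1 \<in> C) \<noteq> (3 \<in> C)) ((1 \<in> C) \<noteq> (4 \<in> C))
     ((1 \<in> C) \<noteq> (5 \<in> C)) ((5 \<in> C) \<noteq> (6 \<in> C))) $ i"
    by (elim insertE emptyE; simp add: cut_vector_def vec_of_def edges_def coords_def card_inter_pair del: One_nat_def; argo?)
qed (simp add: cut_vector_def vec_of_def edges_def)

lemma cut_vectors: "cut_vector edges ` Pow {1..6} = range vec_of"
proof
  show "cut_vector edges ` Pow {1..6} \<subseteq> range vec_of" using cut_vector_eq by auto
  show "range vec_of \<subseteq> cut_vector edges ` Pow {1..6}"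
  proof
    fix d assume "d \<in> range vec_of"
    then obtain p a b x y where d: "d = vec_of (Cut p a b x y)" by (metis cut.exhaust rangeE)
    \<comment> \<open>A vertex set with the given cut vector that does not contain vertex 1.\<close>
    let ?C = "(if p then {2} else {}) \<union> (if a then {3} else {}) \<union> (if b then {4} else {}) \<union>
       (if x then {5} else {}) \<union> (if x \<noteq> y then {6::nat} else {})"
    have "?C \<in> Pow {1..6}" by auto
    moreover have "cut_vector edges ?C = d" unfolding cut_vector_eq d by (rule arg_cong[of _ _ vec_of]) auto
    ultimately show "d \<in> cut_vector edges ` Pow {1..6}" by blast
  qed
qed

lemma cut_numbering_exists:
  assumes "cut_enumeration {1..6} edges ds"
  shows "\<exists>idx. cut_numbering idx (cut_matrix edges ds) (length ds)"
proof -
  have ds: "distinct ds" "set ds = range vec_of" using assms unfolding cut_enumeration_def cut_vectors by auto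
  define idx where "idx u = (SOME j. j < length ds \<and> ds ! j = vec_of u)" for u
  have idx: "idx u < length ds" "ds ! idx u = vec_of u" for u
  proof -
    have "\<exists>j. j < length ds \<and> ds ! j = vec_of u" using ds(2) by (metis in_set_conv_nth rangeI)
    from someI_ex[OF this] show "idx u < length ds" "ds ! idx u = vec_of u" unfolding idx_def by auto
  qed
  have "bij_betw idx UNIV {..<length ds}"
  proof (rule bij_betw_imageI)
    show "inj idx" by (rule injI) (metis idx(2) injD vec_of_inj)
    show "range idx = {..<length ds}"
    proof
      show "range idx \<subseteq> {..<length ds}" using idx(1) by auto
      show "{..<length ds} \<subseteq> range idx"
      proof
        fix j assume "j \<in> {..<length ds}"
        then have j: "j < length ds" by simp
        then obtain u where "ds ! j = vec_of u" using ds(2) by (metis nth_mem rangeE)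
        then have "j = idx u" using nth_eq_iff_index_eq[OF ds(1) j idx(1)[of u]] idx(2) by simp
        then show "j \<in> range idx" by blast
      qed
    qed
  qed
  moreover have col: "col (cut_matrix edges ds) (idx u) = vec_of u @\<^sub>v vec_of_list [1]" for u
  proof -
    have len: "length edges + 1 = 8" by (simp add: edges_def)
    have "map (\<lambda>\<delta>. \<delta> @\<^sub>v vec_of_list [1]) ds ! idx u = vec_of u @\<^sub>v vec_of_list [1]"
      using idx by simp
    moreover have "vec_of u @\<^sub>v vec_of_list [1] \<in> carrier_vec 8"
      by (rule carrier_vecI) (simp add: vec_of_def)
    ultimately show ?thesis unfolding cut_matrix_def len using idx(1)[of u]
      by (subst col_mat_of_cols) simp_all
  qed
  moreover have "(vec_of u @\<^sub>v vec_of_list [1]) $ i = of_bool ((coords ! i) u)" if "i < 7" for u i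
    using that by (simp add: vec_of_def)
  moreover have "(vec_of u @\<^sub>v vec_of_list [1]) $ 7 = 1" for u
    by (simp add: vec_of_def)
  ultimately have "cut_numbering idx (cut_matrix edges ds) (length ds)"
    by unfold_locales (simp_all add: cut_matrix_def edges_def)
  then show ?thesis by blast
qed

lemma (in cut_numbering) configuration: "configuration A"
proof -
  have "map_vec real_of_int (col A j) \<bullet> unit_vec 8 7 = 1" if "j < n" for j
  proof -
    obtain u where j: "j = idx u" using idx_surj \<open>j < n\<close> by blast
    have "map_vec real_of_int (col A j) \<bullet> unit_vec 8 7 = map_vec real_of_int (col A j) $ 7"
      by (rule scalar_prod_right_unit) (auto simp: dims(2))
    then show ?thesis using last_row[of u] unfolding j by (simp add: dims(2))
  qed
  then show ?thesis unfolding configuration_def dims by (intro bexI[of _ "unit_vec 8 7"]) auto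
qed

theorem theorem1p7:
  fixes es :: "nat set list"
  assumes "es = [{1,3}, {2,3}, {1,4}, {2,4}, {1,5}, {5,6}, {2,6}]"
  shows "(\<forall>ds. cut_enumeration {1..6} es ds \<longrightarrow>
            configuration (cut_matrix es ds) \<and>
            has_some_quadratic_gb (length ds) (cut_ideal es ds :: 'k::field mpoly set) \<and>
            \<not> has_lex_quadratic_gb (length ds) (cut_ideal es ds :: 'k mpoly set) \<and>
            \<not> has_revlex_quadratic_gb (length ds) (cut_ideal es ds :: 'k mpoly set)) \<and>
         \<not> lex_revlex_conjecture TYPE('k)"
proof
  have es: "es = edges" using assms by (simp add: edges_def)
  show all: "\<forall>ds. cut_enumeration {1..6} es ds \<longrightarrow>
            configuration (cut_matrix es ds) \<and>
            has_some_quadratic_gb (length ds) (cut_ideal es ds :: 'k mpoly set) \<and>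
            \<not> has_lex_quadratic_gb (length ds) (cut_ideal es ds :: 'k mpoly set) \<and>
            \<not> has_revlex_quadratic_gb (length ds) (cut_ideal es ds :: 'k mpoly set)"
  proof (intro allI impI)
    fix ds assume "cut_enumeration {1..6} es ds"
    then obtain idx where "cut_numbering idx (cut_matrix es ds) (length ds)"
      using cut_numbering_exists unfolding es by blast
    then interpret cut_numbering idx "cut_matrix es ds" "length ds" .
    show "configuration (cut_matrix es ds) \<and>
            has_some_quadratic_gb (length ds) (cut_ideal es ds :: 'k mpoly set) \<and>
            \<not> has_lex_quadratic_gb (length ds) (cut_ideal es ds :: 'k mpoly set) \<and>
            \<not> has_revlex_quadratic_gb (length ds) (cut_ideal es ds :: 'k mpoly set)"
      unfolding cut_ideal_def has_some_quadratic_gb_def has_lex_quadratic_gb_def has_revlex_quadratic_gb_def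
      using configuration monomial_order_weight weight_order_gb no_lex_gb no_grevlex_gb by blast
  qed
  have "finite (cut_vector es ` Pow {1..6})" by simp
  then obtain ds where ds: "cut_enumeration {1..6} es ds"
    unfolding cut_enumeration_def using finite_distinct_list by metis
  have "dim_col (cut_matrix es ds) = length ds" by (simp add: cut_matrix_def)
  then show "\<not> lex_revlex_conjecture TYPE('k)"
    using all ds unfolding lex_revlex_conjecture_def cut_ideal_def by metis
qed

end
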